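(* Let $E$ be a (real) Banach lattice with order continuous norm and let $\mathcal{T} = (T_t)_{t \in (0,\infty)}$ be a bounded and positive one-parameter semigroup on $E$. Assume that for some $s >0$ the operator $T_s$ is a kernel operator and that $\mathcal{T}$ possesses a quasi-interior fixed point. Then $\mathcal{T}$ is strongly convergent, i.e. $\lim_{t\to\infty}T_tx$ exists in norm for every $x\in E$.
   Context: A one-parameter semigroup on a Banach space $E$ is a family $(T_t)_{t\in(0,\infty)}\subseteq\mathcal L(E)$ with $T_{t+s}=T_tT_s$ for all $t,s>0$ (no continuity or measurability in $t$ is assumed). It is bounded if $\sup_{t>0}\|T_t\|<\infty$ and positive if each $T_t$ is a positive operator. A vector $y\in E_+$ is a quasi-interior point of $E_+$ if the principal ideal $E_y=\{g\in E:\exists c\ge0,\ |g|\le cy\}$ is dense in $E$; a quasi-interior fixed point of $\mathcal T$ is such a $y$ with $T_ty=y$ for all $t>0$. For Banach lattices $E,F$ with $F$ order complete, $\mathcal L^r(E,F)$ denotes the order complete vector lattice of regular operators (the linear span of the positive operators from $E$ to $F$), and $E'\otimes F$ denotes the space of finite rank operators from $E$ to $F$. The elements of $(E'\otimes F)^{\perp\perp}$, the band generated by $E'\otimes F$ in $\mathcal L^r(E,F)$, are called kernel operators. (A Banach lattice with order continuous norm is order complete.) *)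

theory Defs
  imports "HOL-Analysis.Analysis" "HOL-Library.Lattice_Algebras"
begin

section \<open>Banach lattices\<close>

class banach_lattice = banach + ordered_real_vector + lattice_ab_group_add_abs +
  assumes norm_mono_abs: "\<bar>x\<bar> \<le> \<bar>y\<bar> \<Longrightarrow> norm x \<le> norm y"

text \<open>
  Order continuity of the norm: every net decreasing to 0 converges to 0 in norm. A decreasing
  net is represented by its set of values, a nonempty downward directed set indexed by itself.
\<close>

definition order_continuous_norm :: "'a::banach_lattice itself \<Rightarrow> bool" where
  "order_continuous_norm _ \<longleftrightarrow>
     (\<forall>D::'a set. D \<noteq> {} \<and> (\<forall>x\<in>D. \<forall>y\<in>D. \<exists>z\<in>D. z \<le> x \<and> z \<le> y) \<and>
        (\<forall>x\<in>D. 0 \<le> x) \<and> (\<forall>b. (\<forall>x\<in>D. b \<le> x) \<longrightarrow> b \<le> 0) \<longrightarrow>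
        (\<forall>e>0. \<exists>z\<in>D. \<forall>x\<in>D. x \<le> z \<longrightarrow> norm x < e))"

definition principal_ideal :: "'a::banach_lattice \<Rightarrow> 'a set" where
  "principal_ideal y = {g. \<exists>c\<ge>0. \<bar>g\<bar> \<le> c *\<^sub>R y}"

definition quasi_interior :: "'a::banach_lattice \<Rightarrow> bool" where
  "quasi_interior y \<longleftrightarrow> 0 \<le> y \<and> closure (principal_ideal y) = UNIV"


section \<open>Regular operators and kernel operators\<close>

definition positive_op :: "('a::banach_lattice \<Rightarrow>\<^sub>L 'b::banach_lattice) \<Rightarrow> bool" where
  "positive_op S \<longleftrightarrow> (\<forall>x\<ge>0. 0 \<le> blinfun_apply S x)"

definition op_le :: "('a::banach_lattice \<Rightarrow>\<^sub>L 'b::banach_lattice) \<Rightarrow> ('a \<Rightarrow>\<^sub>L 'b) \<Rightarrow> bool" where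
  "op_le S R \<longleftrightarrow> positive_op (R - S)"

text \<open>
  Positive linear maps between Banach lattices are automatically continuous, so no regular
  operator is lost by working inside the type of bounded operators.
\<close>

definition regular_ops :: "('a::banach_lattice \<Rightarrow>\<^sub>L 'b::banach_lattice) set" where
  "regular_ops = span {S. positive_op S}"

text \<open>
  The lattice operations of \<open>L\<^sup>r(E,F)\<close> are those of its own order, so they are described
  by their universal properties among regular operators; they exist (and are unique) whenever
  \<open>F\<close> is order complete.
\<close>

definition is_modulus :: "('a::banach_lattice \<Rightarrow>\<^sub>L 'b::banach_lattice) \<Rightarrow> ('a \<Rightarrow>\<^sub>L 'b) \<Rightarrow> bool" where
  "is_modulus S M \<longleftrightarrow> M \<in> regular_ops \<and> op_le S M \<and> op_le (- S) M \<and>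
     (\<forall>U\<in>regular_ops. op_le S U \<and> op_le (- S) U \<longrightarrow> op_le M U)"

definition is_op_inf ::
  "('a::banach_lattice \<Rightarrow>\<^sub>L 'b::banach_lattice) \<Rightarrow> ('a \<Rightarrow>\<^sub>L 'b) \<Rightarrow> ('a \<Rightarrow>\<^sub>L 'b) \<Rightarrow> bool" where
  "is_op_inf S R N \<longleftrightarrow> N \<in> regular_ops \<and> op_le N S \<and> op_le N R \<and>
     (\<forall>L\<in>regular_ops. op_le L S \<and> op_le L R \<longrightarrow> op_le L N)"

definition op_disjoint :: "('a::banach_lattice \<Rightarrow>\<^sub>L 'b::banach_lattice) \<Rightarrow> ('a \<Rightarrow>\<^sub>L 'b) \<Rightarrow> bool" where
  "op_disjoint S R \<longleftrightarrow> (\<exists>M N. is_modulus S M \<and> is_modulus R N \<and> is_op_inf M N 0)"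

definition disjoint_compl ::
  "('a::banach_lattice \<Rightarrow>\<^sub>L 'b::banach_lattice) set \<Rightarrow> ('a \<Rightarrow>\<^sub>L 'b) set" where
  "disjoint_compl A = {S \<in> regular_ops. \<forall>R\<in>A. op_disjoint S R}"

definition finite_rank_ops :: "('a::banach_lattice \<Rightarrow>\<^sub>L 'b::banach_lattice) set" where
  "finite_rank_ops = {S. \<exists>B. finite B \<and> range (blinfun_apply S) \<subseteq> span B}"

definition kernel_op :: "('a::banach_lattice \<Rightarrow>\<^sub>L 'b::banach_lattice) \<Rightarrow> bool" where
  "kernel_op S \<longleftrightarrow> S \<in> disjoint_compl (disjoint_compl finite_rank_ops)"


section \<open>One-parameter semigroups\<close>

text \<open>A semigroup indexed by \<open>(0,\<infty>)\<close>; the values at nonpositive parameters are irrelevant.\<close>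

definition one_param_semigroup :: "(real \<Rightarrow> 'a::real_normed_vector \<Rightarrow>\<^sub>L 'a) \<Rightarrow> bool" where
  "one_param_semigroup T \<longleftrightarrow> (\<forall>t>0. \<forall>s>0. T (t + s) = T t o\<^sub>L T s)"

definition bounded_semigroup :: "(real \<Rightarrow> 'a::real_normed_vector \<Rightarrow>\<^sub>L 'a) \<Rightarrow> bool" where
  "bounded_semigroup T \<longleftrightarrow> bdd_above ((\<lambda>t. norm (T t)) ` {0<..})"

definition positive_semigroup :: "(real \<Rightarrow> 'a::banach_lattice \<Rightarrow>\<^sub>L 'a) \<Rightarrow> bool" where
  "positive_semigroup T \<longleftrightarrow> (\<forall>t>0. positive_op (T t))"

definition quasi_interior_fixed_point ::
  "(real \<Rightarrow> 'a::banach_lattice \<Rightarrow>\<^sub>L 'a) \<Rightarrow> 'a \<Rightarrow> bool" where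
  "quasi_interior_fixed_point T y \<longleftrightarrow>
     quasi_interior y \<and> (\<forall>t>0. blinfun_apply (T t) y = y)"

definition strongly_convergent :: "(real \<Rightarrow> 'a::real_normed_vector \<Rightarrow>\<^sub>L 'a) \<Rightarrow> bool" where
  "strongly_convergent T \<longleftrightarrow> (\<forall>x. \<exists>l. ((\<lambda>t. blinfun_apply (T t) x) \<longlongrightarrow> l) at_top)"

end

theory Submission imports Defs "HOL-Library.Diagonal_Subsequence"
begin

text \<open>Write \<open>K = T\<^sub>s\<close> and let \<open>y\<close> be the fixed point. A positive kernel operator is the
  supremum of the operators \<open>0 \<le> S \<le> K\<close> dominated by some rank one operator \<open>\<phi> \<otimes> f\<close>. Such an \<open>S\<close> behaves
  like a Hilbert--Schmidt operator: the quadratic form \<open>g \<mapsto> \<phi>(g\<^sup>2)\<close> on the principal ideal of \<open>y\<close> makes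
  \<open>S [-y, y]\<close> totally bounded, hence \<open>K [-y, y]\<close> is relatively compact by order continuity of the
  norm. Orbits are therefore relatively compact and some sequence \<open>T\<^bsub>m k\<^esub>\<close> tends strongly to a
  positive projection \<open>P\<close>. Order intervals in the range of \<open>P\<close> are compact, so that there are
  atoms below each positive element, and each \<open>T\<^sub>t\<close> permutes the rays of atoms with finite orbits;
  since \<open>t\<close> is infinitely divisible, \<open>T\<^sub>t\<close> fixes every atom and hence the range of \<open>P\<close>. Thus
  \<open>T\<^sub>t\<close> tends strongly to \<open>P\<close>.\<close>

section \<open>Banach lattices\<close>

text \<open>Nothing is assumed about the dependence on \<open>t\<close>, so no generator or spectral
  argument is at hand and the algebra of the half-line has to do the work. Divisibility of
  \<open>t\<close> is indispensable: the powers of a permutation matrix share the other features and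
  need not converge. Kernel operators are given only as a band, without an integral kernel. All that
  is taken from the band is domination by rank one operators, and a quadratic form built from one
  dominating functional stands in for the L2 space in which such an operator would be
  Hilbert-Schmidt. The approximation of \<open>K\<close> from below serves twice: it gives
  compactness, and it gives a functional that is strictly positive on the positive fixed vectors of
  \<open>P\<close> below \<open>y\<close>. The latter is needed because the range of
  \<open>P\<close> carries no measure and need not be a sublattice: components of its elements are
  found by maximising this functional over compact sets, and without atoms they could be split again
  and again, like supports of Rademacher functions, until compactness fails.\<close>

declare neg_inf_eq_sup [simp del] neg_sup_eq_inf [simp del]
  diff_inf_eq_sup [simp del] diff_sup_eq_inf [simp del]

text \<open>The modulus is sup minus inf, while the sum is sup plus inf. Expressing it through
  \<open>inf\<close> alone pays off later: a linear map that kills \<open>inf a b\<close> can be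
  evaluated on \<open>\<bar>a - b\<bar>\<close>.\<close>

lemma abs_diff_inf: "\<bar>a - b\<bar> = a + b - 2 *\<^sub>R inf a (b::'a::banach_lattice)"
proof -
  have "\<bar>a - b\<bar> = sup (a - b) (b - a)"
    by (simp add: abs_lattice)
  also have "\<dots> = a + b - 2 *\<^sub>R inf a b"
  proof (rule order.antisym)
    show "sup (a - b) (b - a) \<le> a + b - 2 *\<^sub>R inf a b"
      using add_mono[OF inf.cobounded2[of a b] inf.cobounded2[of a b]]
        add_mono[OF inf.cobounded1[of a b] inf.cobounded1[of a b]]
      by (intro le_supI) (auto simp: algebra_simps scaleR_2)
    have "a + b = sup a b + inf a b"
      by (rule add_eq_inf_sup)
    moreover have "sup a b - inf a b \<le> sup (a - b) (b - a)"
    proof -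
      have "a \<le> sup (a - b) (b - a) + b" "b \<le> sup (a - b) (b - a) + a"
        by (simp_all add: diff_le_eq[symmetric])
      moreover have "a \<le> sup (a - b) (b - a) + a" "b \<le> sup (a - b) (b - a) + b"
        using abs_ge_zero[of "a - b"] by (simp_all add: abs_lattice)
      ultimately have "sup a b \<le> sup (a - b) (b - a) + a" "sup a b \<le> sup (a - b) (b - a) + b"
        by (auto intro: le_supI)
      then have "sup a b - sup (a - b) (b - a) \<le> inf a b"
        by (intro le_infI) (metis diff_le_eq add.commute)+
      then show ?thesis by (metis diff_le_eq add.commute)
    qed
    ultimately show "a + b - 2 *\<^sub>R inf a b \<le> sup (a - b) (b - a)"
      by (simp add: scaleR_2)
  qed
  finally show ?thesis .
qed

lemma norm_abs: "norm \<bar>x\<bar> = norm (x::'a::banach_lattice)"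
  by (intro order.antisym norm_mono_abs) simp_all

lemma norm_mono_pos: "0 \<le> x \<Longrightarrow> x \<le> y \<Longrightarrow> norm x \<le> norm (y::'a::banach_lattice)"
  using norm_mono_abs[of x y] order.trans[of 0 x y] by simp

lemma norm_le_of_abs_le: "\<bar>x\<bar> \<le> y \<Longrightarrow> norm x \<le> norm (y::'a::banach_lattice)"
  using norm_mono_pos[of "\<bar>x\<bar>" y] by (simp add: norm_abs)

lemma abs_scaleR_lattice: "\<bar>c *\<^sub>R x\<bar> = \<bar>c\<bar> *\<^sub>R \<bar>x::'a::banach_lattice\<bar>"
proof -
  have le: "\<bar>c *\<^sub>R x\<bar> \<le> \<bar>c\<bar> *\<^sub>R \<bar>x\<bar>" for c and x :: 'a
  proof (cases "c \<ge> 0")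
    case True
    then show ?thesis
      using scaleR_left_mono[of x "\<bar>x\<bar>" c] scaleR_left_mono[of "-x" "\<bar>x\<bar>" c]
      by (intro abs_leI) (auto simp: abs_ge_self abs_ge_minus_self)
  next
    case False
    then show ?thesis
      using scaleR_left_mono[of x "\<bar>x\<bar>" "-c"] scaleR_left_mono[of "-x" "\<bar>x\<bar>" "-c"]
      by (intro abs_leI) (auto simp: abs_ge_self abs_ge_minus_self)
  qed
  show ?thesis
  proof (cases "c = 0")
    case False
    have "\<bar>inverse c *\<^sub>R (c *\<^sub>R x)\<bar> \<le> \<bar>inverse c\<bar> *\<^sub>R \<bar>c *\<^sub>R x\<bar>"
      by (rule le)
    then have "\<bar>x\<bar> \<le> \<bar>inverse c\<bar> *\<^sub>R \<bar>c *\<^sub>R x\<bar>" using False by simp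
    then have "\<bar>c\<bar> *\<^sub>R \<bar>x\<bar> \<le> \<bar>c\<bar> *\<^sub>R (\<bar>inverse c\<bar> *\<^sub>R \<bar>c *\<^sub>R x\<bar>)"
      by (intro scaleR_left_mono) auto
    then have "\<bar>c\<bar> *\<^sub>R \<bar>x\<bar> \<le> \<bar>c *\<^sub>R x\<bar>"
      using False by (simp add: abs_inverse)
    with le[of c x] show ?thesis by (rule order.antisym)
  qed simp
qed

lemma continuous_abs_lattice [continuous_intros]:
  fixes f :: "'b::topological_space \<Rightarrow> 'a::banach_lattice"
  assumes "continuous_on S f"
  shows "continuous_on S (\<lambda>x. \<bar>f x\<bar>)"
proof -
  have "1-lipschitz_on UNIV (abs :: 'a \<Rightarrow> 'a)"
  proof (rule lipschitz_onI)
    fix x y :: 'a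
    have "\<bar>\<bar>x\<bar> - \<bar>y\<bar>\<bar> \<le> \<bar>x - y\<bar>"
      by (rule abs_triangle_ineq3)
    then show "dist \<bar>x\<bar> \<bar>y\<bar> \<le> 1 * dist x y"
      by (simp add: dist_norm norm_mono_abs)
  qed simp
  then have "continuous_on UNIV (abs :: 'a \<Rightarrow> 'a)"
    by (rule lipschitz_on_continuous_on)
  from continuous_on_compose2[OF this assms] show ?thesis by auto
qed

lemma inf_eq_half: "inf a b = (1/2) *\<^sub>R (a + b - \<bar>a - b\<bar>)" for a b :: "'a::banach_lattice"
  by (simp add: abs_diff_inf)

lemma continuous_inf_lattice [continuous_intros]:
  fixes f g :: "'b::topological_space \<Rightarrow> 'a::banach_lattice"
  assumes "continuous_on S f" "continuous_on S g"
  shows "continuous_on S (\<lambda>x. inf (f x) (g x))"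
  unfolding inf_eq_half using assms by (intro continuous_intros)

text \<open>Positivity of \<open>x - a\<close> is the equation
  \<open>\<bar>x - a\<bar> = x - a\<close> between continuous functions.\<close>

lemma closed_le_lattice: "closed {x. a \<le> (x::'a::banach_lattice)}"
proof -
  have "{x. a \<le> x} = {x. \<bar>x - a\<bar> = x - a}"
    using abs_of_nonneg[of "_ - a"] abs_ge_zero by (auto simp: le_diff_eq) (metis abs_ge_zero diff_ge_0_iff_ge)
  moreover have "closed {x. \<bar>x - a\<bar> = x - a}"
    by (intro closed_Collect_eq continuous_intros)
  ultimately show ?thesis by simp
qed

lemma tendsto_le_lattice:
  fixes f g :: "'b \<Rightarrow> 'a::banach_lattice"
  assumes "F \<noteq> bot" "(f \<longlongrightarrow> a) F" "(g \<longlongrightarrow> b) F" "eventually (\<lambda>x. f x \<le> g x) F"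
  shows "a \<le> b"
proof -
  have "((\<lambda>x. g x - f x) \<longlongrightarrow> b - a) F"
    using assms by (intro tendsto_intros)
  moreover have "eventually (\<lambda>x. g x - f x \<in> {x. 0 \<le> x}) F"
    using assms(4) by eventually_elim simp
  ultimately have "b - a \<in> {x. 0 \<le> x}"
    by (intro Lim_in_closed_set[OF closed_le_lattice[of 0] _ assms(1)])
  then show ?thesis by simp
qed

lemma closed_ge_lattice: "closed {x. (x::'a::banach_lattice) \<le> a}"
proof -
  have "{x. x \<le> a} = uminus ` {x. - a \<le> x}"
    by (auto simp: image_iff minus_le_iff intro: exI[of _ "- _"]) (metis minus_minus neg_le_iff_le)
  then show ?thesis
    using closed_negations[OF closed_le_lattice] by metis
qed

lemma archimedean_lattice:
  assumes "\<And>n::nat. real n *\<^sub>R b \<le> v" shows "b \<le> (0::'a::banach_lattice)"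
proof -
  have "(\<lambda>n. (1 / real (Suc n)) *\<^sub>R v) \<longlonglongrightarrow> 0 *\<^sub>R v"
    by (intro tendsto_scaleR tendsto_const LIMSEQ_Suc[OF lim_1_over_n])
  moreover have "b \<le> (1 / real (Suc n)) *\<^sub>R v" for n
    using scaleR_left_mono[OF assms[of "Suc n"], of "1 / real (Suc n)"] by simp
  ultimately show ?thesis
    using tendsto_le_lattice[of sequentially "\<lambda>_. b" b "\<lambda>n. (1 / real (Suc n)) *\<^sub>R v"] by auto
qed

lemma inf_add_le:
  assumes "0 \<le> z" "0 \<le> a" "0 \<le> b"
  shows "inf z (a + b) \<le> inf z a + inf z (b::'a::banach_lattice)"
proof -
  have "inf z (a + b) - inf z a \<le> inf z b"
  proof (rule le_infI)
    have "inf z (a + b) - inf z a \<le> z - 0"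
      using assms by (intro diff_mono) simp_all
    then show "inf z (a + b) - inf z a \<le> z" by simp
    have "inf z (a + b) - b \<le> inf z a"
    proof (rule le_infI)
      have "inf z (a + b) - b \<le> z - 0"
        using assms by (intro diff_mono) simp_all
      then show "inf z (a + b) - b \<le> z" by simp
      show "inf z (a + b) - b \<le> a"
        using diff_mono[OF inf.cobounded2[of z "a + b"] order.refl[of b]] by simp
    qed
    then show "inf z (a + b) - inf z a \<le> b"
      by (metis diff_le_eq add.commute)
  qed
  then show ?thesis by (metis diff_le_eq add.commute)
qed

lemma pprt_eq_sub_inf: "pprt (x - y) = x - inf x (y::'a::banach_lattice)"
  by (simp add: pprt_def diff_inf_eq_sup add_sup_distrib_left sup_commute)

lemma scaleR_inf: "0 \<le> c \<Longrightarrow> c *\<^sub>R inf a b = inf (c *\<^sub>R a) (c *\<^sub>R (b::'a::banach_lattice))"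
  unfolding inf_eq_half
  using abs_scaleR_lattice[of c "a - b"] by (simp add: scaleR_right_diff_distrib scaleR_right_distrib)

text \<open>A sum of moduli is the supremum of all signed sums, so an upper bound may be checked one
  sign pattern at a time, where linearity is available. The extra summand \<open>x\<close> absorbs
  the signs already fixed during the induction.\<close>

lemma sum_abs_le_signs:
  fixes v :: "'i \<Rightarrow> 'a::banach_lattice"
  assumes "finite I" "\<And>s. (\<And>i. s i = 1 \<or> s i = (-1::real)) \<Longrightarrow> x + (\<Sum>i\<in>I. s i *\<^sub>R v i) \<le> w"
  shows "x + (\<Sum>i\<in>I. \<bar>v i\<bar>) \<le> w"
  using assms
proof (induction I arbitrary: x rule: finite_induct)
  case empty
  then show ?case using empty(1)[of "\<lambda>_. 1"] by simp
next
  case (insert j I)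
  have *: "(x + c *\<^sub>R v j) + (\<Sum>i\<in>I. \<bar>v i\<bar>) \<le> w" if c: "c = 1 \<or> c = -1" for c
  proof (rule insert.IH)
    fix s :: "'i \<Rightarrow> real" assume s: "\<And>i. s i = 1 \<or> s i = -1"
    have "(\<Sum>i\<in>I. (s(j:=c)) i *\<^sub>R v i) = (\<Sum>i\<in>I. s i *\<^sub>R v i)"
      using insert.hyps by (intro sum.cong) auto
    then show "x + c *\<^sub>R v j + (\<Sum>i\<in>I. s i *\<^sub>R v i) \<le> w"
      using insert.prems[of "s(j:=c)"] c s insert.hyps by (auto simp: algebra_simps)
  qed
  have "\<bar>v j\<bar> \<le> w - x - (\<Sum>i\<in>I. \<bar>v i\<bar>)"
    using *[of 1] *[of "-1"] by (intro abs_leI) (auto simp: algebra_simps)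
  then show ?case using insert.hyps by (simp add: algebra_simps)
qed

section \<open>Suprema and order continuous norms\<close>

definition is_sup :: "'a::order set \<Rightarrow> 'a \<Rightarrow> bool" where
  "is_sup A s \<longleftrightarrow> (\<forall>a\<in>A. a \<le> s) \<and> (\<forall>u. (\<forall>a\<in>A. a \<le> u) \<longrightarrow> s \<le> u)"

text \<open>A predicate on types, because it is derived from \<open>order_continuous_norm\<close>,
  which is itself a hypothesis about a type. It is used for the lattice and, for functionals, with
  \<open>real\<close>.\<close>

definition sup_complete :: "'a::order itself \<Rightarrow> bool" where
  "sup_complete _ \<longleftrightarrow> (\<forall>A::'a set. A \<noteq> {} \<and> (\<exists>u. \<forall>a\<in>A. a \<le> u) \<longrightarrow> (\<exists>s. is_sup A s))"

lemma is_sup_unique: "is_sup A s \<Longrightarrow> is_sup A s' \<Longrightarrow> s = s'"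
  unfolding is_sup_def by (meson order.antisym)

lemma sup_complete_real: "sup_complete TYPE(real)"
  unfolding sup_complete_def is_sup_def
  by (metis cSup_least cSup_upper bdd_above.I)

lemma is_sup_plus:
  fixes s t :: "'a::ordered_ab_group_add"
  assumes "is_sup A s" "is_sup B t"
  shows "is_sup {a + b |a b. a \<in> A \<and> b \<in> B} (s + t)"
  unfolding is_sup_def
proof (intro conjI ballI allI impI)
  fix u assume u: "\<forall>x\<in>{a + b |a b. a \<in> A \<and> b \<in> B}. x \<le> u"
  have "a + t \<le> u" if "a \<in> A" for a
  proof -
    have "b \<le> u - a" if "b \<in> B" for b
      using u that \<open>a \<in> A\<close> by (auto simp: le_diff_eq add.commute)
    then have "t \<le> u - a" using assms(2) by (auto simp: is_sup_def)
    then show ?thesis by (simp add: le_diff_eq add.commute)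
  qed
  then have "\<forall>a\<in>A. a \<le> u - t" by (simp add: le_diff_eq)
  then have "s \<le> u - t" using assms(1) by (simp add: is_sup_def)
  then show "s + t \<le> u" by (simp add: le_diff_eq)
qed (use assms in \<open>auto simp: is_sup_def intro: add_mono\<close>)

lemma is_sup_scaleR:
  fixes s :: "'a::ordered_real_vector"
  assumes "is_sup A s" "c > 0"
  shows "is_sup ((\<lambda>a. c *\<^sub>R a) ` A) (c *\<^sub>R s)"
  unfolding is_sup_def
proof (intro conjI ballI allI impI)
  fix u assume u: "\<forall>x\<in>(\<lambda>a. c *\<^sub>R a) ` A. x \<le> u"
  have "a \<le> inverse c *\<^sub>R u" if "a \<in> A" for a
    using scaleR_left_mono[of "c *\<^sub>R a" u "inverse c"] u that assms(2) by auto
  then have "s \<le> inverse c *\<^sub>R u" using assms(1) by (auto simp: is_sup_def)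
  then show "c *\<^sub>R s \<le> u"
    using scaleR_left_mono[of s "inverse c *\<^sub>R u" c] assms(2) by auto
qed (use assms in \<open>auto simp: is_sup_def intro!: scaleR_left_mono\<close>)

text \<open>Order continuity speaks of sets decreasing to 0, but there is no supremum yet from which
  \<open>D\<close> could be subtracted. It is therefore applied to all differences of an upper bound
  and an element of \<open>D\<close>; norm completeness then yields the supremum as the common limit
  of upper bounds and elements.\<close>

lemma directed_tendsto_sup:
  fixes D :: "'a::banach_lattice set"
  assumes oc: "order_continuous_norm TYPE('a)"
    and ne: "D \<noteq> {}" and dir: "\<And>x y. x \<in> D \<Longrightarrow> y \<in> D \<Longrightarrow> \<exists>z\<in>D. x \<le> z \<and> y \<le> z"
    and bd: "\<And>x. x \<in> D \<Longrightarrow> x \<le> u"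
  obtains s where "is_sup D s" "\<And>e. e > 0 \<Longrightarrow> \<exists>d\<in>D. \<forall>d'\<in>D. d \<le> d' \<longrightarrow> norm (s - d') < e"
proof -
  define U where "U = {v. \<forall>d\<in>D. d \<le> v}"
  define W where "W = {v - d |v d. v \<in> U \<and> d \<in> D}"
  have uU: "u \<in> U" using bd by (auto simp: U_def)
  have infU: "inf v v' \<in> U" if "v \<in> U" "v' \<in> U" for v v'
    using that by (auto simp: U_def)
  have W_small: "\<exists>z\<in>W. \<forall>x\<in>W. x \<le> z \<longrightarrow> norm x < e" if "e > 0" for e
  proof -
    have "W \<noteq> {}" using ne uU by (auto simp: W_def)
    moreover have "\<forall>x\<in>W. \<forall>y\<in>W. \<exists>z\<in>W. z \<le> x \<and> z \<le> y"
    proof (intro ballI)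
      fix x y assume "x \<in> W" "y \<in> W"
      then obtain v d v' d' where *: "x = v - d" "y = v' - d'" "v \<in> U" "v' \<in> U" "d \<in> D" "d' \<in> D"
        by (auto simp: W_def)
      obtain z where z: "z \<in> D" "d \<le> z" "d' \<le> z" using dir * by meson
      have "inf v v' - z \<in> W" using infU * z by (auto simp: W_def)
      moreover have "inf v v' - z \<le> x" "inf v v' - z \<le> y"
        using * z by (auto intro!: diff_mono)
      ultimately show "\<exists>z\<in>W. z \<le> x \<and> z \<le> y" by blast
    qed
    moreover have "\<forall>x\<in>W. 0 \<le> x" by (auto simp: W_def U_def)
    moreover have "b \<le> 0" if b: "\<forall>x\<in>W. b \<le> x" for b
    proof -
      obtain d0 where d0: "d0 \<in> D" using ne by auto
      \<comment> \<open>If \<open>b\<close> is below all differences, an upper bound minus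
        \<open>b\<close> is again an upper bound. Iterating, all multiples of \<open>b\<close> stay
        below \<open>u - d0\<close>.\<close>
      have step: "v - real n *\<^sub>R b \<in> U" if "v \<in> U" for v n
      proof (induction n)
        case (Suc n)
        have "d \<le> v - real (Suc n) *\<^sub>R b" if "d \<in> D" for d
        proof -
          have "b \<le> (v - real n *\<^sub>R b) - d" using b Suc that by (auto simp: W_def)
          then show ?thesis by (simp add: algebra_simps)
        qed
        then show ?case by (auto simp: U_def)
      qed (use that in simp)
      have "real n *\<^sub>R b \<le> u - d0" for n
        using step[OF uU, of n] d0 by (auto simp: U_def algebra_simps)
      then show ?thesis by (rule archimedean_lattice)
    qed
    ultimately show ?thesis
      using oc[unfolded order_continuous_norm_def, rule_format, of W, OF _ that] by blast
  qed
  have small: "\<exists>v\<in>U. \<exists>d\<in>D. norm (v - d) < e" if "e > 0" for e :: real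
  proof -
    obtain z where "z \<in> W" "\<forall>x\<in>W. x \<le> z \<longrightarrow> norm x < e" using W_small \<open>e > 0\<close> by blast
    then show ?thesis unfolding W_def by blast
  qed
  have "\<exists>p. fst p \<in> U \<and> snd p \<in> D \<and> norm (fst p - snd p) < 1 / real (Suc n)" for n
    using small[of "1 / real (Suc n)"] by auto
  then obtain p where "\<And>n. fst (p n) \<in> U \<and> snd (p n) \<in> D \<and> norm (fst (p n) - snd (p n)) < 1 / real (Suc n)"
    by metis
  then obtain V E where VE: "\<And>n. V n \<in> U" "\<And>n. E n \<in> D" "\<And>n. norm (V n - E n) < 1 / real (Suc n)"
    using that[of "\<lambda>n. fst (p n)" "\<lambda>n. snd (p n)"] by blast
  have V_E: "norm (V n - d) \<le> 1 / real (Suc n)" if "d \<in> D" "E n \<le> d" for n d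
    using norm_mono_pos[of "V n - d" "V n - E n"] VE[of n] that by (auto simp: U_def)
  have VV: "norm (V n - V m) \<le> 1 / real (Suc n) + 1 / real (Suc m)" for n m
  proof -
    obtain d where d: "d \<in> D" "E n \<le> d" "E m \<le> d" using dir VE by meson
    have "norm (V n - V m) \<le> norm (V n - d) + norm (V m - d)"
      using norm_triangle_ineq4[of "V n - d" "V m - d"] by simp
    then show ?thesis using V_E[OF d(1,2)] V_E[OF d(1,3)] by simp
  qed
  have "Cauchy V"
  proof (rule metric_CauchyI)
    fix e :: real assume "e > 0"
    then obtain N where N: "1 / real (Suc N) < e / 2"
      using nat_approx_posE[of "e/2"] \<open>e > 0\<close> by (metis half_gt_zero)
    have "dist (V m) (V n) < e" if "m \<ge> N" "n \<ge> N" for m n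
    proof -
      have "1 / real (Suc m) \<le> 1 / real (Suc N)" "1 / real (Suc n) \<le> 1 / real (Suc N)"
        using that by (auto intro!: divide_left_mono)
      then show ?thesis using VV[of m n] N by (simp add: dist_norm)
    qed
    then show "\<exists>M. \<forall>m\<ge>M. \<forall>n\<ge>M. dist (V m) (V n) < e" by blast
  qed
  then obtain s where s: "V \<longlonglongrightarrow> s"
    using Cauchy_convergent_iff convergent_def by blast
  have sU: "d \<le> s" if "d \<in> D" for d
    using tendsto_le_lattice[OF _ tendsto_const s, of d] VE(1) that by (auto simp: U_def)
  have E_s: "E \<longlonglongrightarrow> s"
  proof -
    have "(\<lambda>n. V n - E n) \<longlonglongrightarrow> 0"
      using VE(3) by (intro Lim_null_comparison[OF _ LIMSEQ_Suc[OF lim_1_over_n]])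
        (auto intro!: always_eventually less_imp_le)
    from tendsto_diff[OF s this] show ?thesis by simp
  qed
  have lub: "s \<le> v" if "\<forall>d\<in>D. d \<le> v" for v
    using tendsto_le_lattice[OF _ E_s tendsto_const[of v]] VE(2) that by auto
  have "\<exists>d\<in>D. \<forall>d'\<in>D. d \<le> d' \<longrightarrow> norm (s - d') < e" if "e > 0" for e :: real
  proof -
    obtain n where "norm (s - E n) < e"
      using metric_LIMSEQ_D[OF E_s \<open>e > 0\<close>] by (auto simp: dist_norm norm_minus_commute)
    moreover have "norm (s - d') \<le> norm (s - E n)" if "d' \<in> D" "E n \<le> d'" for d'
      using that sU by (intro norm_mono_pos) auto
    ultimately show ?thesis using VE(2) by (meson order.strict_trans1)
  qed
  then show ?thesis using that sU lub by (auto simp: is_sup_def)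
qed

text \<open>Adjoining finite suprema makes the set directed and does not change its upper
  bounds.\<close>

lemma sup_complete_order_continuous:
  assumes "order_continuous_norm TYPE('a::banach_lattice)"
  shows "sup_complete TYPE('a)"
  unfolding sup_complete_def
proof (intro allI impI)
  fix A :: "'a set" assume A: "A \<noteq> {} \<and> (\<exists>u. \<forall>a\<in>A. a \<le> u)"
  then obtain u where u: "\<And>a. a \<in> A \<Longrightarrow> a \<le> u" by blast
  define D where "D = {Sup_fin F |F. finite F \<and> F \<noteq> {} \<and> F \<subseteq> A}"
  obtain s where s: "is_sup D s"
  proof (rule directed_tendsto_sup[OF assms, of D u])
    obtain a where "a \<in> A" using A by blast
    then have "Sup_fin {a} \<in> D" unfolding D_def by blast
    then show "D \<noteq> {}" by blast
    show "x \<le> u" if "x \<in> D" for x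
      using that u by (auto simp: D_def intro!: Sup_fin.boundedI)
    show "\<exists>z\<in>D. x \<le> z \<and> y \<le> z" if xy: "x \<in> D" "y \<in> D" for x y
    proof -
      obtain F G where "x = Sup_fin F" "y = Sup_fin G" "finite F" "F \<noteq> {}" "F \<subseteq> A"
        "finite G" "G \<noteq> {}" "G \<subseteq> A" using xy by (auto simp: D_def)
      moreover from this have "Sup_fin (F \<union> G) \<in> D" by (auto simp: D_def intro!: exI[of _ "F \<union> G"])
      ultimately show ?thesis
        by (intro bexI[of _ "Sup_fin (F \<union> G)"]) (auto simp: Sup_fin.union)
    qed
  qed blast
  have "a \<le> s" if "a \<in> A" for a
  proof -
    have "Sup_fin {a} \<in> D" using that by (auto simp: D_def intro!: exI[of _ "{a}"])
    then show ?thesis using s by (auto simp: is_sup_def)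
  qed
  moreover have "s \<le> v" if "\<forall>a\<in>A. a \<le> v" for v
  proof -
    have "\<forall>d\<in>D. d \<le> v"
      using that by (auto simp: D_def intro!: Sup_fin.boundedI)
    then show ?thesis using s by (simp add: is_sup_def)
  qed
  ultimately show "\<exists>s. is_sup A s" by (auto simp: is_sup_def)
qed

section \<open>Regular operators\<close>

lemma pprt_diff: "pprt x - pprt (- x) = (x::'a::banach_lattice)"
  using prts[of x] by (simp add: pprt_neg)

lemma abs_eq_pprt: "\<bar>x\<bar> = pprt x + pprt (- x)" for x :: "'a::banach_lattice"
  using abs_prts[of x] by (simp add: pprt_neg)

lemma linear_blinfun_apply: "linear (blinfun_apply S)"
  by (rule bounded_linear.linear[OF blinfun.bounded_linear_right])

text \<open>Each vector is a difference of positive ones, and additivity makes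
  \<open>p a - p b\<close> independent of the chosen difference; linearity follows from this
  independence.\<close>

lemma cone_extension:
  fixes p :: "'a::banach_lattice \<Rightarrow> 'b::real_vector"
  assumes add: "\<And>x y. 0 \<le> x \<Longrightarrow> 0 \<le> y \<Longrightarrow> p (x + y) = p x + p y"
    and hom: "\<And>c x. 0 < c \<Longrightarrow> 0 \<le> x \<Longrightarrow> p (c *\<^sub>R x) = c *\<^sub>R p x"
  obtains P where "linear P" "\<And>x. 0 \<le> x \<Longrightarrow> P x = p x"
proof -
  define P where "P x = p (pprt x) - p (pprt (- x))" for x
  have p0: "p 0 = 0" using add[of 0 0] by simp
  have eq: "P (a - b) = p a - p b" if "0 \<le> a" "0 \<le> b" for a b
  proof -
    have "pprt (a - b) + b = a + pprt (- (a - b))"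
      using pprt_diff[of "a - b"] by (simp add: algebra_simps)
    then have "p (pprt (a - b)) + p b = p a + p (pprt (- (a - b)))"
      using that by (metis add zero_le_pprt)
    then show ?thesis by (simp add: P_def algebra_simps)
  qed
  have "linear P"
  proof (rule linearI)
    fix x y :: 'a and c :: real
    have "P (x + y) = P ((pprt x + pprt y) - (pprt (- x) + pprt (- y)))"
      using pprt_diff[of x] pprt_diff[of y] by (simp add: algebra_simps)
    also have "\<dots> = P x + P y"
      by (subst eq) (simp_all add: add P_def)
    finally show "P (x + y) = P x + P y" .
    consider "c > 0" | "c = 0" | "c < 0" by linarith
    then show "P (c *\<^sub>R x) = c *\<^sub>R P x"
    proof cases
      case 1
      have "P (c *\<^sub>R x) = P (c *\<^sub>R pprt x - c *\<^sub>R pprt (- x))"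
        using pprt_diff[of x] by (simp flip: scaleR_diff_right)
      also have "\<dots> = c *\<^sub>R P x"
        using 1 by (subst eq) (simp_all add: hom P_def scaleR_right_diff_distrib scaleR_nonneg_nonneg)
      finally show ?thesis .
    next
      case 2
      then show ?thesis by (simp add: P_def p0)
    next
      case 3
      have "c *\<^sub>R x = (- c) *\<^sub>R pprt (- x) - (- c) *\<^sub>R pprt x"
        using arg_cong[OF pprt_diff[of x], of "\<lambda>z. c *\<^sub>R z"] by (simp add: scaleR_right_diff_distrib)
      then have "P (c *\<^sub>R x) = P ((- c) *\<^sub>R pprt (- x) - (- c) *\<^sub>R pprt x)"
        by simp
      also have "\<dots> = p ((- c) *\<^sub>R pprt (- x)) - p ((- c) *\<^sub>R pprt x)"
        using 3 by (intro eq scaleR_nonneg_nonneg) auto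
      also have "\<dots> = (- c) *\<^sub>R p (pprt (- x)) - (- c) *\<^sub>R p (pprt x)"
        using 3 hom[of "- c"] by simp
      also have "\<dots> = c *\<^sub>R P x"
        by (simp add: P_def scaleR_right_diff_distrib)
      finally show ?thesis .
    qed
  qed
  moreover have "P x = p x" if "0 \<le> x" for x
    using eq[of x 0] that p0 by simp
  ultimately show ?thesis using that by blast
qed

text \<open>\<open>P\<close> is the positive part of \<open>L\<close>. Additivity of the suprema
  rests on the Riesz splitting \<open>z = inf z x + (z - inf z x)\<close>, by which the interval up
  to \<open>x + y\<close> is the sum of the two smaller ones.\<close>

lemma riesz_kantorovich:
  fixes L :: "'a::banach_lattice \<Rightarrow> 'b::ordered_real_vector"
  assumes sc: "sup_complete TYPE('b)" and lin: "linear L"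
    and bd: "\<And>x. 0 \<le> x \<Longrightarrow> \<exists>u. \<forall>z\<in>{0..x}. L z \<le> u"
  obtains P where "linear P" "\<And>x. 0 \<le> x \<Longrightarrow> is_sup (L ` {0..x}) (P x)"
proof -
  interpret L: linear L by fact
  have "\<exists>s. 0 \<le> x \<longrightarrow> is_sup (L ` {0..x}) s" for x
  proof (cases "0 \<le> x")
    case True
    then have "L ` {0..x} \<noteq> {}" "\<exists>u. \<forall>a\<in>L ` {0..x}. a \<le> u" using bd[of x] by auto
    then show ?thesis using sc[unfolded sup_complete_def, rule_format, of "L ` {0..x}"] by blast
  qed simp
  then obtain p where p: "\<And>x. 0 \<le> x \<Longrightarrow> is_sup (L ` {0..x}) (p x)" by metis
  have "p (x + y) = p x + p y" if xy: "0 \<le> x" "0 \<le> y" for x y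
  proof -
    have "L ` {0..x + y} = {a + b |a b. a \<in> L ` {0..x} \<and> b \<in> L ` {0..y}}"
    proof (intro equalityI subsetI)
      fix w assume "w \<in> L ` {0..x + y}"
      then obtain z where z: "w = L z" "0 \<le> z" "z \<le> x + y" by auto
      have "z - inf z x = pprt (z - x)" by (simp add: pprt_eq_sub_inf)
      moreover have "pprt (z - x) \<le> y"
        using z xy by (auto simp: pprt_def diff_le_eq add.commute)
      ultimately have "z - inf z x \<in> {0..y}" by (metis atLeastAtMost_iff zero_le_pprt)
      moreover have "inf z x \<in> {0..x}" using z xy by auto
      moreover have "w = L (inf z x) + L (z - inf z x)" by (simp add: z L.diff)
      ultimately show "w \<in> {a + b |a b. a \<in> L ` {0..x} \<and> b \<in> L ` {0..y}}" by blast
    next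
      fix w assume "w \<in> {a + b |a b. a \<in> L ` {0..x} \<and> b \<in> L ` {0..y}}"
      then obtain a b where "w = L a + L b" "a \<in> {0..x}" "b \<in> {0..y}" by blast
      then show "w \<in> L ` {0..x + y}"
        by (intro image_eqI[of _ _ "a + b"]) (auto simp: L.add add_mono)
    qed
    then show ?thesis
      using is_sup_plus[OF p p, OF xy] p[of "x + y"] xy by (metis is_sup_unique add_nonneg_nonneg)
  qed
  moreover have "p (c *\<^sub>R x) = c *\<^sub>R p x" if cx: "0 < c" "0 \<le> x" for c x
  proof -
    have "L ` {0..c *\<^sub>R x} = (\<lambda>a. c *\<^sub>R a) ` L ` {0..x}"
    proof (intro equalityI subsetI)
      fix w assume "w \<in> L ` {0..c *\<^sub>R x}"
      then obtain z where z: "w = L z" "0 \<le> z" "z \<le> c *\<^sub>R x" by auto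
      have "inverse c *\<^sub>R z \<le> inverse c *\<^sub>R c *\<^sub>R x" "0 \<le> inverse c *\<^sub>R z"
        using scaleR_left_mono[OF z(3), of "inverse c"] z cx by (auto intro!: scaleR_nonneg_nonneg)
      then have "inverse c *\<^sub>R z \<in> {0..x}" using cx by simp
      moreover have "w = c *\<^sub>R L (inverse c *\<^sub>R z)" using cx z by (simp add: L.scale)
      ultimately show "w \<in> (\<lambda>a. c *\<^sub>R a) ` L ` {0..x}" by blast
    next
      fix w assume "w \<in> (\<lambda>a. c *\<^sub>R a) ` L ` {0..x}"
      then obtain z where "w = c *\<^sub>R L z" "z \<in> {0..x}" by blast
      then show "w \<in> L ` {0..c *\<^sub>R x}"
        using cx by (intro image_eqI[of _ _ "c *\<^sub>R z"])
          (auto simp: L.scale intro!: scaleR_left_mono scaleR_nonneg_nonneg)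
    qed
    then show ?thesis
      using is_sup_scaleR[OF p, of x c] p[of "c *\<^sub>R x"] cx by (metis is_sup_unique scaleR_nonneg_nonneg less_imp_le)
  qed
  ultimately obtain P where "linear P" "\<And>x. 0 \<le> x \<Longrightarrow> P x = p x"
    using cone_extension[of p] by blast
  then show ?thesis using that p by metis
qed

lemma positive_linear_mono:
  fixes P :: "'a::banach_lattice \<Rightarrow> 'b::ordered_real_vector"
  assumes "linear P" "\<And>x. 0 \<le> x \<Longrightarrow> 0 \<le> P x" "x \<le> y"
  shows "P x \<le> P y"
  using assms(2)[of "y - x"] assms(3) by (simp add: linear_diff[OF assms(1)])

lemma positive_linear_abs:
  fixes P :: "'a::banach_lattice \<Rightarrow> 'b::{ordered_real_vector,ordered_ab_group_add_abs}"
  assumes "linear P" "\<And>x. 0 \<le> x \<Longrightarrow> 0 \<le> P x"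
  shows "\<bar>P x\<bar> \<le> P \<bar>x\<bar>"
  using positive_linear_mono[OF assms, of x "\<bar>x\<bar>"] positive_linear_mono[OF assms, of "- x" "\<bar>x\<bar>"]
  by (intro abs_leI) (simp_all add: linear_neg[OF assms(1)] abs_ge_self abs_ge_minus_self)

lemma positive_op_mono: "positive_op S \<Longrightarrow> x \<le> y \<Longrightarrow> blinfun_apply S x \<le> blinfun_apply S y"
  by (rule positive_linear_mono) (auto simp: positive_op_def linear_blinfun_apply)

lemma positive_op_abs: "positive_op S \<Longrightarrow> \<bar>blinfun_apply S x\<bar> \<le> blinfun_apply S \<bar>x\<bar>"
  by (rule positive_linear_abs) (auto simp: positive_op_def linear_blinfun_apply)

lemma op_le_iff: "op_le S R \<longleftrightarrow> (\<forall>x\<ge>0. blinfun_apply S x \<le> blinfun_apply R x)"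
  by (simp add: op_le_def positive_op_def blinfun.diff_left)

lemma blinfun_between:
  fixes P :: "'a::banach_lattice \<Rightarrow> 'b::banach_lattice"
  assumes "linear P" "\<And>x. 0 \<le> x \<Longrightarrow> 0 \<le> P x" "\<And>x. 0 \<le> x \<Longrightarrow> P x \<le> blinfun_apply U x"
  obtains N where "positive_op N" "blinfun_apply N = P"
proof -
  have "norm (P x) \<le> norm x * norm U" for x
  proof -
    have "\<bar>P x\<bar> \<le> blinfun_apply U \<bar>x\<bar>"
      using positive_linear_abs[OF assms(1,2)] assms(3)[of "\<bar>x\<bar>"] order.trans by auto
    then have "norm (P x) \<le> norm (blinfun_apply U \<bar>x\<bar>)" by (rule norm_le_of_abs_le)
    also have "\<dots> \<le> norm x * norm U"
      using norm_blinfun[of U "\<bar>x\<bar>"] by (simp add: norm_abs mult.commute)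
    finally show ?thesis .
  qed
  then have "bounded_linear P"
    using assms(1) by (intro bounded_linear.intro bounded_linear_axioms.intro) auto
  then have "blinfun_apply (Blinfun P) = P" by (rule bounded_linear_Blinfun_apply)
  then show ?thesis using assms(2) by (intro that) (auto simp: positive_op_def)
qed

text \<open>\<open>N\<close> is the positive part of \<open>S\<close> among operators. It is the
  only lattice operation on operators that has to be constructed; moduli and suprema are expressed
  through it.\<close>

lemma op_pos_part:
  fixes S U :: "'a::banach_lattice \<Rightarrow>\<^sub>L 'b::banach_lattice"
  assumes sc: "sup_complete TYPE('b)" and U: "positive_op U" "op_le S U"
  obtains N where "positive_op N" "op_le S N" "\<And>V. positive_op V \<Longrightarrow> op_le S V \<Longrightarrow> op_le N V"
proof -
  have bd: "blinfun_apply S z \<le> blinfun_apply V x"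
    if "positive_op V" "op_le S V" "z \<in> {0..x}" for V z x
    using that positive_op_mono[of V z x] by (auto simp: op_le_iff intro: order.trans)
  then have "\<exists>u. \<forall>z\<in>{0..x}. blinfun_apply S z \<le> u" for x using U by meson
  then obtain P where P: "linear P" "\<And>x. 0 \<le> x \<Longrightarrow> is_sup (blinfun_apply S ` {0..x}) (P x)"
    using riesz_kantorovich[OF sc linear_blinfun_apply] by metis
  have ge: "blinfun_apply S z \<le> P x" if "z \<in> {0..x}" for z x
    using P(2)[of x] that unfolding is_sup_def by fastforce
  have le: "P x \<le> blinfun_apply V x" if "positive_op V" "op_le S V" "0 \<le> x" for V x
    using P(2)[of x] bd[OF that(1,2)] that(3) unfolding is_sup_def by auto
  have nn: "0 \<le> P x" if "0 \<le> x" for x using ge[of 0 x] that by (simp add: blinfun.zero_right)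
  obtain N where N: "positive_op N" "blinfun_apply N = P"
    using blinfun_between[OF P(1) nn le[OF U]] by blast
  show ?thesis
    by (rule that[of N]) (use N ge le in \<open>auto simp: op_le_iff\<close>)
qed

lemma positive_regular: "positive_op S \<Longrightarrow> S \<in> regular_ops"
  by (simp add: regular_ops_def span_base)

lemma positive_op_add: "positive_op S \<Longrightarrow> positive_op R \<Longrightarrow> positive_op (S + R)"
  by (simp add: positive_op_def blinfun.add_left)

section \<open>Finite rank operators\<close>

lemma finite_combinations_compact:
  fixes v :: "'i \<Rightarrow> 'b::real_normed_vector"
  assumes "finite B"
  shows "compact {(\<Sum>b\<in>B. a b *\<^sub>R v b) |a. \<forall>b\<in>B. \<bar>a b\<bar> \<le> M b}"
  using assms
proof (induction B rule: finite_induct)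
  case (insert b B)
  have "{(\<Sum>b\<in>insert b B. a b *\<^sub>R v b) |a. \<forall>b\<in>insert b B. \<bar>a b\<bar> \<le> M b} =
      {x + y |x y. x \<in> (\<lambda>t. t *\<^sub>R v b) ` {-M b..M b} \<and> y \<in> {(\<Sum>b\<in>B. a b *\<^sub>R v b) |a. \<forall>b\<in>B. \<bar>a b\<bar> \<le> M b}}"
    (is "?A = ?C")
  proof (intro equalityI subsetI)
    fix x assume "x \<in> ?A"
    then show "x \<in> ?C" using insert.hyps by (fastforce simp: abs_le_iff)
  next
    fix x assume "x \<in> ?C"
    then obtain t a where ta: "x = t *\<^sub>R v b + (\<Sum>b\<in>B. a b *\<^sub>R v b)" "\<bar>t\<bar> \<le> M b" "\<forall>b\<in>B. \<bar>a b\<bar> \<le> M b"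
      by (auto simp: abs_le_iff)
    have "(\<Sum>b'\<in>B. (a(b := t)) b' *\<^sub>R v b') = (\<Sum>b\<in>B. a b *\<^sub>R v b)"
      using insert.hyps by (intro sum.cong) auto
    then have "x = (\<Sum>b'\<in>insert b B. (a(b := t)) b' *\<^sub>R v b')" using ta insert.hyps by simp
    then show "x \<in> ?A" using ta insert.hyps by (auto intro!: exI[of _ "a(b := t)"])
  qed
  moreover have "compact ?C"
    using insert.IH by (intro compact_sums compact_continuous_image continuous_intros) auto
  ultimately show ?case by simp
qed simp

text \<open>Equivalence of norms in finite dimension. The induction hypothesis makes coefficient
  boxes capture bounded sequences, so \<open>span B\<close> is closed, a new basis vector has
  positive distance from it, and this distance controls the new coefficient.\<close>

lemma coefficients_bounded:
  fixes B :: "'b::real_normed_vector set"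
  assumes "finite B" "independent B"
  shows "\<exists>C\<ge>0. \<forall>a. (\<Sum>b\<in>B. \<bar>a b\<bar>) \<le> C * norm (\<Sum>b\<in>B. a b *\<^sub>R b)"
  using assms
proof (induction B rule: finite_induct)
  case empty
  then show ?case by auto
next
  case (insert b B)
  then have ind: "independent B" "b \<notin> span B"
    by (auto simp: independent_insert)
  then obtain C where C: "C \<ge> 0" "\<And>a. (\<Sum>b\<in>B. \<bar>a b\<bar>) \<le> C * norm (\<Sum>b\<in>B. a b *\<^sub>R b)"
    using insert.IH by metis
  have "closed (span B)"
    unfolding closed_sequential_limits
  proof (intro allI impI, elim conjE)
    fix x l assume x: "\<forall>n. x n \<in> span B" "x \<longlonglongrightarrow> l"
    then obtain K where K: "\<And>n. norm (x n) \<le> K"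
      using convergent_imp_bounded[of x l] by (auto simp: bounded_iff)
    let ?S = "{(\<Sum>b\<in>B. a b *\<^sub>R b) |a. \<forall>b\<in>B. \<bar>a b\<bar> \<le> C * K}"
    have "x n \<in> ?S" for n
    proof -
      obtain a where a: "x n = (\<Sum>b\<in>B. a b *\<^sub>R b)"
        using x insert.hyps by (force simp: span_finite)
      have "\<bar>a b\<bar> \<le> C * K" if "b \<in> B" for b
      proof -
        have "\<bar>a b\<bar> \<le> (\<Sum>b\<in>B. \<bar>a b\<bar>)" using insert.hyps that by (intro member_le_sum) auto
        also have "\<dots> \<le> C * norm (x n)" using C(2)[of a] a by simp
        also have "\<dots> \<le> C * K" using C K by (intro mult_left_mono) auto
        finally show ?thesis .
      qed
      then show ?thesis using a by blast
    qed
    then have "l \<in> ?S"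
      by (intro closed_sequentially[OF compact_imp_closed[OF finite_combinations_compact[OF insert.hyps(1)]] _ x(2)]) blast
    then show "l \<in> span B" by (auto intro: span_sum span_scale span_base)
  qed
  then have d: "infdist b (span B) > 0"
    using ind in_closed_iff_infdist_zero[of "span B" b] infdist_nonneg[of b "span B"] span_zero[of B]
    by fastforce
  define d where "d = infdist b (span B)"
  have t: "\<bar>t\<bar> * d \<le> norm (t *\<^sub>R b + w)" if "w \<in> span B" for t w
  proof (cases "t = 0")
    case False
    have "- (inverse t *\<^sub>R w) \<in> span B" using that by (intro span_neg span_scale)
    then have "d \<le> dist b (- (inverse t *\<^sub>R w))" unfolding d_def by (rule infdist_le)
    then have "\<bar>t\<bar> * d \<le> \<bar>t\<bar> * norm (b + inverse t *\<^sub>R w)"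
      by (intro mult_left_mono) (auto simp: dist_norm)
    also have "\<dots> = norm (t *\<^sub>R (b + inverse t *\<^sub>R w))" by simp
    finally show ?thesis using False by (simp add: scaleR_right_distrib)
  qed simp
  \<comment> \<open>With \<open>n\<close> the norm of the whole combination, \<open>n / d\<close>
    bounds the coefficient of \<open>b\<close>, and \<open>C * (n + n / d * norm b)\<close> bounds
    the sum of the others.\<close>
  let ?C = "(1 + C * norm b) / d + C"
  have "(\<Sum>b\<in>insert b B. \<bar>a b\<bar>) \<le> ?C * norm (\<Sum>b\<in>insert b B. a b *\<^sub>R b)" for a
  proof -
    define w where "w = (\<Sum>b\<in>B. a b *\<^sub>R b)"
    define n where "n = norm (a b *\<^sub>R b + w)"
    have "w \<in> span B" unfolding w_def by (intro span_sum span_scale span_base)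
    then have 1: "\<bar>a b\<bar> \<le> n / d" using t[of w "a b"] d by (simp add: pos_le_divide_eq d_def n_def)
    have "norm w \<le> n + norm (a b *\<^sub>R b)"
      using norm_triangle_ineq4[of "a b *\<^sub>R b + w" "a b *\<^sub>R b"] by (simp add: n_def)
    then have "norm w \<le> n + \<bar>a b\<bar> * norm b" by simp
    moreover have "\<bar>a b\<bar> * norm b \<le> n / d * norm b" using 1 by (intro mult_right_mono) auto
    ultimately have "C * norm w \<le> C * (n + n / d * norm b)" using C by (intro mult_left_mono) auto
    moreover have "(\<Sum>b\<in>B. \<bar>a b\<bar>) \<le> C * norm w" using C(2)[of a] by (simp add: w_def)
    ultimately have "\<bar>a b\<bar> + (\<Sum>b\<in>B. \<bar>a b\<bar>) \<le> n / d + C * (n + n / d * norm b)" using 1 by linarith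
    also have "\<dots> = ?C * n" by (simp add: field_simps add_divide_distrib)
    finally show ?thesis using insert.hyps by (simp add: n_def w_def)
  qed
  moreover have "?C \<ge> 0" using C d by (simp add: d_def)
  ultimately show ?case by blast
qed

definition positive_functional :: "('a::banach_lattice \<Rightarrow>\<^sub>L real) \<Rightarrow> bool" where
  "positive_functional \<phi> \<longleftrightarrow> (\<forall>x\<ge>0. 0 \<le> blinfun_apply \<phi> x)"

lemma positive_functional_mono: "positive_functional \<phi> \<Longrightarrow> x \<le> y \<Longrightarrow> blinfun_apply \<phi> x \<le> blinfun_apply \<phi> y"
  by (rule positive_linear_mono) (auto simp: positive_functional_def linear_blinfun_apply)

lemma functional_dominated:
  fixes L :: "'a::banach_lattice \<Rightarrow> real"
  assumes "bounded_linear L"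
  obtains \<phi> where "positive_functional \<phi>" "\<And>x. \<bar>L x\<bar> \<le> blinfun_apply \<phi> \<bar>x\<bar>"
proof -
  interpret L: bounded_linear L by fact
  obtain K where K: "\<And>x. norm (L x) \<le> norm x * K" "K > 0" using L.pos_bounded by blast
  have bd: "L z \<le> K * norm x" if "z \<in> {0..x}" for z x
  proof -
    have "L z \<le> norm z * K" using K(1)[of z] by simp
    also have "\<dots> \<le> norm x * K" using that K norm_mono_pos[of z x] by (intro mult_right_mono) auto
    finally show ?thesis by (simp add: mult.commute)
  qed
  then obtain P where P: "linear P" "\<And>x. 0 \<le> x \<Longrightarrow> is_sup (L ` {0..x}) (P x)"
    using riesz_kantorovich[OF sup_complete_real L.linear_axioms] by metis
  have ge: "L z \<le> P x" if "z \<in> {0..x}" for z x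
    using P(2)[of x] that unfolding is_sup_def by fastforce
  have nn: "0 \<le> P x" if "0 \<le> x" for x using ge[of 0 x] that by (simp add: L.zero)
  have le: "P x \<le> K * norm x" if "0 \<le> x" for x
    using P(2)[OF that] bd unfolding is_sup_def by auto
  \<comment> \<open>As \<open>P\<close> is the positive part of \<open>L\<close>, this is the
    modulus of \<open>L\<close>. The factor 3 below is 2 for \<open>P\<close> plus 1 for
    \<open>L\<close>.\<close>
  define Q where "Q x = 2 * P x - L x" for x
  have linQ: "linear Q" unfolding Q_def using P(1) L.linear_axioms
    by (intro linear_compose_sub linear_cmul) (auto simp: linear_iff algebra_simps)
  have Qabs: "\<bar>L x\<bar> \<le> Q x" if "0 \<le> x" for x
    using ge[of x x] nn[of x] that unfolding Q_def by (intro abs_leI) auto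
  have Qnn: "0 \<le> Q x" if "0 \<le> x" for x using Qabs[OF that] by simp
  have Qbd: "norm (Q x) \<le> norm x * (3 * K)" for x
  proof -
    have "\<bar>Q x\<bar> \<le> Q \<bar>x\<bar>" by (rule positive_linear_abs[OF linQ Qnn])
    also have "\<dots> \<le> 3 * (K * norm x)"
      using le[of "\<bar>x\<bar>"] K(1)[of "\<bar>x\<bar>"] by (simp add: Q_def norm_abs mult.commute)
    finally show ?thesis by (simp add: mult_ac)
  qed
  have "bounded_linear Q"
    using linQ Qbd by (intro bounded_linear.intro bounded_linear_axioms.intro) auto
  then have app: "blinfun_apply (Blinfun Q) = Q" by (rule bounded_linear_Blinfun_apply)
  show ?thesis
  proof (rule that[of "Blinfun Q"])
    show "positive_functional (Blinfun Q)" using Qnn by (simp add: positive_functional_def app)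
    fix x
    have "L x = L (pprt x) - L (pprt (- x))"
      using L.diff[of "pprt x" "pprt (- x)"] by (simp add: pprt_diff)
    then have "\<bar>L x\<bar> \<le> \<bar>L (pprt x)\<bar> + \<bar>L (pprt (- x))\<bar>" by simp
    also have "\<dots> \<le> Q (pprt x) + Q (pprt (- x))" by (intro add_mono Qabs) auto
    also have "\<dots> = Q \<bar>x\<bar>" using linQ by (simp add: abs_eq_pprt linear_add)
    finally show "\<bar>L x\<bar> \<le> blinfun_apply (Blinfun Q) \<bar>x\<bar>" by (simp add: app)
  qed
qed

lemma abs_sum_le_lattice: "\<bar>sum f A\<bar> \<le> (\<Sum>i\<in>A. \<bar>f i\<bar>)" for f :: "'i \<Rightarrow> 'a::banach_lattice"
  by (induction A rule: infinite_finite_induct)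
    (auto intro: order.trans[OF abs_triangle_ineq] add_left_mono)

text \<open>Coordinates in a basis of the range are bounded functionals. Summing dominating
  functionals and the moduli of the basis vectors separately yields one rank one bound, so rank one
  operators suffice to test disjointness from all finite rank ones.\<close>

lemma finite_rank_dominated:
  fixes R :: "'a::banach_lattice \<Rightarrow>\<^sub>L 'b::banach_lattice"
  assumes "R \<in> finite_rank_ops"
  obtains \<phi> f where "positive_functional \<phi>" "0 \<le> f"
    "\<And>x. \<bar>blinfun_apply R x\<bar> \<le> blinfun_apply \<phi> \<bar>x\<bar> *\<^sub>R f"
proof -
  obtain B0 where B0: "finite B0" "range (blinfun_apply R) \<subseteq> span B0"
    using assms by (auto simp: finite_rank_ops_def)
  obtain B where B: "B \<subseteq> B0" "independent B" "B0 \<subseteq> span B"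
    using maximal_independent_subset[of B0] by blast
  have fin: "finite B" using B B0 finite_subset by blast
  have ran: "blinfun_apply R x \<in> span B" for x
    using B0(2) span_mono[OF B(3)] unfolding span_span by blast
  define c where "c b x = representation B (blinfun_apply R x) b" for b :: 'b and x
  have R_eq: "blinfun_apply R x = (\<Sum>b\<in>B. c b x *\<^sub>R b)" for x
    using sum_representation_eq[OF B(2) ran fin order.refl] by (simp add: c_def)
  obtain C where C: "C \<ge> 0" "\<And>a. (\<Sum>b\<in>B. \<bar>a b\<bar>) \<le> C * norm (\<Sum>b\<in>B. a b *\<^sub>R b)"
    using coefficients_bounded[OF fin B(2)] by metis
  have bl: "bounded_linear (c b)" if "b \<in> B" for b
  proof (rule bounded_linear_intro)
    show "c b (x + y) = c b x + c b y" for x y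
      using representation_add[OF B(2) ran ran] by (simp add: c_def blinfun.add_right)
    show "c b (r *\<^sub>R x) = r *\<^sub>R c b x" for r x
      using representation_scale[OF B(2) ran] by (simp add: c_def blinfun.scaleR_right)
    show "norm (c b x) \<le> norm x * (C * norm R)" for x
    proof -
      have "norm (c b x) \<le> (\<Sum>b\<in>B. \<bar>c b x\<bar>)" using fin that by (simp, intro member_le_sum) auto
      also have "\<dots> \<le> C * norm (blinfun_apply R x)" using C(2)[of "\<lambda>b. c b x"] by (simp add: R_eq)
      also have "\<dots> \<le> C * (norm R * norm x)" using C by (intro mult_left_mono norm_blinfun)
      finally show ?thesis by (simp add: mult_ac)
    qed
  qed
  have "\<exists>\<phi>. b \<in> B \<longrightarrow> positive_functional \<phi> \<and> (\<forall>x. \<bar>c b x\<bar> \<le> blinfun_apply \<phi> \<bar>x\<bar>)" for b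
  proof (cases "b \<in> B")
    case True
    then obtain \<phi> where "positive_functional \<phi>" "\<And>x. \<bar>c b x\<bar> \<le> blinfun_apply \<phi> \<bar>x\<bar>"
      using functional_dominated[OF bl[OF True]] by metis
    then show ?thesis by blast
  qed simp
  then obtain \<phi> where \<phi>: "\<And>b. b \<in> B \<Longrightarrow> positive_functional (\<phi> b)"
    "\<And>b x. b \<in> B \<Longrightarrow> \<bar>c b x\<bar> \<le> blinfun_apply (\<phi> b) \<bar>x\<bar>" by metis
  have app: "blinfun_apply (\<Sum>b\<in>B. \<phi> b) x = (\<Sum>b\<in>B. blinfun_apply (\<phi> b) x)" for x
    by (rule blinfun.sum_left)
  have "\<bar>blinfun_apply R x\<bar> \<le> blinfun_apply (\<Sum>b\<in>B. \<phi> b) \<bar>x\<bar> *\<^sub>R (\<Sum>b\<in>B. \<bar>b\<bar>)" for x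
  proof -
    have "\<bar>blinfun_apply R x\<bar> \<le> (\<Sum>b\<in>B. \<bar>c b x\<bar> *\<^sub>R \<bar>b\<bar>)"
      using abs_sum_le_lattice[of "\<lambda>b. c b x *\<^sub>R b" B] by (simp add: R_eq abs_scaleR_lattice)
    also have "\<dots> \<le> (\<Sum>b\<in>B. blinfun_apply (\<Sum>b\<in>B. \<phi> b) \<bar>x\<bar> *\<^sub>R \<bar>b\<bar>)"
    proof (intro sum_mono scaleR_right_mono)
      fix b assume b: "b \<in> B"
      have "blinfun_apply (\<phi> b) \<bar>x\<bar> \<le> (\<Sum>b\<in>B. blinfun_apply (\<phi> b) \<bar>x\<bar>)"
        using \<phi>(1) fin b by (intro member_le_sum) (auto simp: positive_functional_def)
      then show "\<bar>c b x\<bar> \<le> blinfun_apply (\<Sum>b\<in>B. \<phi> b) \<bar>x\<bar>"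
        using \<phi>(2)[OF b, of x] by (simp add: app)
    qed simp
    finally show ?thesis by (simp add: scaleR_sum_right)
  qed
  moreover have "positive_functional (\<Sum>b\<in>B. \<phi> b)"
    using \<phi>(1) by (auto simp: positive_functional_def app intro!: sum_nonneg)
  moreover have "0 \<le> (\<Sum>b\<in>B. \<bar>b\<bar>)" by (intro sum_nonneg) simp
  ultimately show ?thesis using that by blast
qed

section \<open>Approximation of kernel operators\<close>

lemma is_modulus_positive: "positive_op S \<Longrightarrow> is_modulus S S"
proof -
  assume S: "positive_op S"
  have "- blinfun_apply S x \<le> blinfun_apply S x" if "0 \<le> x" for x
    using S that by (simp add: positive_op_def minus_le_self_iff)
  then show ?thesis
    unfolding is_modulus_def using positive_regular[OF S] by (simp add: op_le_iff blinfun.minus_left)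
qed

text \<open>The modulus is twice the positive part minus \<open>R\<close>. Minimality: if
  \<open>V\<close> is above \<open>R\<close> and \<open>- R\<close>, then half of
  \<open>V + R\<close> is positive and above \<open>R\<close>, hence above the positive
  part.\<close>

lemma modulus_exists:
  fixes R :: "'a::banach_lattice \<Rightarrow>\<^sub>L 'b::banach_lattice"
  assumes sc: "sup_complete TYPE('b)" and R: "positive_op U" "op_le R U" "op_le (- R) U"
  obtains M where "is_modulus R M" "op_le M U"
proof -
  obtain N where N: "positive_op N" "op_le R N" "\<And>V. positive_op V \<Longrightarrow> op_le R V \<Longrightarrow> op_le N V"
    using op_pos_part[OF sc R(1,2)] by blast
  have below: "op_le (2 *\<^sub>R N - R) V" if V: "op_le R V" "op_le (- R) V" for V
  proof -
    have "0 \<le> (1/2) *\<^sub>R (blinfun_apply V x + blinfun_apply R x)"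
      "blinfun_apply R x \<le> (1/2) *\<^sub>R (blinfun_apply V x + blinfun_apply R x)" if "0 \<le> x" for x
    proof -
      have v: "blinfun_apply R x \<le> blinfun_apply V x" "0 \<le> blinfun_apply V x + blinfun_apply R x"
        using V that by (auto simp: op_le_iff blinfun.minus_left minus_le_iff le_minus_iff)
          (metis add.commute diff_ge_0_iff_ge diff_minus_eq_add)
      then show "0 \<le> (1/2) *\<^sub>R (blinfun_apply V x + blinfun_apply R x)"
        by (intro scaleR_nonneg_nonneg) auto
      have "(1/2) *\<^sub>R (blinfun_apply R x + blinfun_apply R x) \<le> (1/2) *\<^sub>R (blinfun_apply V x + blinfun_apply R x)"
        using v by (intro scaleR_left_mono add_right_mono) auto
      then show "blinfun_apply R x \<le> (1/2) *\<^sub>R (blinfun_apply V x + blinfun_apply R x)"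
        by (simp flip: scaleR_2)
    qed
    then have "positive_op ((1/2) *\<^sub>R (V + R))" "op_le R ((1/2) *\<^sub>R (V + R))"
      by (auto simp: positive_op_def op_le_iff blinfun.scaleR_left blinfun.add_left)
    then have "op_le N ((1/2) *\<^sub>R (V + R))" by (rule N(3))
    then have le: "blinfun_apply N x \<le> (1/2) *\<^sub>R (blinfun_apply V x + blinfun_apply R x)" if "0 \<le> x" for x
      using that by (simp add: op_le_iff blinfun.scaleR_left blinfun.add_left)
    have "2 *\<^sub>R blinfun_apply N x \<le> blinfun_apply V x + blinfun_apply R x" if "0 \<le> x" for x
      using scaleR_left_mono[OF le[OF that], of 2] by simp
    then show ?thesis
      by (simp add: op_le_iff blinfun.scaleR_left blinfun.diff_left diff_le_eq)
  qed
  have "2 *\<^sub>R N - R \<in> regular_ops"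
  proof -
    have "R = U - (U - R)" by simp
    moreover have "U - (U - R) \<in> regular_ops"
      unfolding regular_ops_def using R by (intro span_diff span_base) (auto simp: op_le_def)
    ultimately have "R \<in> regular_ops" by simp
    then show ?thesis using positive_regular[OF N(1)] unfolding regular_ops_def
      by (intro span_diff span_scale)
  qed
  moreover have "op_le R (2 *\<^sub>R N - R)" "op_le (- R) (2 *\<^sub>R N - R)"
  proof -
    have "blinfun_apply R x \<le> 2 *\<^sub>R blinfun_apply N x - blinfun_apply R x"
      "- blinfun_apply R x \<le> 2 *\<^sub>R blinfun_apply N x - blinfun_apply R x" if "0 \<le> x" for x
    proof -
      have "blinfun_apply R x \<le> blinfun_apply N x" "0 \<le> blinfun_apply N x"
        using N(1,2) that by (auto simp: op_le_iff positive_op_def)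
      then show "blinfun_apply R x \<le> 2 *\<^sub>R blinfun_apply N x - blinfun_apply R x"
        "- blinfun_apply R x \<le> 2 *\<^sub>R blinfun_apply N x - blinfun_apply R x"
        by (simp_all add: le_diff_eq scaleR_2 add_mono)
    qed
    then show "op_le R (2 *\<^sub>R N - R)" "op_le (- R) (2 *\<^sub>R N - R)"
      by (auto simp: op_le_iff blinfun.diff_left blinfun.scaleR_left blinfun.minus_left)
  qed
  ultimately have "is_modulus R (2 *\<^sub>R N - R)" using below by (auto simp: is_modulus_def)
  then show ?thesis using that below[OF R(2,3)] by blast
qed

text \<open>By \<open>finite_rank_dominated\<close>, these are the positive elements of the order
  ideal generated by the finite rank operators.\<close>

definition rank_one_dominated :: "('a::banach_lattice \<Rightarrow>\<^sub>L 'b::banach_lattice) \<Rightarrow> bool" where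
  "rank_one_dominated S \<longleftrightarrow> positive_op S \<and>
     (\<exists>\<phi> f. positive_functional \<phi> \<and> 0 \<le> f \<and> (\<forall>x\<ge>0. blinfun_apply S x \<le> blinfun_apply \<phi> x *\<^sub>R f))"

lemma rank_one_dominated_le:
  assumes "rank_one_dominated S" "positive_op R" "op_le R S"
  shows "rank_one_dominated R"
proof -
  obtain \<phi> f where *: "positive_functional \<phi>" "0 \<le> f" "\<forall>x\<ge>0. blinfun_apply S x \<le> blinfun_apply \<phi> x *\<^sub>R f"
    using assms(1) by (auto simp: rank_one_dominated_def)
  then have "\<forall>x\<ge>0. blinfun_apply R x \<le> blinfun_apply \<phi> x *\<^sub>R f"
    using assms(3) unfolding op_le_iff by (meson order.trans)
  then show ?thesis using * assms(2) unfolding rank_one_dominated_def by blast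
qed

text \<open>Adding functionals and vectors separately only adds positive cross terms to the sum of
  the two rank one bounds.\<close>

lemma rank_one_dominated_add:
  assumes "rank_one_dominated S" "rank_one_dominated R"
  shows "rank_one_dominated (S + R)"
proof -
  obtain \<phi> f where S: "positive_functional \<phi>" "0 \<le> f" "\<And>x. 0 \<le> x \<Longrightarrow> blinfun_apply S x \<le> blinfun_apply \<phi> x *\<^sub>R f"
    using assms(1) by (auto simp: rank_one_dominated_def)
  obtain \<psi> g where R: "positive_functional \<psi>" "0 \<le> g" "\<And>x. 0 \<le> x \<Longrightarrow> blinfun_apply R x \<le> blinfun_apply \<psi> x *\<^sub>R g"
    using assms(2) by (auto simp: rank_one_dominated_def)
  have "blinfun_apply S x + blinfun_apply R x \<le> (blinfun_apply \<phi> x + blinfun_apply \<psi> x) *\<^sub>R (f + g)"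
    if x: "0 \<le> x" for x
  proof -
    have nn: "0 \<le> blinfun_apply \<phi> x" "0 \<le> blinfun_apply \<psi> x"
      using S(1) R(1) x by (auto simp: positive_functional_def)
    have "blinfun_apply \<phi> x *\<^sub>R f \<le> blinfun_apply \<phi> x *\<^sub>R (f + g)"
      "blinfun_apply \<psi> x *\<^sub>R g \<le> blinfun_apply \<psi> x *\<^sub>R (f + g)"
      using nn S(2) R(2) by (auto intro!: scaleR_left_mono)
    then show ?thesis
      using add_mono[OF order.trans[OF S(3)[OF x]] order.trans[OF R(3)[OF x]]]
      by (simp add: scaleR_left_distrib)
  qed
  then show ?thesis
    unfolding rank_one_dominated_def
    using S R assms positive_op_add[of S R]
    by (intro conjI exI[of _ "\<phi> + \<psi>"] exI[of _ "f + g"])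
      (auto simp: rank_one_dominated_def positive_functional_def blinfun.add_left)
qed

lemma rank_one_op:
  fixes f :: "'b::banach_lattice"
  assumes "positive_functional \<phi>" "0 \<le> f"
  obtains U where "rank_one_dominated U" "\<And>x. blinfun_apply U x = blinfun_apply \<phi> x *\<^sub>R f"
proof -
  have "bounded_linear (\<lambda>x. blinfun_apply \<phi> x *\<^sub>R f)"
    by (intro bounded_linear_scaleR_const blinfun.bounded_linear_right)
  then have "blinfun_apply (Blinfun (\<lambda>x. blinfun_apply \<phi> x *\<^sub>R f)) = (\<lambda>x. blinfun_apply \<phi> x *\<^sub>R f)"
    by (rule bounded_linear_Blinfun_apply)
  then show ?thesis
    using assms by (intro that[of "Blinfun (\<lambda>x. blinfun_apply \<phi> x *\<^sub>R f)"])
      (auto simp: rank_one_dominated_def positive_op_def positive_functional_def intro: scaleR_nonneg_nonneg)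
qed

text \<open>Let \<open>K1\<close> be the supremum of the directed family \<open>F\<close> of rank
  one dominated operators below \<open>K\<close>. A positive operator below both
  \<open>K - K1\<close> and the modulus of a finite rank operator can be added to every member of
  \<open>F\<close> without leaving \<open>F\<close>, so it vanishes. Hence \<open>K - K1\<close> is
  disjoint from all finite rank operators and therefore from \<open>K\<close>, although it lies
  below \<open>K\<close>. This forces \<open>K = K1\<close>, and order continuity turns the
  pointwise supremum into a norm approximation.\<close>

lemma kernel_op_approx:
  fixes K :: "'a::banach_lattice \<Rightarrow>\<^sub>L 'b::banach_lattice"
  assumes oc: "order_continuous_norm TYPE('b)" and K: "positive_op K" "kernel_op K"
    and x: "0 \<le> x" and e: "e > 0"
  obtains S where "rank_one_dominated S" "op_le S K" "norm (blinfun_apply K x - blinfun_apply S x) < e"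
proof -
  note sc = sup_complete_order_continuous[OF oc]
  define F where "F = {S. rank_one_dominated S \<and> op_le S K}"
  have F0: "0 \<in> F"
    using K by (auto simp: F_def rank_one_dominated_def positive_op_def op_le_iff positive_functional_def
        intro!: exI[of _ 0])
  have F_bd: "blinfun_apply S x \<le> blinfun_apply K x" if "S \<in> F" "0 \<le> x" for S x
    using that by (simp add: F_def op_le_iff)
  have dirF: "\<exists>R\<in>F. op_le S1 R \<and> op_le S2 R" if S: "S1 \<in> F" "S2 \<in> F" for S1 S2
  proof -
    have S': "positive_op S1" "positive_op S2" "rank_one_dominated S1" "rank_one_dominated S2"
      "op_le S1 K" "op_le S2 K"
      using S by (auto simp: F_def rank_one_dominated_def)
    have "op_le (S2 - S1) S2" using S' by (simp add: op_le_def)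
    \<comment> \<open>The supremum of \<open>S1\<close> and \<open>S2\<close> is \<open>S1\<close>
      plus the positive part of \<open>S2 - S1\<close>.\<close>
    then obtain N where N: "positive_op N" "op_le (S2 - S1) N"
      "\<And>V. positive_op V \<Longrightarrow> op_le (S2 - S1) V \<Longrightarrow> op_le N V"
      using op_pos_part[OF sc S'(2), of "S2 - S1"] by blast
    have "op_le N S2" using N(3)[OF S'(2)] \<open>op_le (S2 - S1) S2\<close> by blast
    then have "rank_one_dominated (S1 + N)"
      using S' N by (intro rank_one_dominated_add rank_one_dominated_le[of S2 N])
    moreover have "op_le N (K - S1)"
      using S'(5,6) by (intro N(3)) (simp_all add: op_le_def)
    then have "op_le (S1 + N) K"
      by (simp add: op_le_iff blinfun.add_left blinfun.diff_left le_diff_eq add.commute)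
    ultimately have "S1 + N \<in> F" by (simp add: F_def)
    moreover have "op_le S1 (S1 + N)" "op_le S2 (S1 + N)"
      using N by (auto simp: op_le_iff positive_op_def blinfun.add_left blinfun.diff_left diff_le_eq add.commute)
    ultimately show ?thesis by blast
  qed
  define D where "D x = (\<lambda>S. blinfun_apply S x) ` F" for x
  have "\<exists>s. 0 \<le> x \<longrightarrow> is_sup (D x) s \<and> (\<forall>e>0. \<exists>d\<in>D x. \<forall>d'\<in>D x. d \<le> d' \<longrightarrow> norm (s - d') < e)" for x
  proof (cases "0 \<le> x")
    case True
    have "\<exists>z\<in>D x. a \<le> z \<and> b \<le> z" if "a \<in> D x" "b \<in> D x" for a b
    proof -
      obtain S1 S2 where S: "S1 \<in> F" "S2 \<in> F" "a = blinfun_apply S1 x" "b = blinfun_apply S2 x"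
        using \<open>a \<in> D x\<close> \<open>b \<in> D x\<close> by (auto simp: D_def)
      then obtain R where "R \<in> F" "op_le S1 R" "op_le S2 R" using dirF by blast
      then show ?thesis using S True by (auto simp: D_def op_le_iff)
    qed
    moreover have "a \<le> blinfun_apply K x" if "a \<in> D x" for a
      using that F_bd True by (auto simp: D_def)
    moreover have "D x \<noteq> {}" using F0 by (auto simp: D_def)
    ultimately obtain s where "is_sup (D x) s" "\<And>e. e > 0 \<Longrightarrow> \<exists>d\<in>D x. \<forall>d'\<in>D x. d \<le> d' \<longrightarrow> norm (s - d') < e"
      using directed_tendsto_sup[OF oc, of "D x" "blinfun_apply K x"] by blast
    then show ?thesis by blast
  qed simp
  then obtain p where p: "\<And>x. 0 \<le> x \<Longrightarrow> is_sup (D x) (p x)"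
    "\<And>x e. 0 \<le> x \<Longrightarrow> e > 0 \<Longrightarrow> \<exists>d\<in>D x. \<forall>d'\<in>D x. d \<le> d' \<longrightarrow> norm (p x - d') < e" by metis
  have p_ge: "blinfun_apply S x \<le> p x" if "0 \<le> x" "S \<in> F" for x S
    using p(1)[OF that(1)] that(2) by (auto simp: is_sup_def D_def)
  have p_le: "p x \<le> u" if "0 \<le> x" "\<And>S. S \<in> F \<Longrightarrow> blinfun_apply S x \<le> u" for x u
    using p(1)[OF that(1)] that(2) by (auto simp: is_sup_def D_def)
  have add: "p (x + y) = p x + p y" if xy: "0 \<le> x" "0 \<le> y" for x y
  proof (rule order.antisym)
    show "p (x + y) \<le> p x + p y"
      using xy p_ge by (intro p_le) (auto simp: blinfun.add_right intro: add_mono)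
    \<comment> \<open>Superadditivity is where directedness enters: \<open>S\<close> and
      \<open>R\<close> are replaced by a common upper bound in \<open>F\<close>.\<close>
    have "blinfun_apply S x + blinfun_apply R y \<le> p (x + y)" if "S \<in> F" "R \<in> F" for S R
    proof -
      obtain V where V: "V \<in> F" "op_le S V" "op_le R V" using dirF \<open>S \<in> F\<close> \<open>R \<in> F\<close> by blast
      then have "blinfun_apply S x + blinfun_apply R y \<le> blinfun_apply V (x + y)"
        using xy by (auto simp: op_le_iff blinfun.add_right intro: add_mono)
      also have "\<dots> \<le> p (x + y)" using V xy by (intro p_ge) auto
      finally show ?thesis .
    qed
    then have "blinfun_apply S x \<le> p (x + y) - blinfun_apply R y" if "S \<in> F" "R \<in> F" for S R
      using that by (simp add: le_diff_eq)
    then have "p x \<le> p (x + y) - blinfun_apply R y" if "R \<in> F" for R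
      using that xy by (intro p_le) auto
    then have "blinfun_apply R y \<le> p (x + y) - p x" if "R \<in> F" for R
      using that by (metis add.commute le_diff_eq)
    then have "p y \<le> p (x + y) - p x" using xy by (intro p_le) auto
    then show "p x + p y \<le> p (x + y)" by (simp add: le_diff_eq add.commute)
  qed
  have hom: "p (c *\<^sub>R x) = c *\<^sub>R p x" if cx: "0 < c" "0 \<le> x" for c x
  proof -
    have "is_sup (D (c *\<^sub>R x)) (c *\<^sub>R p x)"
      using is_sup_scaleR[OF p(1)[OF cx(2)] cx(1)] by (simp add: D_def image_image blinfun.scaleR_right)
    then show ?thesis using p(1)[of "c *\<^sub>R x"] cx is_sup_unique by (metis less_imp_le scaleR_nonneg_nonneg)
  qed
  obtain P where P: "linear P" "\<And>x. 0 \<le> x \<Longrightarrow> P x = p x"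
    using cone_extension[OF add hom] by blast
  have "0 \<le> P x" "P x \<le> blinfun_apply K x" if "0 \<le> x" for x
    using p_ge[OF that F0] p_le[OF that F_bd[OF _ that]] that by (auto simp: P(2))
  then obtain K1 where K1: "positive_op K1" "blinfun_apply K1 = P" "op_le K1 K"
    using blinfun_between[OF P(1), of K] by (metis op_le_iff)
  have S_le_K1: "op_le S K1" if "S \<in> F" for S
    using that p_ge by (auto simp: op_le_iff K1 P)
  have disj: "op_disjoint (K - K1) R" if R: "R \<in> finite_rank_ops" for R
  proof -
    obtain \<phi> f where f: "positive_functional \<phi>" "0 \<le> f" "\<And>x. \<bar>blinfun_apply R x\<bar> \<le> blinfun_apply \<phi> \<bar>x\<bar> *\<^sub>R f"
      using finite_rank_dominated[OF R] by blast
    obtain U where U: "rank_one_dominated U" "\<And>x. blinfun_apply U x = blinfun_apply \<phi> x *\<^sub>R f"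
      using rank_one_op[OF f(1,2)] by blast
    have "\<bar>blinfun_apply R x\<bar> \<le> blinfun_apply U x" if "0 \<le> x" for x
      using f(3)[of x] that by (simp add: U)
    then have "op_le R U" "op_le (- R) U"
      by (auto simp: op_le_iff blinfun.minus_left intro: order.trans[OF abs_ge_self] order.trans[OF abs_ge_minus_self])
    moreover have "positive_op U" using U by (simp add: rank_one_dominated_def)
    ultimately obtain M where M: "is_modulus R M" "op_le M U"
      using modulus_exists[OF sc] by blast
    have pos: "positive_op (K - K1)" using K1(3) by (simp add: op_le_def)
    have "is_op_inf (K - K1) M 0"
      unfolding is_op_inf_def
    proof (intro conjI ballI impI)
      show "0 \<in> regular_ops" by (simp add: regular_ops_def span_zero)
      show "op_le 0 (K - K1)" using pos by (simp add: op_le_def)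
      show "op_le 0 M"
      proof -
        have "0 \<le> blinfun_apply M x" if "0 \<le> x" for x
        proof -
          have "\<bar>blinfun_apply R x\<bar> \<le> blinfun_apply M x"
            using M(1) that by (intro abs_leI) (auto simp: is_modulus_def op_le_iff blinfun.minus_left)
          then show ?thesis using abs_ge_zero order.trans by blast
        qed
        then show ?thesis by (simp add: op_le_iff)
      qed
      fix L assume L: "L \<in> regular_ops" "op_le L (K - K1) \<and> op_le L M"
      obtain N where N: "positive_op N" "op_le L N" "\<And>V. positive_op V \<Longrightarrow> op_le L V \<Longrightarrow> op_le N V"
        using op_pos_part[OF sc pos] L by blast
      have "op_le L U" using L M(2) by (auto simp: op_le_iff intro: order.trans)
      then have NU: "op_le N U" using \<open>positive_op U\<close> by (intro N(3))
      have NK: "op_le N (K - K1)" using pos L by (intro N(3)) auto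
      have rN: "rank_one_dominated N" by (rule rank_one_dominated_le[OF U(1) N(1) NU])
      \<comment> \<open>\<open>S\<close> is below \<open>K1\<close> and \<open>N\<close> below
        \<open>K - K1\<close>, so the sum is still below \<open>K\<close>; the supremum
        \<open>p\<close> cannot then exceed \<open>p\<close> minus \<open>N\<close>.\<close>
      have "S + N \<in> F" if "S \<in> F" for S
      proof -
        have "op_le (S + N) K"
          unfolding op_le_iff
        proof (intro allI impI)
          fix x :: 'a assume x: "0 \<le> x"
          have "blinfun_apply S x \<le> blinfun_apply K1 x" using S_le_K1[OF that] x by (simp add: op_le_iff)
          moreover have "blinfun_apply N x \<le> blinfun_apply K x - blinfun_apply K1 x"
            using NK x by (simp add: op_le_iff blinfun.diff_left)
          ultimately show "blinfun_apply (S + N) x \<le> blinfun_apply K x"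
            using add_mono[of "blinfun_apply S x" _ "blinfun_apply N x"] by (fastforce simp: blinfun.add_left)
        qed
        then show ?thesis using that rN rank_one_dominated_add by (auto simp: F_def)
      qed
      then have SN: "blinfun_apply S x \<le> p x - blinfun_apply N x" if "0 \<le> x" "S \<in> F" for S x
        using p_ge[OF that(1), of "S + N"] that by (simp add: blinfun.add_left le_diff_eq)
      have "blinfun_apply N x \<le> 0" if "0 \<le> x" for x
        using p_le[OF that SN[OF that]] by (simp add: le_diff_eq)
      then show "op_le L 0" using N(2) by (auto simp: op_le_iff intro: order.trans)
    qed
    then show ?thesis using is_modulus_positive[OF pos] M(1) by (auto simp: op_disjoint_def)
  qed
  have "K - K1 \<in> disjoint_compl finite_rank_ops"
    using disj positive_regular[of "K - K1"] K1(3) by (auto simp: disjoint_compl_def op_le_def)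
  then have "op_disjoint K (K - K1)" using K(2) by (auto simp: kernel_op_def disjoint_compl_def)
  then obtain M N where MN: "is_modulus K M" "is_modulus (K - K1) N" "is_op_inf M N 0"
    by (auto simp: op_disjoint_def)
  \<comment> \<open>\<open>K - K1\<close> is thus below both moduli, whose infimum is 0.\<close>
  have "op_le (K - K1) K" using K1(1) by (simp add: op_le_def)
  moreover have "op_le K M" "op_le (K - K1) N" using MN by (auto simp: is_modulus_def)
  ultimately have "op_le (K - K1) M" "op_le (K - K1) N" by (auto simp: op_le_iff intro: order.trans)
  moreover have "K - K1 \<in> regular_ops" using positive_regular[of "K - K1"] K1(3) by (auto simp: op_le_def)
  ultimately have "op_le (K - K1) 0" using MN(3) by (auto simp: is_op_inf_def)
  then have "blinfun_apply K x = p x"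
    using x p_le[OF x F_bd[OF _ x]] by (intro order.antisym) (auto simp: op_le_iff blinfun.diff_left K1 P)
  moreover obtain d where "d \<in> D x" "norm (p x - d) < e" using p(2)[OF x e] by blast
  ultimately show ?thesis using that by (auto simp: D_def F_def)
qed

section \<open>A quadratic form on a principal ideal\<close>

text \<open>The defect \<open>h\<close> is additive and vanishes on integers, so it is 1-periodic
  and hence bounded on the whole line; a bounded additive function is 0.\<close>

lemma additive_bounded_linear:
  fixes g :: "real \<Rightarrow> real"
  assumes add: "\<And>s t. g (s + t) = g s + g t" and bd: "\<And>t. \<bar>t\<bar> \<le> 1 \<Longrightarrow> \<bar>g t\<bar> \<le> C"
  shows "g t = t * g 1"
proof -
  define h where "h t = g t - t * g 1" for t
  have hadd: "h (s + t) = h s + h t" for s t by (simp add: h_def add algebra_simps)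
  have h0: "h 0 = 0" using hadd[of 0 0] by simp
  have hneg: "h (- t) = - h t" for t using hadd[of t "- t"] h0 by simp
  have hn: "h (real n * t) = real n * h t" for n t
    by (induction n) (simp_all add: h0 hadd algebra_simps)
  have h1: "h 1 = 0" by (simp add: h_def)
  have hi: "h (of_int k) = 0" for k
  proof (cases k)
    case (nonneg n)
    then show ?thesis using hn[of n 1] h1 by simp
  next
    case (neg n)
    then show ?thesis using hn[of "Suc n" 1] h1 hneg[of "real (Suc n)"] by simp
  qed
  have hb: "\<bar>h t\<bar> \<le> C + \<bar>g 1\<bar>" for t
  proof -
    have "h t = h (frac t)" using hadd[of "of_int \<lfloor>t\<rfloor>" "frac t"] hi by (simp add: frac_def)
    also have "\<bar>\<dots>\<bar> \<le> \<bar>g (frac t)\<bar> + \<bar>frac t\<bar> * \<bar>g 1\<bar>"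
      unfolding h_def by (metis abs_mult abs_triangle_ineq4)
    also have "\<dots> \<le> C + 1 * \<bar>g 1\<bar>"
      using frac_lt_1[of t] frac_ge_0[of t] by (intro add_mono bd mult_right_mono) auto
    finally show ?thesis by simp
  qed
  have "h t = 0"
  proof (rule ccontr)
    assume "h t \<noteq> 0"
    then obtain n where "C + \<bar>g 1\<bar> < real n * \<bar>h t\<bar>"
      using reals_Archimedean3[of "\<bar>h t\<bar>"] by auto
    then show False using hb[of "real n * t"] by (simp add: hn abs_mult)
  qed
  then show ?thesis by (simp add: h_def)
qed

text \<open>Stated on a subspace because the form to which it is applied makes sense only on a
  principal ideal. The last bound takes the place of Cauchy-Schwarz: it is immediate from the
  parallelogram law, and it provides the local boundedness that upgrades additivity to
  homogeneity.\<close>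

lemma jordan_von_neumann:
  fixes q :: "'a::real_vector \<Rightarrow> real"
  assumes V: "subspace V"
    and par: "\<And>x y. x \<in> V \<Longrightarrow> y \<in> V \<Longrightarrow> q (x + y) + q (x - y) = 2 * q x + 2 * q y"
    and hom: "\<And>c x. x \<in> V \<Longrightarrow> q (c *\<^sub>R x) = c\<^sup>2 * q x"
    and nn: "\<And>x. x \<in> V \<Longrightarrow> 0 \<le> q x"
  shows "\<exists>B. (\<forall>x\<in>V. \<forall>y\<in>V. B x y = B y x) \<and>
    (\<forall>x\<in>V. \<forall>x'\<in>V. \<forall>y\<in>V. B (x + x') y = B x y + B x' y) \<and>
    (\<forall>c. \<forall>x\<in>V. \<forall>y\<in>V. B (c *\<^sub>R x) y = c * B x y) \<and>
    (\<forall>x\<in>V. B x x = q x) \<and> (\<forall>x\<in>V. \<forall>y\<in>V. \<bar>B x y\<bar> \<le> (q x + q y) / 2)"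
proof -
  note [simp] = subspace_add[OF V] subspace_diff[OF V] subspace_scale[OF V] subspace_0[OF V]
  define B where "B x y = (q (x + y) - q (x - y)) / 4" for x y
  have qneg: "q (- x) = q x" if "x \<in> V" for x using hom[OF that, of "-1"] by simp
  have sym: "B x y = B y x" if "x \<in> V" "y \<in> V" for x y
    using qneg[of "x - y"] that by (simp add: B_def add.commute)
  have diag: "B x x = q x" if "x \<in> V" for x
    using hom[OF that, of 2] hom[OF that, of 0] by (simp add: B_def flip: scaleR_2)
  have bound: "\<bar>B x y\<bar> \<le> (q x + q y) / 2" if xy: "x \<in> V" "y \<in> V" for x y
    using par[OF xy] nn[of "x + y"] nn[of "x - y"] xy unfolding B_def by (simp add: abs_le_iff field_simps)
  have pre: "B x z + B x' z = B (x + x') (2 *\<^sub>R z) / 2" if xz: "x \<in> V" "x' \<in> V" "z \<in> V" for x x' z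
  proof -
    have "q (x + x' + 2 *\<^sub>R z) + q (x - x') = 2 * q (x + z) + 2 * q (x' + z)"
      using par[of "x + z" "x' + z"] xz by (simp add: algebra_simps scaleR_2)
    moreover have "q (x + x' - 2 *\<^sub>R z) + q (x - x') = 2 * q (x - z) + 2 * q (x' - z)"
      using par[of "x - z" "x' - z"] xz by (simp add: algebra_simps scaleR_2)
    ultimately show ?thesis unfolding B_def by (simp add: field_simps)
  qed
  have B0: "B 0 z = 0" if "z \<in> V" for z using qneg[OF that] by (simp add: B_def)
  \<comment> \<open>Taking 0 as second vector in \<open>pre\<close> rewrites its right-hand side as
    \<open>B (x + x') z\<close>.\<close>
  have add: "B (x + x') z = B x z + B x' z" if "x \<in> V" "x' \<in> V" "z \<in> V" for x x' z
    using pre[OF that] pre[of "x + x'" 0 z] B0 that by simp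
  have scale: "B (c *\<^sub>R x) z = c * B x z" if xz: "x \<in> V" "z \<in> V" for c x z
  proof -
    have bd: "\<bar>B (t *\<^sub>R x) z\<bar> \<le> (q x + q z) / 2" if "\<bar>t\<bar> \<le> 1" for t
    proof -
      have "t\<^sup>2 * q x \<le> 1 * q x"
        using that nn[OF xz(1)] by (intro mult_right_mono) (auto simp: abs_square_le_1)
      then show ?thesis using bound[of "t *\<^sub>R x" z] hom[OF xz(1), of t] xz by simp
    qed
    have "B (c *\<^sub>R x) z = c * B (1 *\<^sub>R x) z"
      by (rule additive_bounded_linear[OF _ bd]) (use xz in \<open>simp add: scaleR_left_distrib add\<close>)
    then show ?thesis by simp
  qed
  show ?thesis
    by (intro exI[of _ B] conjI ballI allI) (fact sym add scale diag bound)+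
qed

lemma principal_ideal_subspace: "0 \<le> y \<Longrightarrow> subspace (principal_ideal y)"
  unfolding subspace_def principal_ideal_def
proof (intro conjI ballI allI)
  fix a b :: 'a and c :: real
  assume "a \<in> {g. \<exists>c\<ge>0. \<bar>g\<bar> \<le> c *\<^sub>R y}" "b \<in> {g. \<exists>c\<ge>0. \<bar>g\<bar> \<le> c *\<^sub>R y}"
  then obtain s t where "0 \<le> s" "0 \<le> t" "\<bar>a\<bar> \<le> s *\<^sub>R y" "\<bar>b\<bar> \<le> t *\<^sub>R y" by blast
  then show "a + b \<in> {g. \<exists>c\<ge>0. \<bar>g\<bar> \<le> c *\<^sub>R y}"
    by (auto intro!: exI[of _ "s + t"] order.trans[OF abs_triangle_ineq] add_mono simp: scaleR_left_distrib)
next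
  fix a :: 'a and c :: real
  assume "a \<in> {g. \<exists>c\<ge>0. \<bar>g\<bar> \<le> c *\<^sub>R y}"
  then obtain s where "0 \<le> s" "\<bar>a\<bar> \<le> s *\<^sub>R y" by blast
  then show "c *\<^sub>R a \<in> {g. \<exists>c\<ge>0. \<bar>g\<bar> \<le> c *\<^sub>R y}"
    using scaleR_left_mono[of "\<bar>a\<bar>" "s *\<^sub>R y" "\<bar>c\<bar>"]
    by (auto intro!: exI[of _ "\<bar>c\<bar> * s"] simp: abs_scaleR_lattice)
qed auto

text \<open>In the \<open>C(K)\<close>-picture, where \<open>y\<close> is the constant function \<open>1\<close>, the element
  \<open>sup {2 \<lambda> g - \<lambda>\<^sup>2 y}\<close> is \<open>g\<^sup>2\<close>.  Its parallelogram law is the linear substitution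
  \<open>(\<lambda>, \<mu>) \<mapsto> (\<lambda> + \<mu>, \<lambda> - \<mu>)\<close> of the parameters.\<close>

lemma quadratic_form:
  fixes y :: "'a::banach_lattice"
  assumes sc: "sup_complete TYPE('a)" and y: "0 \<le> y" and \<phi>: "positive_functional \<phi>"
  obtains q :: "'a \<Rightarrow> real" where
    "\<And>a b. a \<in> principal_ideal y \<Longrightarrow> b \<in> principal_ideal y \<Longrightarrow> q (a + b) + q (a - b) = 2 * q a + 2 * q b"
    "\<And>c a. a \<in> principal_ideal y \<Longrightarrow> q (c *\<^sub>R a) = c\<^sup>2 * q a"
    "\<And>a. a \<in> principal_ideal y \<Longrightarrow> 0 \<le> q a"
    "\<And>a. \<bar>a\<bar> \<le> y \<Longrightarrow> q a \<le> blinfun_apply \<phi> y"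
    "\<And>a. a \<in> principal_ideal y \<Longrightarrow> (blinfun_apply \<phi> \<bar>a\<bar>)\<^sup>2 \<le> q a * blinfun_apply \<phi> y"
proof -
  define V where "V = principal_ideal y"
  have sub: "subspace V" using principal_ideal_subspace[OF y] by (simp add: V_def)
  define A where "A g = range (\<lambda>l. (2 * l) *\<^sub>R g - l\<^sup>2 *\<^sub>R y)" for g :: 'a
  have A_bd: "(2 * l) *\<^sub>R g - l\<^sup>2 *\<^sub>R y \<le> c\<^sup>2 *\<^sub>R y" if g: "\<bar>g\<bar> \<le> c *\<^sub>R y" "0 \<le> c" for g c l
  proof -
    have "(2 * l) *\<^sub>R g \<le> \<bar>(2 * l) *\<^sub>R g\<bar>" by (rule abs_ge_self)
    also have "\<dots> = \<bar>2 * l\<bar> *\<^sub>R \<bar>g\<bar>" by (rule abs_scaleR_lattice)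
    also have "\<dots> \<le> \<bar>2 * l\<bar> *\<^sub>R (c *\<^sub>R y)" using g by (intro scaleR_left_mono) auto
    also have "\<dots> = (2 * \<bar>l\<bar> * c) *\<^sub>R y" by (simp add: abs_mult)
    also have "\<dots> \<le> (c\<^sup>2 + l\<^sup>2) *\<^sub>R y"
      using sum_squares_bound[of "\<bar>l\<bar>" c] y by (intro scaleR_right_mono) auto
    finally show ?thesis by (simp add: diff_le_eq scaleR_left_distrib)
  qed
  have "\<exists>s. g \<in> V \<longrightarrow> is_sup (A g) s" for g
  proof (cases "g \<in> V")
    case True
    then obtain c where "0 \<le> c" "\<bar>g\<bar> \<le> c *\<^sub>R y" by (auto simp: V_def principal_ideal_def)
    then have "A g \<noteq> {} \<and> (\<exists>u. \<forall>a\<in>A g. a \<le> u)" using A_bd by (auto simp: A_def)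
    then show ?thesis using sc[unfolded sup_complete_def, rule_format, of "A g"] by blast
  qed simp
  then obtain Q where Q: "\<And>g. g \<in> V \<Longrightarrow> is_sup (A g) (Q g)" by metis
  have Q_ge: "(2 * l) *\<^sub>R g - l\<^sup>2 *\<^sub>R y \<le> Q g" if "g \<in> V" for g l
    using Q[OF that] by (auto simp: is_sup_def A_def)
  have Q_hom: "Q (c *\<^sub>R g) = c\<^sup>2 *\<^sub>R Q g" if g: "g \<in> V" for g c
  proof (cases "c = 0")
    case True
    have "0 \<in> A 0" unfolding A_def by (rule range_eqI[of _ _ 0]) simp
    moreover have "a \<le> 0" if "a \<in> A 0" for a
      using that y by (auto simp: A_def scaleR_nonneg_nonneg)
    ultimately have "is_sup (A 0) 0" by (auto simp: is_sup_def)
    then show ?thesis using True Q[of 0] is_sup_unique subspace_0[OF sub] by fastforce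
  next
    case False
    have "A (c *\<^sub>R g) = (\<lambda>a. c\<^sup>2 *\<^sub>R a) ` A g"
    proof (intro equalityI subsetI)
      fix a assume "a \<in> A (c *\<^sub>R g)"
      then obtain l where l: "a = (2 * l) *\<^sub>R c *\<^sub>R g - l\<^sup>2 *\<^sub>R y" by (auto simp: A_def)
      have "a = c\<^sup>2 *\<^sub>R ((2 * (l / c)) *\<^sub>R g - (l / c)\<^sup>2 *\<^sub>R y)"
        using False by (simp add: l scaleR_right_diff_distrib power2_eq_square)
      then show "a \<in> (\<lambda>a. c\<^sup>2 *\<^sub>R a) ` A g" unfolding A_def by blast
    next
      fix a assume "a \<in> (\<lambda>a. c\<^sup>2 *\<^sub>R a) ` A g"
      then obtain l where l: "a = c\<^sup>2 *\<^sub>R ((2 * l) *\<^sub>R g - l\<^sup>2 *\<^sub>R y)" by (auto simp: A_def)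
      have "a = (2 * (c * l)) *\<^sub>R c *\<^sub>R g - (c * l)\<^sup>2 *\<^sub>R y"
        by (simp add: l scaleR_right_diff_distrib power2_eq_square mult_ac)
      then show "a \<in> A (c *\<^sub>R g)" unfolding A_def by blast
    qed
    then show ?thesis
      using is_sup_scaleR[OF Q[OF g], of "c\<^sup>2"] Q[of "c *\<^sub>R g"] g False is_sup_unique subspace_scale[OF sub]
      by fastforce
  qed
  have Q_par: "Q (a + b) + Q (a - b) = 2 *\<^sub>R Q a + 2 *\<^sub>R Q b" if ab: "a \<in> V" "b \<in> V" for a b
  proof -
    have 1: "is_sup {x + x' |x x'. x \<in> A (a + b) \<and> x' \<in> A (a - b)} (Q (a + b) + Q (a - b))"
      using ab by (intro is_sup_plus Q subspace_add[OF sub] subspace_diff[OF sub])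
    have 2: "is_sup {x + x' |x x'. x \<in> (\<lambda>x. 2 *\<^sub>R x) ` A a \<and> x' \<in> (\<lambda>x. 2 *\<^sub>R x) ` A b} (2 *\<^sub>R Q a + 2 *\<^sub>R Q b)"
      using ab by (intro is_sup_plus is_sup_scaleR Q) auto
    have LR: "((2 * (r + s)) *\<^sub>R (a + b) - (r + s)\<^sup>2 *\<^sub>R y) + ((2 * (r - s)) *\<^sub>R (a - b) - (r - s)\<^sup>2 *\<^sub>R y) =
        2 *\<^sub>R ((2 * r) *\<^sub>R a - r\<^sup>2 *\<^sub>R y) + 2 *\<^sub>R ((2 * s) *\<^sub>R b - s\<^sup>2 *\<^sub>R y)" for r s
    proof -
      have "(r * 4) *\<^sub>R v = (r * 2) *\<^sub>R v + (r * 2) *\<^sub>R v"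
        "(r * (s * 2)) *\<^sub>R v = (r * s) *\<^sub>R v + (r * s) *\<^sub>R v" for r s and v :: 'a
        by (simp_all flip: scaleR_left_distrib)
      then show ?thesis by (simp add: algebra_simps power2_eq_square scaleR_2)
    qed
    have "{x + x' |x x'. x \<in> A (a + b) \<and> x' \<in> A (a - b)} =
        {x + x' |x x'. x \<in> (\<lambda>x. 2 *\<^sub>R x) ` A a \<and> x' \<in> (\<lambda>x. 2 *\<^sub>R x) ` A b}" (is "?X = ?Y")
    proof (intro equalityI subsetI)
      fix w assume "w \<in> ?X"
      then obtain l m where "w = ((2 * l) *\<^sub>R (a + b) - l\<^sup>2 *\<^sub>R y) + ((2 * m) *\<^sub>R (a - b) - m\<^sup>2 *\<^sub>R y)"
        unfolding A_def by blast
      moreover have "l = (l + m) / 2 + (l - m) / 2" "m = (l + m) / 2 - (l - m) / 2"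
        by (simp_all add: field_simps)
      ultimately obtain r s where "w = ((2 * (r + s)) *\<^sub>R (a + b) - (r + s)\<^sup>2 *\<^sub>R y) + ((2 * (r - s)) *\<^sub>R (a - b) - (r - s)\<^sup>2 *\<^sub>R y)"
        by metis
      then show "w \<in> ?Y" unfolding LR A_def by blast
    next
      fix w assume "w \<in> ?Y"
      then obtain r s where "w = 2 *\<^sub>R ((2 * r) *\<^sub>R a - r\<^sup>2 *\<^sub>R y) + 2 *\<^sub>R ((2 * s) *\<^sub>R b - s\<^sup>2 *\<^sub>R y)"
        unfolding A_def by blast
      then show "w \<in> ?X" unfolding LR[symmetric] A_def by blast
    qed
    from is_sup_unique[OF 1[unfolded this] 2] show ?thesis .
  qed
  define q where "q g = blinfun_apply \<phi> (Q g)" for g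
  note mono = positive_functional_mono[OF \<phi>]
  show ?thesis
  proof (rule that[of q, folded V_def])
    show "q (a + b) + q (a - b) = 2 * q a + 2 * q b" if "a \<in> V" "b \<in> V" for a b
      using arg_cong[OF Q_par[OF that], of "blinfun_apply \<phi>"]
      by (simp add: q_def blinfun.add_right blinfun.scaleR_right)
    show q_hom: "q (c *\<^sub>R a) = c\<^sup>2 * q a" if "a \<in> V" for c a
      using Q_hom[OF that] by (simp add: q_def blinfun.scaleR_right)
    show q_nn: "0 \<le> q a" if "a \<in> V" for a
      using Q_ge[OF that, of 0] \<phi> by (simp add: q_def positive_functional_def)
    show "q a \<le> blinfun_apply \<phi> y" if "\<bar>a\<bar> \<le> y" for a
    proof -
      have "a \<in> V" using that by (auto simp: V_def principal_ideal_def intro!: exI[of _ 1])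
      then have "Q a \<le> y" using Q[of a] A_bd[of a 1] that by (auto simp: is_sup_def A_def)
      then show ?thesis unfolding q_def by (rule mono)
    qed
    show "(blinfun_apply \<phi> \<bar>a\<bar>)\<^sup>2 \<le> q a * blinfun_apply \<phi> y" if a: "a \<in> V" for a
    proof -
      define p where "p = blinfun_apply \<phi> \<bar>a\<bar>"
      have p0: "0 \<le> p" using \<phi> by (simp add: p_def positive_functional_def)
      \<comment> \<open>The parameters 1 and -1 in the supremum belonging to
        \<open>t *\<^sub>R a\<close> bound twice its modulus. Optimising over \<open>t\<close>, that
        is \<open>t = p / q a\<close>, gives Cauchy-Schwarz; if \<open>q a = 0\<close>, arbitrarily
        large \<open>t\<close> force \<open>p = 0\<close>.\<close>
      have *: "2 * t * p \<le> t\<^sup>2 * q a + blinfun_apply \<phi> y" if t: "0 \<le> t" for t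
      proof -
        have "(2 * t) *\<^sub>R \<bar>a\<bar> = \<bar>(2 * t) *\<^sub>R a\<bar>" using t by (simp add: abs_scaleR_lattice)
        also have "\<dots> \<le> t\<^sup>2 *\<^sub>R Q a + y"
          using Q_ge[of "t *\<^sub>R a" 1] Q_ge[of "t *\<^sub>R a" "-1"] a Q_hom[OF a, of t] subspace_scale[OF sub a]
          by (intro abs_leI) (simp_all add: diff_le_eq)
        finally show ?thesis
          using mono[of "(2 * t) *\<^sub>R \<bar>a\<bar>" "t\<^sup>2 *\<^sub>R Q a + y"]
          by (simp add: q_def p_def blinfun.add_right blinfun.scaleR_right)
      qed
      show ?thesis
      proof (cases "q a = 0")
        case True
        have "p = 0"
        proof (rule ccontr)
          assume "p \<noteq> 0"
          then obtain n where "blinfun_apply \<phi> y < real n * p" using p0 reals_Archimedean3[of p] by auto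
          moreover have "2 * (real n * p) \<le> blinfun_apply \<phi> y" using *[of "real n"] True by simp
          moreover have "0 \<le> real n * p" using p0 by simp
          ultimately show False by linarith
        qed
        then show ?thesis using True by (simp add: p_def)
      next
        case False
        then have "q a > 0" using q_nn[OF a] by simp
        then show ?thesis using *[of "p / q a"] p0
          by (simp add: power2_eq_square field_simps p_def)
      qed
    qed
  qed
qed

section \<open>Images of order intervals under operators dominated by rank one\<close>

lemma order_interval_in_ideal: "\<bar>x\<bar> \<le> y \<Longrightarrow> x \<in> principal_ideal y"
  by (auto simp: principal_ideal_def intro!: exI[of _ 1])

lemma positive_functional_nonneg: "positive_functional \<phi> \<Longrightarrow> 0 \<le> x \<Longrightarrow> 0 \<le> blinfun_apply \<phi> x"
  by (simp add: positive_functional_def)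

lemma rank_one_dominated_abs:
  assumes "positive_op S" "\<And>x. 0 \<le> x \<Longrightarrow> blinfun_apply S x \<le> blinfun_apply \<phi> x *\<^sub>R f"
  shows "\<bar>blinfun_apply S x\<bar> \<le> blinfun_apply \<phi> \<bar>x\<bar> *\<^sub>R f"
  by (rule order.trans[OF positive_op_abs[OF assms(1)] assms(2)]) simp

text \<open>Square-summable multiples of the \<open>v i\<close> are uniformly order bounded, so order continuity makes
  the suprema of the partial square functions converge in norm, which leaves no room for new terms.\<close>

lemma l2_bounded_norm_small:
  fixes v :: "nat \<Rightarrow> 'a::banach_lattice"
  assumes oc: "order_continuous_norm TYPE('a)" and nn: "\<And>i. 0 \<le> v i" and e: "0 < e"
    and bd: "\<And>m c. (\<And>i. 0 \<le> c i) \<Longrightarrow> (\<Sum>i<m. (c i)\<^sup>2) \<le> 1 \<Longrightarrow> (\<Sum>i<m. c i *\<^sub>R v i) \<le> u"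
  obtains m where "norm (v m) < e"
proof (rule ccontr)
  assume "\<not> thesis"
  then have large: "e \<le> norm (v m)" for m using that[of m] by linarith
  define A where "A m = {(\<Sum>i<m. c i *\<^sub>R v i) |c. (\<forall>i. 0 \<le> c i) \<and> (\<Sum>i<m. (c i)\<^sup>2) \<le> (1::real)}" for m
  have A_step: "b *\<^sub>R a + t *\<^sub>R v m \<in> A (Suc m)"
    if a: "a \<in> A m" and bt: "0 \<le> b" "0 \<le> t" "b\<^sup>2 + t\<^sup>2 \<le> 1" for a m b t
  proof -
    obtain c where c: "a = (\<Sum>i<m. c i *\<^sub>R v i)" "\<And>i. 0 \<le> c i" "(\<Sum>i<m. (c i)\<^sup>2) \<le> 1"
      using a by (auto simp: A_def)
    define c' where "c' i = (if i < m then b * c i else t)" for i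
    have "(\<Sum>i<Suc m. c' i *\<^sub>R v i) = b *\<^sub>R a + t *\<^sub>R v m"
      by (simp add: c'_def c(1) scaleR_sum_right)
    moreover have "(\<Sum>i<Suc m. (c' i)\<^sup>2) = b\<^sup>2 * (\<Sum>i<m. (c i)\<^sup>2) + t\<^sup>2"
      by (simp add: c'_def power_mult_distrib sum_distrib_left)
    moreover have "b\<^sup>2 * (\<Sum>i<m. (c i)\<^sup>2) \<le> b\<^sup>2 * 1" using c(3) by (intro mult_left_mono) auto
    moreover have "\<forall>i. 0 \<le> c' i" using c(2) bt by (simp add: c'_def)
    ultimately show ?thesis using bt(3) unfolding A_def by (intro CollectI exI[of _ c']) auto
  qed
  have "\<exists>s. is_sup (A m) s" for m
  proof -
    have "(\<Sum>i<m. 0 *\<^sub>R v i) \<in> A m" unfolding A_def by (intro CollectI exI[of _ "\<lambda>_. 0"]) auto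
    moreover have "\<forall>a\<in>A m. a \<le> u" using bd by (auto simp: A_def)
    ultimately show ?thesis
      using sup_complete_order_continuous[OF oc, unfolded sup_complete_def, rule_format, of "A m"] by blast
  qed
  then obtain s where s: "\<And>m. is_sup (A m) (s m)" by metis
  have s_ge: "a \<le> s m" if "a \<in> A m" for a m using s[of m] that by (auto simp: is_sup_def)
  have s_step: "b *\<^sub>R s m + t *\<^sub>R v m \<le> s (Suc m)" if bt: "0 < b" "0 \<le> t" "b\<^sup>2 + t\<^sup>2 \<le> 1" for b t m
  proof -
    have sup: "is_sup ((\<lambda>a. b *\<^sub>R a) ` A m) (b *\<^sub>R s m)" using is_sup_scaleR[OF s bt(1)] .
    have "\<forall>a\<in>(\<lambda>a. b *\<^sub>R a) ` A m. a \<le> s (Suc m) - t *\<^sub>R v m"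
      using s_ge[OF A_step] bt by (auto simp: le_diff_eq)
    then have "b *\<^sub>R s m \<le> s (Suc m) - t *\<^sub>R v m" using sup by (simp add: is_sup_def)
    then show ?thesis by (simp add: le_diff_eq)
  qed
  have "incseq s" using s_step[of 1 0] by (intro incseq_SucI) auto
  then have s_mono: "s m \<le> s n" if "m \<le> n" for m n using that by (simp add: incseq_def)
  have "\<exists>z\<in>range s. x \<le> z \<and> y \<le> z" if "x \<in> range s" "y \<in> range s" for x y
    using that s_mono by (metis (no_types, opaque_lifting) imageE max.cobounded1 max.cobounded2 rangeI)
  moreover have "x \<le> u" if x: "x \<in> range s" for x
  proof -
    obtain m where "x = s m" using x by blast
    moreover have "\<forall>a\<in>A m. a \<le> u" using bd by (auto simp: A_def)
    ultimately show ?thesis using s[of m] by (auto simp: is_sup_def)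
  qed
  ultimately obtain l where l: "is_sup (range s) l"
    "\<And>e. e > 0 \<Longrightarrow> \<exists>d\<in>range s. \<forall>d'\<in>range s. d \<le> d' \<longrightarrow> norm (l - d') < e"
    using directed_tendsto_sup[OF oc, of "range s" u] by blast
  \<comment> \<open>A new term of weight \<open>t\<close> costs only a fraction
    \<open>1 - b\<close>, at most \<open>t\<^sup>2\<close>, of the old supremum. So \<open>t\<close>
    is chosen such that \<open>t * norm l\<close> is at most \<open>e / 4\<close>: the gain
    \<open>t * e\<close> then beats the loss and the remainder, each at most
    \<open>t * e / 4\<close>.\<close>
  define t where "t = min (1 / 2) (e / (4 * (norm l + 1)))"
  have t: "0 < t" "t \<le> 1 / 2" "t * (4 * (norm l + 1)) \<le> e"
    using e by (auto simp: t_def min_def field_simps add_pos_nonneg)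
  have "0 < t * e / 4" using t e by simp
  then obtain m where m: "norm (l - s m) < t * e / 4" using l(2) by blast
  define b where "b = sqrt (1 - t\<^sup>2)"
  have t2: "t\<^sup>2 < 1" using t by (simp add: abs_square_less_1)
  then have b: "0 < b" "b\<^sup>2 + t\<^sup>2 = 1" "b \<le> 1" by (auto simp: b_def)
  have "b\<^sup>2 \<le> b" using b by (simp add: power2_eq_square mult_left_le)
  then have "1 - t\<^sup>2 \<le> b" using b by linarith
  have "t *\<^sub>R v m \<le> s (Suc m) - b *\<^sub>R s m" using s_step[of b t m] b t by (simp add: le_diff_eq add.commute)
  also have "\<dots> \<le> l - b *\<^sub>R s m" using l(1) by (auto simp: is_sup_def)
  also have "\<dots> = (1 - b) *\<^sub>R l + b *\<^sub>R (l - s m)" by (simp add: algebra_simps)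
  finally have "norm (t *\<^sub>R v m) \<le> norm ((1 - b) *\<^sub>R l + b *\<^sub>R (l - s m))"
    using t nn[of m] by (intro norm_mono_pos scaleR_nonneg_nonneg) auto
  also have "\<dots> \<le> (1 - b) * norm l + b * norm (l - s m)"
    using norm_triangle_ineq[of "(1 - b) *\<^sub>R l" "b *\<^sub>R (l - s m)"] b by simp
  also have "\<dots> \<le> t\<^sup>2 * norm l + 1 * norm (l - s m)"
    using \<open>1 - t\<^sup>2 \<le> b\<close> b by (intro add_mono mult_right_mono) auto
  finally have "t * norm (v m) \<le> t * (t * norm l) + norm (l - s m)"
    using t by (simp add: power2_eq_square mult.assoc)
  moreover have "t * e \<le> t * norm (v m)" using large t by (intro mult_left_mono) auto
  moreover have "t * norm l \<le> e / 4" using t by (simp add: algebra_simps)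
  then have "t * (t * norm l) \<le> t * (e / 4)" using t by (intro mult_left_mono) auto
  moreover have "0 < t * e" using t e by simp
  ultimately show False using m by linarith
qed

text \<open>Without a finite cover, Gram-Schmidt for the form \<open>B\<close> produces orthogonal
  vectors \<open>d n\<close> with \<open>q (d n) \<le> N\<close> whose images have norm at least
  \<open>e / 2\<close>. For square-summable weights the sums of the moduli of these images are
  bounded by \<open>N *\<^sub>R f\<close>, since orthogonality controls \<open>q\<close> of every
  signed combination and \<open>q\<close> controls \<open>\<phi>\<close>. This contradicts
  \<open>l2_bounded_norm_small\<close>.\<close>

lemma rank_one_dominated_totally_bounded:
  fixes S :: "'a::banach_lattice \<Rightarrow>\<^sub>L 'a"
  assumes oc: "order_continuous_norm TYPE('a)" and S: "rank_one_dominated S" and y: "0 \<le> y" and e: "0 < e"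
  shows "\<exists>k. finite k \<and> blinfun_apply S ` {x. \<bar>x\<bar> \<le> y} \<subseteq> (\<Union>c\<in>k. ball c e)"
proof (rule ccontr)
  assume no_cover: "\<not> ?thesis"
  obtain \<phi> f where \<phi>: "positive_functional \<phi>" "0 \<le> f"
    "\<And>x. 0 \<le> x \<Longrightarrow> blinfun_apply S x \<le> blinfun_apply \<phi> x *\<^sub>R f" and pS: "positive_op S"
    using S by (auto simp: rank_one_dominated_def)
  define V where "V = principal_ideal y"
  have sub: "subspace V" using principal_ideal_subspace[OF y] by (simp add: V_def)
  note sub_sum = subspace_sum[OF sub] and sub_scale = subspace_scale[OF sub]
  obtain q where q: "\<And>a b. a \<in> V \<Longrightarrow> b \<in> V \<Longrightarrow> q (a + b) + q (a - b) = 2 * q a + 2 * q b"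
    "\<And>c a. a \<in> V \<Longrightarrow> q (c *\<^sub>R a) = c\<^sup>2 * q a"
    "\<And>a. a \<in> V \<Longrightarrow> 0 \<le> q a" "\<And>a. \<bar>a\<bar> \<le> y \<Longrightarrow> q a \<le> blinfun_apply \<phi> y"
    "\<And>a. a \<in> V \<Longrightarrow> (blinfun_apply \<phi> \<bar>a\<bar>)\<^sup>2 \<le> q a * blinfun_apply \<phi> y"
    using quadratic_form[OF sup_complete_order_continuous[OF oc] y \<phi>(1)] unfolding V_def by blast
  have "\<exists>B. (\<forall>x\<in>V. \<forall>y\<in>V. B x y = B y x) \<and>
    (\<forall>x\<in>V. \<forall>x'\<in>V. \<forall>y\<in>V. B (x + x') y = B x y + B x' y) \<and>
    (\<forall>c. \<forall>x\<in>V. \<forall>y\<in>V. B (c *\<^sub>R x) y = c * B x y) \<and>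
    (\<forall>x\<in>V. B x x = q x) \<and> (\<forall>x\<in>V. \<forall>y\<in>V. \<bar>B x y\<bar> \<le> (q x + q y) / 2)"
    by (rule jordan_von_neumann[OF sub]) (fact q(1-3))+
  then obtain B where B: "(\<forall>x\<in>V. \<forall>y\<in>V. B x y = B y x) \<and>
    (\<forall>x\<in>V. \<forall>x'\<in>V. \<forall>y\<in>V. B (x + x') y = B x y + B x' y) \<and>
    (\<forall>c. \<forall>x\<in>V. \<forall>y\<in>V. B (c *\<^sub>R x) y = c * B x y) \<and>
    (\<forall>x\<in>V. B x x = q x) \<and> (\<forall>x\<in>V. \<forall>y\<in>V. \<bar>B x y\<bar> \<le> (q x + q y) / 2)" ..
  have B_sym: "\<And>x y. x \<in> V \<Longrightarrow> y \<in> V \<Longrightarrow> B x y = B y x"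
    and B_add: "\<And>x x' y. x \<in> V \<Longrightarrow> x' \<in> V \<Longrightarrow> y \<in> V \<Longrightarrow> B (x + x') y = B x y + B x' y"
    and B_scale: "\<And>c x y. x \<in> V \<Longrightarrow> y \<in> V \<Longrightarrow> B (c *\<^sub>R x) y = c * B x y"
    and B_diag: "\<And>x. x \<in> V \<Longrightarrow> B x x = q x"
    and B_bd: "\<And>x y. x \<in> V \<Longrightarrow> y \<in> V \<Longrightarrow> \<bar>B x y\<bar> \<le> (q x + q y) / 2"
    using B by blast+
  have B_sum: "B (\<Sum>i\<in>I. c i *\<^sub>R d i) z = (\<Sum>i\<in>I. c i * B (d i) z)"
    if "\<And>i. i \<in> I \<Longrightarrow> d i \<in> V" "z \<in> V" "finite I" for I and c and d :: "nat \<Rightarrow> 'a" and z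
    using that(3,1)
  proof (induction I rule: finite_induct)
    case empty
    then show ?case using B_scale[of z z 0] that(2) by simp
  next
    case (insert i I)
    then have "(\<Sum>i\<in>I. c i *\<^sub>R d i) \<in> V" by (intro sub_sum sub_scale) auto
    then show ?case using insert that(2) by (simp add: B_add B_scale sub_scale)
  qed
  define N where "N = blinfun_apply \<phi> y"
  have N0: "0 \<le> N" using positive_functional_nonneg[OF \<phi>(1) y] by (simp add: N_def)
  have abs_S: "\<bar>blinfun_apply S x\<bar> \<le> blinfun_apply \<phi> \<bar>x\<bar> *\<^sub>R f" for x
    by (rule rank_one_dominated_abs[OF pS \<phi>(3)])
  have q_pos: "0 < q x" if "x \<in> V" "0 < norm (blinfun_apply S x)" for x
  proof (rule ccontr)
    assume "\<not> 0 < q x"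
    then have "q x = 0" using q(3)[OF that(1)] by simp
    then have "blinfun_apply \<phi> \<bar>x\<bar> = 0" using q(5)[OF that(1)] by simp
    then show False using abs_S[of x] that(2) by simp
  qed
  \<comment> \<open>Orthogonal remainders may leave the order interval; membership in the ideal and
    \<open>q x \<le> N\<close> survive, which is all that the estimates use.\<close>
  define P where "P d n x \<longleftrightarrow> x \<in> V \<and> q x \<le> N \<and> e / 2 \<le> norm (blinfun_apply S x) \<and> (\<forall>i<n. B x (d i) = 0)"
    for d :: "nat \<Rightarrow> 'a" and n x
  have "\<exists>d. \<forall>n. P d n (d n)"
  proof (rule dependent_wellorder_choice)
    fix r :: 'a and f g :: "nat \<Rightarrow> 'a" and x :: nat
    assume "\<And>y. y < x \<Longrightarrow> f y = g y"
    then show "P f x r = P g x r" by (simp add: P_def)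
  next
    fix n and d :: "nat \<Rightarrow> 'a"
    assume d: "\<And>i. i < n \<Longrightarrow> P d i (d i)"
    then have dV: "d i \<in> V" "q (d i) \<le> N" and "e / 2 \<le> norm (blinfun_apply S (d i))" if "i < n" for i
      using that unfolding P_def by blast+
    then have "0 < norm (blinfun_apply S (d i))" if "i < n" for i
      using that e half_gt_zero order.strict_trans2 by blast
    then have dV: "d i \<in> V" "q (d i) \<le> N" "0 < q (d i)" if "i < n" for i
      using dV[OF that] q_pos[of "d i"] that by blast+
    have orth: "B (d i) (d j) = 0" if "i < n" "j < n" "i \<noteq> j" for i j
      using d[OF that(1)] d[OF that(2)] that(3) B_sym[OF dV(1)[OF that(1)] dV(1)[OF that(2)]]
      by (cases "i < j") (auto simp: P_def)
    \<comment> \<open>This compact set contains the image of the \<open>B\<close>-projection of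
      every \<open>z\<close> in the order interval: the coefficients are
      \<open>B z (d i) / q (d i)\<close>, and the numerator is at most \<open>N\<close> in
      modulus.\<close>
    define W where "W = {(\<Sum>i<n. a i *\<^sub>R blinfun_apply S (d i)) |a. \<forall>i\<in>{..<n}. \<bar>a i\<bar> \<le> N / q (d i)}"
    have "compact W" unfolding W_def by (intro finite_combinations_compact) auto
    from this[unfolded compact_eq_totally_bounded, THEN conjunct2, rule_format, of "e / 2"]
    obtain k where k: "finite k" "W \<subseteq> (\<Union>c\<in>k. ball c (e / 2))" using e by auto
    \<comment> \<open>A point outside the \<open>e\<close>-balls whose \<open>e / 2\<close>-balls
      cover \<open>W\<close> has image at distance at least \<open>e / 2\<close> from
      \<open>W\<close>, hence a large remainder.\<close>
    obtain z where z: "\<bar>z\<bar> \<le> y" "blinfun_apply S z \<notin> (\<Union>c\<in>k. ball c e)"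
      using no_cover k(1) by blast
    have zV: "z \<in> V" using z order_interval_in_ideal by (simp add: V_def)
    define a where "a i = B z (d i) / q (d i)" for i
    define p where "p = (\<Sum>i<n. a i *\<^sub>R d i)"
    define x where "x = z - p"
    have pV: "p \<in> V" unfolding p_def using dV by (intro sub_sum sub_scale) auto
    have xV: "x \<in> V" unfolding x_def by (intro subspace_diff[OF sub] zV pV)
    have B_x: "B x (d j) = 0" if "j < n" for j
    proof -
      have "B p (d j) = (\<Sum>i<n. a i * B (d i) (d j))"
        unfolding p_def using dV that by (intro B_sum) auto
      also have "\<dots> = (\<Sum>i<n. if i = j then a j * q (d j) else 0)"
        using orth that B_diag dV by (intro sum.cong) auto
      also have "\<dots> = B z (d j)" using that dV[OF that] by (simp add: a_def)
      finally have "B p (d j) = B z (d j)" .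
      moreover have "B z (d j) = B x (d j) + B p (d j)"
        using B_add[OF xV pV dV(1)[OF that]] by (simp add: x_def)
      ultimately show ?thesis by simp
    qed
    have "B p x = (\<Sum>i<n. a i * B (d i) x)"
      unfolding p_def using dV xV by (intro B_sum) auto
    also have "\<dots> = 0" using B_x B_sym[OF xV] dV by (intro sum.neutral) auto
    finally have px: "B p x = 0" .
    have "q z = B (x + p) (x + p)" using B_diag[OF zV] by (simp add: x_def)
    also have "\<dots> = B x (x + p) + B p (x + p)" using xV pV by (simp add: B_add subspace_add[OF sub])
    also have "B x (x + p) = q x"
      using B_sym[OF xV subspace_add[OF sub xV pV]] B_add[OF xV pV xV] B_diag[OF xV] px by simp
    also have "B p (x + p) = q p"
      using B_sym[OF pV subspace_add[OF sub xV pV]] B_add[OF xV pV pV] B_diag[OF pV] px B_sym[OF pV xV] by simp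
    finally have "q x \<le> q z" using q(3)[OF pV] by simp
    then have "q x \<le> N" using q(4)[OF z(1)] by (simp add: N_def)
    have "blinfun_apply S p \<in> W"
    proof -
      have "\<bar>a i\<bar> \<le> N / q (d i)" if "i < n" for i
      proof -
        have "\<bar>B z (d i)\<bar> \<le> N" using B_bd[OF zV dV(1)[OF that]] q(4)[OF z(1)] dV(2)[OF that] by (simp add: N_def)
        then show ?thesis using dV(3)[OF that] by (simp add: a_def abs_divide divide_right_mono)
      qed
      then show ?thesis unfolding W_def p_def
        by (intro CollectI exI[of _ a]) (simp add: blinfun.sum_right blinfun.scaleR_right)
    qed
    then obtain c where c: "c \<in> k" "dist c (blinfun_apply S p) < e / 2" using k by auto
    then have "e \<le> dist c (blinfun_apply S z)" using z(2) by auto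
    also have "\<dots> \<le> dist c (blinfun_apply S p) + dist (blinfun_apply S p) (blinfun_apply S z)" by (rule dist_triangle)
    finally have "e / 2 \<le> norm (blinfun_apply S x)"
      using c by (simp add: x_def blinfun.diff_right dist_norm norm_minus_commute)
    then show "\<exists>r. P d n r" using xV \<open>q x \<le> N\<close> B_x by (auto simp: P_def)
  qed
  then obtain d where d: "\<And>n. P d n (d n)" by blast
  have dV: "d i \<in> V" "q (d i) \<le> N" for i using d[of i] by (auto simp: P_def)
  have orth: "B (d i) (d j) = 0" if "i \<noteq> j" for i j
    using d[of i] d[of j] that B_sym[OF dV(1)[of i] dV(1)[of j]] by (cases "i < j") (auto simp: P_def)
  obtain m where "norm \<bar>blinfun_apply S (d m)\<bar> < e / 2"
  proof (rule l2_bounded_norm_small[OF oc, of "\<lambda>i. \<bar>blinfun_apply S (d i)\<bar>" "e / 2" "N *\<^sub>R f"])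
    fix m and c :: "nat \<Rightarrow> real" assume c: "\<And>i. 0 \<le> c i" "(\<Sum>i<m. (c i)\<^sup>2) \<le> 1"
    \<comment> \<open>The moduli are not linear in the vectors, signed sums are; for each sign
      pattern a single application of \<open>S\<close> to \<open>g\<close> remains.\<close>
    have "0 + (\<Sum>i<m. \<bar>blinfun_apply S (c i *\<^sub>R d i)\<bar>) \<le> N *\<^sub>R f"
    proof (rule sum_abs_le_signs)
      fix s :: "nat \<Rightarrow> real" assume s: "\<And>i. s i = 1 \<or> s i = - 1"
      define g where "g = (\<Sum>i<m. (s i * c i) *\<^sub>R d i)"
      have gV: "g \<in> V" unfolding g_def using dV by (intro sub_sum sub_scale) auto
      have Bdg: "B (d i) g = s i * c i * q (d i)" if "i < m" for i
      proof -
        have "B g (d i) = (\<Sum>j<m. (s j * c j) * B (d j) (d i))"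
          unfolding g_def using dV by (intro B_sum) auto
        also have "\<dots> = (\<Sum>j<m. if j = i then s i * c i * q (d i) else 0)"
          using orth B_diag dV by (intro sum.cong) auto
        finally show ?thesis using that B_sym[OF gV dV(1)] by simp
      qed
      have "q g = (\<Sum>i<m. (s i * c i) * B (d i) g)"
        using B_diag[OF gV] B_sum[of "{..<m}" d g "\<lambda>i. s i * c i"] dV(1) gV by (simp flip: g_def)
      also have "\<dots> = (\<Sum>i<m. (c i)\<^sup>2 * q (d i))"
      proof (intro sum.cong refl)
        fix i assume "i \<in> {..<m}"
        then show "s i * c i * B (d i) g = (c i)\<^sup>2 * q (d i)"
          using Bdg[of i] s[of i] by (auto simp: power2_eq_square)
      qed
      also have "\<dots> \<le> (\<Sum>i<m. (c i)\<^sup>2 * N)" using dV by (intro sum_mono mult_left_mono) auto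
      also have "\<dots> \<le> 1 * N" using c N0 unfolding sum_distrib_right[symmetric] by (intro mult_right_mono) auto
      finally have "q g * N \<le> N * N" using N0 by (intro mult_right_mono) auto
      then have "(blinfun_apply \<phi> \<bar>g\<bar>)\<^sup>2 \<le> N\<^sup>2" using q(5)[OF gV] by (simp add: N_def power2_eq_square)
      then have "blinfun_apply \<phi> \<bar>g\<bar> \<le> N" using N0 by (rule power2_le_imp_le)
      then have "blinfun_apply \<phi> \<bar>g\<bar> *\<^sub>R f \<le> N *\<^sub>R f" using \<phi>(2) by (intro scaleR_right_mono)
      then have "blinfun_apply S g \<le> N *\<^sub>R f"
        using abs_S[of g] abs_ge_self[of "blinfun_apply S g"] by (meson order.trans)
      then show "0 + (\<Sum>i<m. s i *\<^sub>R blinfun_apply S (c i *\<^sub>R d i)) \<le> N *\<^sub>R f"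
        by (simp add: g_def blinfun.sum_right blinfun.scaleR_right)
    qed simp
    then show "(\<Sum>i<m. c i *\<^sub>R \<bar>blinfun_apply S (d i)\<bar>) \<le> N *\<^sub>R f"
      using c(1) by (simp add: blinfun.scaleR_right abs_scaleR_lattice)
  qed (use e in auto)
  then show False using d[of m] by (simp add: P_def norm_abs)
qed

lemma totally_bounded_compact_closure:
  fixes A :: "'a::banach set"
  assumes "\<And>e. e > 0 \<Longrightarrow> \<exists>k. finite k \<and> A \<subseteq> (\<Union>c\<in>k. ball c e)"
  shows "compact (closure A)"
  unfolding compact_eq_totally_bounded
proof (intro conjI allI impI)
  show "complete (closure A)" by (simp add: complete_eq_closed)
  fix e :: real assume e: "0 < e"
  then obtain k where k: "finite k" "A \<subseteq> (\<Union>c\<in>k. ball c (e / 2))"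
    using assms[of "e / 2"] by auto
  have "closure A \<subseteq> (\<Union>c\<in>k. cball c (e / 2))"
  proof (rule closure_minimal)
    show "A \<subseteq> (\<Union>c\<in>k. cball c (e / 2))" using k(2) ball_subset_cball by blast
    show "closed (\<Union>c\<in>k. cball c (e / 2))" using k(1) by (intro closed_UN) auto
  qed
  also have "\<dots> \<subseteq> (\<Union>c\<in>k. ball c e)" using e by (auto intro!: bexI)
  finally show "\<exists>k. finite k \<and> closure A \<subseteq> (\<Union>c\<in>k. ball c e)" using k(1) by blast
qed

text \<open>Since \<open>K - S\<close> is positive, its value at \<open>y\<close> dominates its
  values on the whole order interval: approximation at one vector is uniform there.\<close>

lemma kernel_op_compact:
  fixes K :: "'a::banach_lattice \<Rightarrow>\<^sub>L 'a"
  assumes oc: "order_continuous_norm TYPE('a)" and K: "positive_op K" "kernel_op K" and y: "0 \<le> y"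
  shows "compact (closure (blinfun_apply K ` {x. \<bar>x\<bar> \<le> y}))"
proof (rule totally_bounded_compact_closure)
  fix e :: real assume e: "0 < e"
  then obtain S where S: "rank_one_dominated S" "op_le S K" "norm (blinfun_apply K y - blinfun_apply S y) < e / 2"
    using kernel_op_approx[OF oc K y, of "e / 2"] by auto
  obtain k where k: "finite k" "blinfun_apply S ` {x. \<bar>x\<bar> \<le> y} \<subseteq> (\<Union>c\<in>k. ball c (e / 2))"
    using rank_one_dominated_totally_bounded[OF oc S(1) y, of "e / 2"] e by auto
  have "blinfun_apply K x \<in> (\<Union>c\<in>k. ball c e)" if x: "\<bar>x\<bar> \<le> y" for x
  proof -
    have pos: "positive_op (K - S)" using S(2) by (simp add: op_le_def)
    have "\<bar>blinfun_apply (K - S) x\<bar> \<le> blinfun_apply (K - S) y"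
      using positive_op_abs[OF pos, of x] positive_op_mono[OF pos x] by (rule order.trans)
    then have "norm (blinfun_apply (K - S) x) \<le> norm (blinfun_apply (K - S) y)" by (rule norm_le_of_abs_le)
    then have "dist (blinfun_apply S x) (blinfun_apply K x) < e / 2"
      using S(3) by (simp add: blinfun.diff_left dist_norm norm_minus_commute)
    moreover obtain c where "c \<in> k" "dist c (blinfun_apply S x) < e / 2" using k(2) x by auto
    ultimately have "dist c (blinfun_apply K x) < e" "c \<in> k"
      using dist_triangle[of c "blinfun_apply K x" "blinfun_apply S x"] by linarith+
    then show ?thesis by auto
  qed
  then show "\<exists>k. finite k \<and> blinfun_apply K ` {x. \<bar>x\<bar> \<le> y} \<subseteq> (\<Union>c\<in>k. ball c e)" using k(1) by blast
qed

text \<open>\<open>\<psi>\<close> is a weighted series of functionals dominating approximants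
  \<open>S n\<close> of \<open>K\<close> at \<open>y\<close>. If \<open>\<psi>\<close> vanishes at
  \<open>x\<close>, so does each of them, and then \<open>K x\<close> is at most the error
  \<open>(K - S n) y\<close> for all \<open>n\<close>. As \<open>T s\<close> will be injective on
  the range of the limit projection, \<open>\<psi>\<close> is strictly positive on its positive
  elements below \<open>y\<close>.\<close>

lemma kernel_op_strictly_positive:
  fixes K :: "'a::banach_lattice \<Rightarrow>\<^sub>L 'a"
  assumes oc: "order_continuous_norm TYPE('a)" and K: "positive_op K" "kernel_op K" and y: "0 \<le> y"
  obtains \<psi> where "positive_functional \<psi>"
    "\<And>x. 0 \<le> x \<Longrightarrow> x \<le> y \<Longrightarrow> blinfun_apply \<psi> x = 0 \<Longrightarrow> blinfun_apply K x = 0"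
proof -
  have "\<exists>S. rank_one_dominated S \<and> op_le S K \<and> norm (blinfun_apply K y - blinfun_apply S y) < 1 / real (Suc n)" for n
    using kernel_op_approx[OF oc K y, of "1 / real (Suc n)"] by auto
  then obtain S where S: "\<And>n. rank_one_dominated (S n)" "\<And>n. op_le (S n) K"
    "\<And>n. norm (blinfun_apply K y - blinfun_apply (S n) y) < 1 / real (Suc n)" by metis
  have "\<exists>\<phi>. positive_functional \<phi> \<and> (\<forall>x\<ge>0. blinfun_apply \<phi> x = 0 \<longrightarrow> blinfun_apply (S n) x \<le> 0)" for n
    using S(1)[of n] unfolding rank_one_dominated_def by (metis scaleR_zero_left)
  then obtain \<phi> where \<phi>: "\<And>n. positive_functional (\<phi> n)"
    "\<And>n x. 0 \<le> x \<Longrightarrow> blinfun_apply (\<phi> n) x = 0 \<Longrightarrow> blinfun_apply (S n) x \<le> 0" by metis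
  \<comment> \<open>The weights bound the terms by a geometric series; the summand 1 avoids division
    by 0.\<close>
  define c where "c n = (1 / 2) ^ n / (1 + norm (\<phi> n))" for n
  have c: "0 < c n" for n by (simp add: c_def add_pos_nonneg)
  have "norm (c n *\<^sub>R \<phi> n) \<le> (1 / 2) ^ n" for n
  proof -
    have "norm (c n *\<^sub>R \<phi> n) = (1 / 2) ^ n * (norm (\<phi> n) / (1 + norm (\<phi> n)))"
      by (simp add: c_def abs_of_nonneg add_nonneg_nonneg)
    also have "\<dots> \<le> (1 / 2) ^ n * 1" by (intro mult_left_mono) (auto simp: divide_simps add_pos_nonneg)
    finally show ?thesis by simp
  qed
  then have sum: "summable (\<lambda>n. c n *\<^sub>R \<phi> n)"
    by (intro summable_comparison_test[OF _ summable_geometric[of "1 / 2 :: real"]]) auto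
  define \<psi> where "\<psi> = (\<Sum>n. c n *\<^sub>R \<phi> n)"
  have app: "(\<lambda>n. c n * blinfun_apply (\<phi> n) x) sums blinfun_apply \<psi> x" for x
    using bounded_linear.sums[OF blinfun.bounded_linear_left summable_sums[OF sum], of x]
    by (simp add: \<psi>_def blinfun.scaleR_left)
  have term_nn: "0 \<le> c n * blinfun_apply (\<phi> n) x" if "0 \<le> x" for n x
    using c[of n] \<phi>(1)[of n] that by (simp add: positive_functional_def)
  have "positive_functional \<psi>"
    unfolding positive_functional_def using sums_le[OF _ sums_zero app] term_nn by blast
  moreover have "blinfun_apply K x = 0" if x: "0 \<le> x" "x \<le> y" "blinfun_apply \<psi> x = 0" for x
  proof -
    have "c n * blinfun_apply (\<phi> n) x = 0" for n
      using suminf_eq_zero_iff[OF sums_summable[OF app[of x]] term_nn[OF x(1)]] sums_unique[OF app[of x]] x(3) by simp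
    then have S0: "blinfun_apply (S n) x \<le> 0" for n using c[of n] x(1) by (intro \<phi>(2)) (auto simp: less_le)
    have "norm (blinfun_apply K x) \<le> 1 / real (Suc n)" for n
    proof -
      have "positive_op (K - S n)" using S(2) by (simp add: op_le_def)
      then have "blinfun_apply (K - S n) x \<le> blinfun_apply (K - S n) y" using x(2) by (rule positive_op_mono)
      then have "blinfun_apply K x \<le> blinfun_apply K y - blinfun_apply (S n) y"
        using add_mono[OF S0[of n]] by (fastforce simp: blinfun.diff_left diff_le_eq)
      moreover have "0 \<le> blinfun_apply K x" using K(1) x(1) by (simp add: positive_op_def)
      ultimately show ?thesis using norm_mono_pos S(3)[of n] by (meson order.trans less_imp_le)
    qed
    then have "norm (blinfun_apply K x) \<le> 0"
      by (intro LIMSEQ_le_const[OF LIMSEQ_Suc[OF lim_1_over_n]]) auto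
    then show ?thesis by simp
  qed
  ultimately show ?thesis using that by blast
qed

section \<open>Strong limit points of the semigroup\<close>

text \<open>Compactness of one image of the order interval is the only trace of the kernel property
  until \<open>\<psi>\<close> is introduced.\<close>

locale compact_semigroup =
  fixes T :: "real \<Rightarrow> 'a::banach_lattice \<Rightarrow>\<^sub>L 'a" and M s :: real and y :: 'a
  assumes semigroup: "0 < t \<Longrightarrow> 0 < r \<Longrightarrow> blinfun_apply (T (t + r)) x = blinfun_apply (T t) (blinfun_apply (T r) x)"
    and bound: "0 < t \<Longrightarrow> norm (T t) \<le> M"
    and pos: "0 < t \<Longrightarrow> positive_op (T t)"
    and y: "0 \<le> y" "closure (principal_ideal y) = UNIV"
    and fix_y: "0 < t \<Longrightarrow> blinfun_apply (T t) y = y"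
    and s: "0 < s"
    and compact_image: "compact (closure (blinfun_apply (T s) ` {x. \<bar>x\<bar> \<le> y}))"
begin

abbreviation "K \<equiv> closure (blinfun_apply (T s) ` {x. \<bar>x\<bar> \<le> y})"

lemma M_nonneg: "0 \<le> M"
  using bound[of 1] norm_ge_zero[of "T 1"] by linarith

lemma norm_T: "0 < t \<Longrightarrow> norm (blinfun_apply (T t) x) \<le> M * norm x"
  using norm_blinfun[of "T t" x] mult_right_mono[OF bound[of t] norm_ge_zero[of x]] by linarith

lemma dist_T: "0 < t \<Longrightarrow> dist (blinfun_apply (T t) x) (blinfun_apply (T t) z) \<le> M * dist x z"
  using norm_T[of t "x - z"] by (simp add: dist_norm blinfun.diff_right)

lemma commute: "0 < t \<Longrightarrow> 0 < r \<Longrightarrow>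
  blinfun_apply (T t) (blinfun_apply (T r) x) = blinfun_apply (T r) (blinfun_apply (T t) x)"
  by (simp flip: semigroup add: add.commute)

lemma interval_invariant:
  assumes "0 < t" "\<bar>x\<bar> \<le> y" shows "\<bar>blinfun_apply (T t) x\<bar> \<le> y"
  using positive_op_abs[OF pos[OF assms(1)], of x] positive_op_mono[OF pos[OF assms(1)] assms(2)]
  by (simp add: fix_y assms(1))

text \<open>\<open>T t\<close> commutes with \<open>T s\<close>, and it preserves the order interval
  because \<open>y\<close> is fixed.\<close>

lemma K_invariant:
  assumes "0 < t" "x \<in> K" shows "blinfun_apply (T t) x \<in> K"
proof -
  have "blinfun_apply (T t) ` K \<subseteq> closure (blinfun_apply (T t) ` blinfun_apply (T s) ` {x. \<bar>x\<bar> \<le> y})"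
    by (intro continuous_image_closure_subset[of UNIV] linear_continuous_on blinfun.bounded_linear_right) auto
  also have "\<dots> \<subseteq> K"
    using interval_invariant[OF assms(1)] s assms(1)
    by (intro closure_mono) (auto simp: commute[of t s])
  finally show ?thesis using assms(2) by blast
qed

text \<open>The common bound \<open>M\<close> makes the operators equicontinuous, so the Cauchy
  property passes to limits of arguments. \<open>M + 1\<close> is used because \<open>M\<close> may
  be 0.\<close>

lemma convergent_closed:
  assumes "\<And>k. 0 < u k"
  shows "closed {x. convergent (\<lambda>k. blinfun_apply (T (u k)) x)}"
  unfolding closed_sequential_limits
proof (intro allI impI, elim conjE)
  fix x l assume x: "\<forall>n. x n \<in> {x. convergent (\<lambda>k. blinfun_apply (T (u k)) x)}" "x \<longlonglongrightarrow> l"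
  have "Cauchy (\<lambda>k. blinfun_apply (T (u k)) l)"
  proof (rule metric_CauchyI)
    fix e :: real assume e: "0 < e"
    have "0 < e / (3 * (M + 1))" using e M_nonneg by simp
    then obtain n where n: "dist (x n) l < e / (3 * (M + 1))" using metric_LIMSEQ_D[OF x(2)] by blast
    have "M * dist (x n) l \<le> (M + 1) * dist (x n) l" by (intro mult_right_mono) auto
    also have "\<dots> < e / 3" using n M_nonneg by (simp add: field_simps)
    finally have small: "M * dist (x n) l < e / 3" .
    have "Cauchy (\<lambda>k. blinfun_apply (T (u k)) (x n))" using x(1) convergent_Cauchy by blast
    then obtain N where N: "\<And>i j. i \<ge> N \<Longrightarrow> j \<ge> N \<Longrightarrow>
        dist (blinfun_apply (T (u i)) (x n)) (blinfun_apply (T (u j)) (x n)) < e / 3"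
      using e metric_CauchyD[of "\<lambda>k. blinfun_apply (T (u k)) (x n)" "e / 3"] by auto
    have "dist (blinfun_apply (T (u i)) l) (blinfun_apply (T (u j)) l) < e" if "i \<ge> N" "j \<ge> N" for i j
      using dist_triangle3[of "blinfun_apply (T (u i)) l" "blinfun_apply (T (u j)) l" "blinfun_apply (T (u i)) (x n)"]
        dist_triangle[of "blinfun_apply (T (u i)) (x n)" "blinfun_apply (T (u j)) l" "blinfun_apply (T (u j)) (x n)"]
        dist_T[OF assms, of i "x n" l] dist_T[OF assms, of j "x n" l] N[OF that] small by linarith
    then show "\<exists>N. \<forall>i\<ge>N. \<forall>j\<ge>N. dist (blinfun_apply (T (u i)) l) (blinfun_apply (T (u j)) l) < e" by blast
  qed
  then show "l \<in> {x. convergent (\<lambda>k. blinfun_apply (T (u k)) x)}" by (simp add: Cauchy_convergent_iff)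
qed

text \<open>By uniform boundedness operator and argument may converge at the same time, so strong
  limits can be multiplied.\<close>

lemma T_tendsto:
  assumes u: "\<And>k. 0 < u k" and lim: "(\<lambda>k. blinfun_apply (T (u k)) x) \<longlonglongrightarrow> l" and z: "z \<longlonglongrightarrow> x"
  shows "(\<lambda>k. blinfun_apply (T (u k)) (z k)) \<longlonglongrightarrow> l"
proof -
  have "(\<lambda>k. blinfun_apply (T (u k)) (z k - x)) \<longlonglongrightarrow> 0"
  proof (rule Lim_null_comparison)
    show "\<forall>\<^sub>F k in sequentially. norm (blinfun_apply (T (u k)) (z k - x)) \<le> M * norm (z k - x)"
      using norm_T[OF u] by simp
    have "(\<lambda>k. M * norm (z k - x)) \<longlonglongrightarrow> M * norm (x - x)"
      using z by (intro tendsto_intros)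
    then show "(\<lambda>k. M * norm (z k - x)) \<longlonglongrightarrow> 0" by simp
  qed
  from tendsto_add[OF lim this] show ?thesis by (simp add: blinfun.diff_right)
qed

lemma K_countable_dense:
  "\<exists>d :: nat \<Rightarrow> 'a. range d \<subseteq> K \<and> K \<subseteq> closure (range d)"
proof -
  have "\<exists>k. finite k \<and> k \<subseteq> K \<and> K \<subseteq> (\<Union>x\<in>k. ball x (1 / real (Suc n)))" for n
    using seq_compact_imp_totally_bounded[OF compact_imp_seq_compact[OF compact_image]] by simp
  then obtain k where k: "\<And>n. finite (k n)" "\<And>n. k n \<subseteq> K" "\<And>n. K \<subseteq> (\<Union>x\<in>k n. ball x (1 / real (Suc n)))"
    by metis
  define D where "D = (\<Union>n. k n)"
  have "0 \<in> K"
    using y(1) by (intro subsetD[OF closure_subset] image_eqI[of _ _ 0]) (auto simp: blinfun.zero_right)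
  then have "k 0 \<noteq> {}" using k(3)[of 0] by auto
  then have "D \<noteq> {}" unfolding D_def by blast
  moreover have "countable D" using k(1) by (auto simp: D_def intro: countable_finite)
  ultimately have ran: "range (from_nat_into D) = D" by (rule range_from_nat_into)
  have "K \<subseteq> closure D"
  proof
    fix x assume x: "x \<in> K"
    show "x \<in> closure D" unfolding closure_approachable
    proof (intro allI impI)
      fix e :: real assume "0 < e"
      then obtain n where n: "1 / real (Suc n) < e" using nat_approx_posE by blast
      obtain z where "z \<in> k n" "dist z x < 1 / real (Suc n)" using k(3)[of n] x by auto
      then show "\<exists>z\<in>D. dist z x < e" using n by (auto simp: D_def intro!: bexI[of _ z])
    qed
  qed
  moreover have "D \<subseteq> K" unfolding D_def using k(2) by (rule UN_least)
  ultimately show ?thesis using ran by metis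
qed

lemma convergent_subsequence_on_K:
  fixes u :: "nat \<Rightarrow> real"
  assumes u: "\<And>k. 0 < u k"
  obtains r where "strict_mono (r :: nat \<Rightarrow> nat)" "\<And>x. x \<in> K \<Longrightarrow> convergent (\<lambda>k. blinfun_apply (T (u (r k))) x)"
proof -
  obtain d :: "nat \<Rightarrow> 'a" where "range d \<subseteq> K \<and> K \<subseteq> closure (range d)"
    using K_countable_dense ..
  then have d: "range d \<subseteq> K" "K \<subseteq> closure (range d)" by (rule conjunct1, rule conjunct2)
  interpret subseqs "\<lambda>n r. convergent (\<lambda>k. blinfun_apply (T (u (r k))) (d n))"
  proof
    fix n and r :: "nat \<Rightarrow> nat"
    have "\<forall>k. blinfun_apply (T (u (r k))) (d n) \<in> K" using d(1) K_invariant u by blast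
    then obtain l r' where "strict_mono (r' :: nat \<Rightarrow> nat)" "((\<lambda>k. blinfun_apply (T (u (r k))) (d n)) \<circ> r') \<longlonglongrightarrow> l"
      using compact_image[unfolded compact_def, rule_format, of "\<lambda>k. blinfun_apply (T (u (r k))) (d n)"] by blast
    then show "\<exists>r'. strict_mono r' \<and> convergent (\<lambda>k. blinfun_apply (T (u ((r \<circ> r') k))) (d n))"
      by (auto simp: convergent_def o_def)
  qed
  \<comment> \<open>The diagonal sequence is a subsequence of the \<open>n\<close>-th selection only
    from some index on, so convergence is first obtained for a shifted sequence.\<close>
  have diag: "convergent (\<lambda>k. blinfun_apply (T (u ((diagseq \<circ> (+) (Suc n)) k))) (d n))" for n
    by (rule diagseq_holds) (auto dest: convergent_subseq_convergent simp: o_def)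
  have "convergent (\<lambda>k. blinfun_apply (T (u (diagseq (k + Suc n)))) (d n))" for n
    using diag[of n] by (simp add: add.commute)
  then have "convergent (\<lambda>k. blinfun_apply (T (u (diagseq k))) (d n))" for n
    using convergent_ignore_initial_segment[of "\<lambda>k. blinfun_apply (T (u (diagseq k))) (d n)" "Suc n"] by simp
  then have "closure (range d) \<subseteq> {x. convergent (\<lambda>k. blinfun_apply (T (u (diagseq k))) x)}"
    by (intro closure_minimal convergent_closed u) auto
  then show ?thesis using that[OF subseq_diagseq] d(2) by blast
qed

text \<open>Factor \<open>T (t k)\<close> as \<open>T (t k - s)\<close> after \<open>T s\<close>,
  which is why \<open>s < t k\<close> is required: \<open>T s\<close> moves the order interval into
  \<open>K\<close>, where a subsequence converges pointwise. Scaling and density extend this to all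
  vectors.\<close>

lemma strongly_convergent_subsequence:
  fixes t :: "nat \<Rightarrow> real"
  assumes t: "\<And>k. s < t k"
  obtains r and R :: "'a \<Rightarrow>\<^sub>L 'a" where "strict_mono (r :: nat \<Rightarrow> nat)"
    "\<And>x. (\<lambda>k. blinfun_apply (T (t (r k))) x) \<longlonglongrightarrow> blinfun_apply R x"
proof -
  have t0: "0 < t k" for k using t[of k] s by linarith
  obtain r where r: "strict_mono (r :: nat \<Rightarrow> nat)" "\<And>x. x \<in> K \<Longrightarrow> convergent (\<lambda>k. blinfun_apply (T (t (r k) - s)) x)"
    using convergent_subsequence_on_K[of "\<lambda>k. t k - s"] t by (metis diff_gt_0_iff_gt)
  have conv: "convergent (\<lambda>k. blinfun_apply (T (t (r k))) x)" if "\<bar>x\<bar> \<le> y" for x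
  proof -
    have "blinfun_apply (T s) x \<in> K" using that by (intro subsetD[OF closure_subset]) auto
    then have "convergent (\<lambda>k. blinfun_apply (T (t (r k) - s)) (blinfun_apply (T s) x))" by (rule r(2))
    then show ?thesis using t s by (simp flip: semigroup)
  qed
  have "convergent (\<lambda>k. blinfun_apply (T (t (r k))) x)" if "x \<in> principal_ideal y" for x
  proof -
    obtain c where c: "0 \<le> c" "\<bar>x\<bar> \<le> c *\<^sub>R y" using \<open>x \<in> principal_ideal y\<close> by (auto simp: principal_ideal_def)
    have c1: "0 < c + 1" using c by simp
    have "\<bar>x\<bar> \<le> (c + 1) *\<^sub>R y" using c y(1) by (simp add: scaleR_left_distrib add_increasing2)
    then have "inverse (c + 1) *\<^sub>R \<bar>x\<bar> \<le> inverse (c + 1) *\<^sub>R (c + 1) *\<^sub>R y"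
      using c1 by (intro scaleR_left_mono) auto
    then have "\<bar>inverse (c + 1) *\<^sub>R x\<bar> \<le> y" using c1 by (simp add: abs_scaleR_lattice)
    from conv[OF this] obtain l where "(\<lambda>k. inverse (c + 1) *\<^sub>R blinfun_apply (T (t (r k))) x) \<longlonglongrightarrow> l"
      by (auto simp: convergent_def blinfun.scaleR_right)
    from tendsto_scaleR[OF tendsto_const[of "c + 1"] this] show ?thesis
      using c1 by (auto simp: convergent_def)
  qed
  then have "closure (principal_ideal y) \<subseteq> {x. convergent (\<lambda>k. blinfun_apply (T (t (r k))) x)}"
    by (intro closure_minimal convergent_closed t0) auto
  then have conv: "convergent (\<lambda>k. blinfun_apply (T (t (r k))) x)" for x using y(2) by blast
  define R where "R x = lim (\<lambda>k. blinfun_apply (T (t (r k))) x)" for x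
  have R: "(\<lambda>k. blinfun_apply (T (t (r k))) x) \<longlonglongrightarrow> R x" for x
    using conv by (simp add: R_def convergent_LIMSEQ_iff)
  have "bounded_linear R"
  proof (rule bounded_linear_intro)
    show "R (a + b) = R a + R b" for a b
      using LIMSEQ_unique[OF R[of "a + b"]] tendsto_add[OF R[of a] R[of b]] by (simp add: blinfun.add_right)
    show "R (c *\<^sub>R a) = c *\<^sub>R R a" for c a
      using LIMSEQ_unique[OF R[of "c *\<^sub>R a"]] tendsto_scaleR[OF tendsto_const[of c] R[of a]] by (simp add: blinfun.scaleR_right)
    show "norm (R a) \<le> norm a * M" for a
      using norm_T[OF t0] by (intro LIMSEQ_le_const2[OF tendsto_norm[OF R]]) (auto simp: mult.commute)
  qed
  then show ?thesis using that[of r "Blinfun R"] r(1) R by (simp add: bounded_linear_Blinfun_apply)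
qed

end

section \<open>An idempotent strong limit point at infinity\<close>

context compact_semigroup
begin

lemma limit_commutes:
  assumes u: "\<And>k. 0 < u k" and R: "\<And>x. (\<lambda>k. blinfun_apply (T (u k)) x) \<longlonglongrightarrow> blinfun_apply R x"
    and S: "\<And>k x. blinfun_apply (T (u k)) (blinfun_apply S x) = blinfun_apply S (blinfun_apply (T (u k)) x)"
  shows "blinfun_apply R (blinfun_apply S x) = blinfun_apply S (blinfun_apply R x)"
proof (rule LIMSEQ_unique)
  show "(\<lambda>k. blinfun_apply (T (u k)) (blinfun_apply S x)) \<longlonglongrightarrow> blinfun_apply R (blinfun_apply S x)"
    by (rule R)
  show "(\<lambda>k. blinfun_apply (T (u k)) (blinfun_apply S x)) \<longlonglongrightarrow> blinfun_apply S (blinfun_apply R x)"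
    unfolding S by (intro bounded_linear.tendsto[OF blinfun.bounded_linear_right] R)
qed

lemma limit_commutes_T:
  assumes u: "\<And>k. 0 < u k" and R: "\<And>x. (\<lambda>k. blinfun_apply (T (u k)) x) \<longlonglongrightarrow> blinfun_apply R x"
    and t: "0 < t"
  shows "blinfun_apply R (blinfun_apply (T t) x) = blinfun_apply (T t) (blinfun_apply R x)"
  by (rule limit_commutes[OF u R commute[OF u t]])

text \<open>If \<open>T (t k)\<close> tends to \<open>R\<close>, a limit point \<open>P\<close> of operators \<open>T (t j - t k)\<close> satisfies
  \<open>P R = R\<close>, and a limit point \<open>R'\<close> of operators \<open>T (t j - 2 t k)\<close> satisfies \<open>R' R = P\<close>; hence
  \<open>P P = R' P R = R' R = P\<close>.\<close>

lemma limit_projection_exists: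
  "\<exists>(P :: 'a \<Rightarrow>\<^sub>L 'a) m. (\<forall>k. s < m k) \<and> filterlim m at_top sequentially \<and>
    (\<forall>x. (\<lambda>k. blinfun_apply (T (m k)) x) \<longlonglongrightarrow> blinfun_apply P x) \<and>
    (\<forall>x. blinfun_apply P (blinfun_apply P x) = blinfun_apply P x)"
proof -
  obtain r and R :: "'a \<Rightarrow>\<^sub>L 'a" where r: "strict_mono r"
    "\<And>x. (\<lambda>k. blinfun_apply (T (s + 1 + real (r k))) x) \<longlonglongrightarrow> blinfun_apply R x"
    using strongly_convergent_subsequence[of "\<lambda>k. s + 1 + real k"] by auto
  define a where "a k = s + 1 + real (r k)" for k
  have a0: "0 < a k" for k using s by (simp add: a_def add_pos_nonneg)
  have a_ge: "real k \<le> a k" for k using seq_suble[OF r(1), of k] s by (simp add: a_def)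
  have R: "(\<lambda>k. blinfun_apply (T (a k)) x) \<longlonglongrightarrow> blinfun_apply R x" for x using r(2) by (simp add: a_def)
  \<comment> \<open>The gap is wide enough for both \<open>a n - a k\<close> and
    \<open>a n - 2 * a k\<close> to exceed \<open>s\<close>, so that limit points exist for both
    families, and for the first to tend to infinity.\<close>
  have "\<exists>n\<ge>k. 2 * a k + s + 1 + real k \<le> a n" for k
  proof -
    obtain n where "2 * a k + s + 1 + real k \<le> real n" using real_arch_simple by blast
    then show ?thesis using a_ge[of "max n k"] by (intro exI[of _ "max n k"]) auto
  qed
  then obtain n where n: "\<And>k. k \<le> n k" "\<And>k. 2 * a k + s + 1 + real k \<le> a (n k)" by metis
  define b where "b k = a (n k) - a k" for k
  have b_s: "s < b k" "0 < b k" for k using n(2)[of k] a0[of k] s by (auto simp: b_def)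
  have b_T: "blinfun_apply (T (b k)) (blinfun_apply (T (a k)) x) = blinfun_apply (T (a (n k))) x" for k x
    using semigroup[OF b_s(2) a0, of k k x] by (simp add: b_def)
  obtain r1 and P :: "'a \<Rightarrow>\<^sub>L 'a" where r1: "strict_mono r1"
    and P: "\<And>x. (\<lambda>k. blinfun_apply (T (b (r1 k))) x) \<longlonglongrightarrow> blinfun_apply P x"
    using strongly_convergent_subsequence[of b, OF b_s(1)] by blast
  define c where "c k = b (r1 k) - a (r1 k)" for k
  have c_s: "s < c k" "0 < c k" for k using n(2)[of "r1 k"] s by (auto simp: c_def b_def)
  have c_T: "blinfun_apply (T (c k)) (blinfun_apply (T (a (r1 k))) x) = blinfun_apply (T (b (r1 k))) x" for k x
    using semigroup[OF c_s(2) a0, of k "r1 k" x] by (simp add: c_def)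
  obtain r2 and R' :: "'a \<Rightarrow>\<^sub>L 'a" where r2: "strict_mono r2"
    and R': "\<And>x. (\<lambda>k. blinfun_apply (T (c (r2 k))) x) \<longlonglongrightarrow> blinfun_apply R' x"
    using strongly_convergent_subsequence[of c, OF c_s(1)] by blast
  have PR: "blinfun_apply P (blinfun_apply R x) = blinfun_apply R x" for x
  proof (rule LIMSEQ_unique)
    have "(\<lambda>k. blinfun_apply (T (a (r1 k))) x) \<longlonglongrightarrow> blinfun_apply R x"
      using LIMSEQ_subseq_LIMSEQ[OF R r1] by (simp add: o_def)
    from T_tendsto[OF b_s(2) P this]
    show "(\<lambda>k. blinfun_apply (T (a (n (r1 k)))) x) \<longlonglongrightarrow> blinfun_apply P (blinfun_apply R x)"
      by (simp add: b_T)
    have "filterlim (\<lambda>k. n (r1 k)) at_top sequentially"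
    proof (rule filterlim_at_top_mono[OF filterlim_ident])
      show "\<forall>\<^sub>F k in sequentially. k \<le> n (r1 k)"
        using n(1) seq_suble[OF r1] by (auto intro!: always_eventually intro: order.trans)
    qed
    from filterlim_compose[OF R this]
    show "(\<lambda>k. blinfun_apply (T (a (n (r1 k)))) x) \<longlonglongrightarrow> blinfun_apply R x" .
  qed
  have R'R: "blinfun_apply R' (blinfun_apply R x) = blinfun_apply P x" for x
  proof (rule LIMSEQ_unique)
    have "(\<lambda>k. blinfun_apply (T (a (r1 (r2 k)))) x) \<longlonglongrightarrow> blinfun_apply R x"
      using LIMSEQ_subseq_LIMSEQ[OF LIMSEQ_subseq_LIMSEQ[OF R r1] r2] by (simp add: o_def)
    from T_tendsto[OF c_s(2) R' this]
    show "(\<lambda>k. blinfun_apply (T (b (r1 (r2 k)))) x) \<longlonglongrightarrow> blinfun_apply R' (blinfun_apply R x)"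
      by (simp add: c_T)
    show "(\<lambda>k. blinfun_apply (T (b (r1 (r2 k)))) x) \<longlonglongrightarrow> blinfun_apply P x"
      using LIMSEQ_subseq_LIMSEQ[OF P r2] by (simp add: o_def)
  qed
  have PR': "blinfun_apply R' (blinfun_apply P x) = blinfun_apply P (blinfun_apply R' x)" for x
    by (rule limit_commutes[of "\<lambda>k. c (r2 k)", OF c_s(2) R'])
      (rule limit_commutes_T[of "\<lambda>k. b (r1 k)", OF b_s(2) P c_s(2), symmetric])
  have "blinfun_apply P (blinfun_apply P x) = blinfun_apply P x" for x
    by (metis PR PR' R'R)
  moreover have "filterlim (\<lambda>k. b (r1 k)) at_top sequentially"
  proof (rule filterlim_at_top_mono[OF filterlim_real_sequentially])
    have "real k \<le> b (r1 k)" for k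
      using n(2)[of "r1 k"] a0[of "r1 k"] s seq_suble[OF r1, of k] by (simp add: b_def)
    then show "\<forall>\<^sub>F k in sequentially. real k \<le> b (r1 k)" by simp
  qed
  ultimately show ?thesis using P b_s(1) by (intro exI[of _ P] exI[of _ "\<lambda>k. b (r1 k)"]) blast
qed

end

section \<open>The semigroup acts on the range of the projection by order automorphisms\<close>

locale semigroup_limit_projection = compact_semigroup T M s y
  for T :: "real \<Rightarrow> 'a::banach_lattice \<Rightarrow>\<^sub>L 'a" and M s y +
  fixes P :: "'a \<Rightarrow>\<^sub>L 'a" and m :: "nat \<Rightarrow> real"
  assumes m: "s < m k" "filterlim m at_top sequentially"
    and P: "(\<lambda>k. blinfun_apply (T (m k)) x) \<longlonglongrightarrow> blinfun_apply P x"
    and idem: "blinfun_apply P (blinfun_apply P x) = blinfun_apply P x"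
begin

lemma m_pos: "0 < m k"
  using m(1)[of k] s by linarith

lemma P_pos: "positive_op P"
  unfolding positive_op_def
proof (intro allI impI)
  fix x :: 'a assume "0 \<le> x"
  then show "0 \<le> blinfun_apply P x"
    using pos[OF m_pos] by (intro tendsto_le_lattice[OF _ tendsto_const P]) (auto simp: positive_op_def)
qed

lemmas P_mono = positive_op_mono[OF P_pos]

lemma P_nonneg: "0 \<le> x \<Longrightarrow> 0 \<le> blinfun_apply P x"
  using P_pos by (simp add: positive_op_def)

lemma P_y: "blinfun_apply P y = y"
  using LIMSEQ_unique[OF P[of y]] by (simp add: fix_y m_pos)

lemma norm_P: "norm (blinfun_apply P x) \<le> M * norm x"
  using norm_T[OF m_pos] by (intro LIMSEQ_le_const2[OF tendsto_norm[OF P]]) auto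

lemma P_T: "0 < t \<Longrightarrow> blinfun_apply P (blinfun_apply (T t) x) = blinfun_apply (T t) (blinfun_apply P x)"
  by (rule limit_commutes_T[OF m_pos P])

abbreviation "X \<equiv> {x. blinfun_apply P x = x}"

lemma X_tendsto: "x \<in> X \<Longrightarrow> (\<lambda>k. blinfun_apply (T (m k)) x) \<longlonglongrightarrow> x"
  using P[of x] by simp

lemma eventually_m: "0 < t \<Longrightarrow> \<forall>\<^sub>F k in sequentially. s + t < m k"
  using m(2) by (simp add: filterlim_at_top_dense)

text \<open>Recurrence: on \<open>X\<close> the vectors \<open>T (m k) x\<close> return to
  \<open>x\<close>, and they factor through \<open>T t x\<close> as soon as \<open>m k > t\<close>.
  So \<open>T t x\<close> determines \<open>x\<close>, with norm control here and with order control
  in \<open>X_T_nonneg\<close>.\<close>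

lemma X_norm_T:
  assumes "x \<in> X" "0 < t" shows "norm x \<le> M * norm (blinfun_apply (T t) x)"
proof (rule tendsto_upperbound[OF tendsto_norm[OF X_tendsto[OF assms(1)]]])
  show "\<forall>\<^sub>F k in sequentially. norm (blinfun_apply (T (m k)) x) \<le> M * norm (blinfun_apply (T t) x)"
    using eventually_m[OF assms(2)]
  proof eventually_elim
    case (elim k)
    then have "blinfun_apply (T (m k)) x = blinfun_apply (T (m k - t)) (blinfun_apply (T t) x)"
      using semigroup[of "m k - t" t x] assms(2) s by simp
    then show ?case using norm_T[of "m k - t"] elim s by simp
  qed
qed simp

lemma X_T_inj: "x \<in> X \<Longrightarrow> 0 < t \<Longrightarrow> blinfun_apply (T t) x = 0 \<Longrightarrow> x = 0"
  using X_norm_T[of x t] by simp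

lemma X_T_nonneg:
  assumes "x \<in> X" "0 < t" "0 \<le> blinfun_apply (T t) x" shows "0 \<le> x"
proof (rule tendsto_le_lattice[OF _ tendsto_const X_tendsto[OF assms(1)]])
  show "\<forall>\<^sub>F k in sequentially. 0 \<le> blinfun_apply (T (m k)) x"
    using eventually_m[OF assms(2)]
  proof eventually_elim
    case (elim k)
    then have "blinfun_apply (T (m k)) x = blinfun_apply (T (m k - t)) (blinfun_apply (T t) x)"
      using semigroup[of "m k - t" t x] assms(2) s by simp
    then show ?case using pos[of "m k - t"] assms(3) elim s by (simp add: positive_op_def)
  qed
qed simp

lemma X_T: "x \<in> X \<Longrightarrow> 0 < t \<Longrightarrow> blinfun_apply (T t) x \<in> X"
  by (simp add: P_T)

lemma X_diff: "x \<in> X \<Longrightarrow> z \<in> X \<Longrightarrow> x - z \<in> X"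
  by (simp add: blinfun.diff_right)

lemma X_scale: "x \<in> X \<Longrightarrow> c *\<^sub>R x \<in> X"
  by (simp add: blinfun.scaleR_right)

lemma X_T_le:
  assumes "x \<in> X" "z \<in> X" "0 < t" "blinfun_apply (T t) x \<le> blinfun_apply (T t) z" shows "x \<le> z"
  using X_T_nonneg[OF X_diff[OF assms(2,1)] assms(3)] assms(4) by (simp add: blinfun.diff_right)

text \<open>The inverse of \<open>T t\<close> on \<open>X\<close> is a strong limit point of the
  operators \<open>T (m k - t)\<close>; dropping the first \<open>k0\<close> indices keeps all
  parameters above \<open>s\<close>.\<close>

lemma X_T_surj:
  assumes w: "w \<in> X" and t: "0 < t"
  shows "\<exists>z\<in>X. blinfun_apply (T t) z = w"
proof -
  obtain k0 where k0: "\<And>k. k \<ge> k0 \<Longrightarrow> s + t < m k"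
    using eventually_m[OF t] by (auto simp: eventually_sequentially)
  define u where "u k = m (k + k0) - t" for k
  have u: "s < u k" "0 < u k" for k using k0[of "k + k0"] s by (auto simp: u_def)
  obtain r and Q :: "'a \<Rightarrow>\<^sub>L 'a" where r: "strict_mono r"
    and Q: "\<And>x. (\<lambda>k. blinfun_apply (T (u (r k))) x) \<longlonglongrightarrow> blinfun_apply Q x"
    using strongly_convergent_subsequence[of u, OF u(1)] by blast
  have "blinfun_apply (T t) (blinfun_apply Q w) = w"
  proof (rule LIMSEQ_unique)
    show "(\<lambda>k. blinfun_apply (T t) (blinfun_apply (T (u (r k))) w)) \<longlonglongrightarrow> blinfun_apply (T t) (blinfun_apply Q w)"
      by (intro bounded_linear.tendsto[OF blinfun.bounded_linear_right] Q)
    have "blinfun_apply (T t) (blinfun_apply (T (u (r k))) w) = blinfun_apply (T (m (r k + k0))) w" for k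
      using semigroup[OF t u(2), of "r k" w] by (simp add: u_def)
    moreover have "(\<lambda>k. blinfun_apply (T (m (r k + k0))) w) \<longlonglongrightarrow> w"
      using LIMSEQ_subseq_LIMSEQ[OF LIMSEQ_ignore_initial_segment[OF X_tendsto[OF w], of k0] r] by (simp add: o_def)
    ultimately show "(\<lambda>k. blinfun_apply (T t) (blinfun_apply (T (u (r k))) w)) \<longlonglongrightarrow> w" by simp
  qed
  moreover have "blinfun_apply Q w \<in> X"
    using limit_commutes[of "\<lambda>k. u (r k)", OF u(2) Q P_T[OF u(2), symmetric], of w] w by simp
  ultimately show ?thesis by blast
qed

lemma X_closed: "closed X"
  by (intro closed_Collect_eq linear_continuous_on blinfun.bounded_linear_right continuous_on_id)

definition I :: "'a \<Rightarrow> 'a set" where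
  "I v = {x. blinfun_apply P x = x \<and> 0 \<le> x \<and> x \<le> v}"

text \<open>A fixed vector of \<open>P\<close> in the order interval is a limit of vectors
  \<open>T (m k) x = T s (T (m k - s) x)\<close>, all of which lie in the compact set
  \<open>K\<close>.\<close>

lemma I_compact: "v \<le> y \<Longrightarrow> compact (I v)"
proof -
  assume v: "v \<le> y"
  have "I v = K \<inter> (X \<inter> {x. 0 \<le> x} \<inter> {x. x \<le> v})"
  proof -
    have "x \<in> K" if x: "x \<in> I v" for x
    proof -
      have "x \<in> X" "\<bar>x\<bar> \<le> y" using x v by (auto simp: I_def)
      moreover have "blinfun_apply (T (m k)) x \<in> K" for k
      proof -
        have "blinfun_apply (T (m k)) x = blinfun_apply (T s) (blinfun_apply (T (m k - s)) x)"
          using semigroup[of s "m k - s" x] s m(1)[of k] by simp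
        moreover have "\<bar>blinfun_apply (T (m k - s)) x\<bar> \<le> y"
          using interval_invariant[of "m k - s" x] m(1)[of k] \<open>\<bar>x\<bar> \<le> y\<close> by simp
        ultimately show ?thesis by (intro subsetD[OF closure_subset]) auto
      qed
      ultimately show ?thesis using closed_sequentially[OF closed_closure _ X_tendsto] by blast
    qed
    then show ?thesis by (auto simp: I_def)
  qed
  moreover have "closed (X \<inter> {x. 0 \<le> x} \<inter> {x. x \<le> v})"
    by (intro closed_Int X_closed closed_le_lattice closed_ge_lattice)
  ultimately show "compact (I v)" using compact_Int_closed[OF compact_image] by simp
qed

lemma I_trans: "x \<in> I v \<Longrightarrow> v \<in> I w \<Longrightarrow> x \<in> I w"
  by (auto simp: I_def)

lemma I_diff: "x \<in> I v \<Longrightarrow> blinfun_apply P v = v \<Longrightarrow> v - x \<in> I v"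
  by (auto simp: I_def blinfun.diff_right)

lemma P_inf_I: "a \<in> I v \<Longrightarrow> 0 \<le> b \<Longrightarrow> blinfun_apply P (inf a b) \<in> I a"
  using P_mono[of "inf a b" a] by (auto simp: I_def idem P_nonneg)

lemma P_inf_commute_I: "b \<in> I v \<Longrightarrow> 0 \<le> a \<Longrightarrow> blinfun_apply P (inf a b) \<in> I b"
  using P_inf_I[of b v a] by (simp add: inf_commute)

end

section \<open>Atoms in the range of the projection\<close>

text \<open>The range \<open>X\<close> of \<open>P\<close> need not be a sublattice, but it is a lattice in its own order, with
  infimum \<open>P (inf a b)\<close>; \<open>dj\<close> is disjointness in this lattice.\<close>

context semigroup_limit_projection
begin

definition dj :: "'a \<Rightarrow> 'a \<Rightarrow> bool" where
  "dj a b \<longleftrightarrow> blinfun_apply P (inf a b) = 0"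

lemma dj_commute: "dj a b \<longleftrightarrow> dj b a"
  by (simp add: dj_def inf_commute)

lemma dj_zero: "0 \<le> a \<Longrightarrow> dj 0 a"
  by (simp add: dj_def inf_absorb1 blinfun.zero_right)

lemma djI: "0 \<le> a \<Longrightarrow> 0 \<le> b \<Longrightarrow> blinfun_apply P (inf a b) \<le> 0 \<Longrightarrow> dj a b"
  using P_nonneg[of "inf a b"] by (simp add: dj_def)

lemma dj_mono: "dj a b \<Longrightarrow> 0 \<le> a' \<Longrightarrow> a' \<le> a \<Longrightarrow> 0 \<le> b' \<Longrightarrow> b' \<le> b \<Longrightarrow> dj a' b'"
  using P_mono[OF inf_mono[of a' a b' b]] by (intro djI) (auto simp: dj_def)

lemma dj_add:
  assumes "dj a c" "dj b c" "0 \<le> a" "0 \<le> b" "0 \<le> c" shows "dj (a + b) c"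
  using P_mono[OF inf_add_le[of c a b]] assms
  by (intro djI) (auto simp: dj_def blinfun.add_right inf_commute)

lemma dj_scale:
  assumes "dj a b" "0 \<le> a" "0 \<le> b" "0 \<le> c" shows "dj (c *\<^sub>R a) b"
proof -
  have "c *\<^sub>R a \<le> max 1 c *\<^sub>R a" "1 *\<^sub>R b \<le> max 1 c *\<^sub>R b"
    using assms by (intro scaleR_right_mono; simp)+
  then have "inf (c *\<^sub>R a) b \<le> max 1 c *\<^sub>R inf a b"
    by (simp add: scaleR_inf le_infI1 le_infI2)
  from P_mono[OF this] show ?thesis
    using assms by (intro djI) (auto simp: dj_def blinfun.scaleR_right scaleR_nonneg_nonneg)
qed

text \<open>Riesz subadditivity splits the common part of \<open>g\<close> and \<open>p + q\<close>,
  and disjointness kills the share of \<open>q\<close>.\<close>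

lemma dj_le_add:
  assumes "dj g q" "g \<le> p + q" "g \<in> X" "p \<in> X" "0 \<le> g" "0 \<le> p" "0 \<le> q" shows "g \<le> p"
proof -
  have "g = blinfun_apply P (inf g (p + q))" using assms(2,3) by (simp add: inf_absorb1)
  also have "\<dots> \<le> blinfun_apply P (inf g p + inf g q)" using assms by (intro P_mono inf_add_le)
  also have "\<dots> = blinfun_apply P (inf g p)" using assms(1) by (simp add: dj_def blinfun.add_right)
  also have "\<dots> \<le> p" using P_mono[of "inf g p" p] assms(4) by simp
  finally show ?thesis .
qed

text \<open>The two elements are the positive and negative parts of \<open>x\<close> in the lattice
  \<open>X\<close>. If they had a common part \<open>g\<close>, then \<open>P (pprt x) - g\<close>
  would still dominate \<open>pprt x\<close>; applying \<open>P\<close> gives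
  \<open>g \<le> 0\<close>.\<close>

lemma dj_parts:
  assumes x: "x \<in> X"
  shows "dj (blinfun_apply P (pprt x)) (blinfun_apply P (pprt (- x)))"
proof -
  let ?p = "blinfun_apply P (pprt x)" and ?n = "blinfun_apply P (pprt (- x))"
  define g where "g = blinfun_apply P (inf ?p ?n)"
  have nn: "0 \<le> ?p" "0 \<le> ?n" by (simp_all add: P_nonneg)
  have Pg: "blinfun_apply P g = g" by (simp add: g_def idem)
  have gp: "g \<le> ?p" using P_mono[of "inf ?p ?n" ?p] by (simp add: g_def idem)
  have gn: "g \<le> ?n" using P_mono[of "inf ?p ?n" ?n] by (simp add: g_def idem)
  have x_eq: "?p - ?n = x" using arg_cong[OF pprt_diff[of x], of "blinfun_apply P"] x by (simp add: blinfun.diff_right)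
  have "x \<le> ?p - g" using diff_left_mono[OF gn, of ?p] x_eq by simp
  then have "pprt x \<le> ?p - g" using gp by (simp add: pprt_def)
  from P_mono[OF this] have "g \<le> 0" by (simp add: blinfun.diff_right Pg idem)
  then show ?thesis using nn by (intro djI) (simp_all add: g_def)
qed

lemma dj_sum_le:
  assumes "a \<in> I v" "b \<in> I v" "dj a b" "blinfun_apply P v = v" shows "a + b \<le> v"
proof -
  have "a + b = blinfun_apply P (sup a b + inf a b)"
    using assms(1,2) by (simp add: add_eq_inf_sup[symmetric] I_def blinfun.add_right)
  also have "\<dots> = blinfun_apply P (sup a b)" using assms(3) by (simp add: dj_def blinfun.add_right)
  also have "\<dots> \<le> v" using P_mono[of "sup a b" v] assms by (simp add: I_def)
  finally show ?thesis .
qed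

lemma P_abs_diff_dj:
  assumes "dj a b" "a \<in> X" "b \<in> X" shows "blinfun_apply P \<bar>a - b\<bar> = a + b"
  using assms by (simp add: abs_diff_inf blinfun.diff_right blinfun.add_right blinfun.scaleR_right dj_def)

text \<open>One direction is subadditivity of \<open>inf\<close>. In the other the sum exceeds
  \<open>inf d (a + b)\<close> by at most \<open>inf a b\<close>, which \<open>P\<close>
  annihilates.\<close>

lemma P_inf_add_dj:
  assumes "dj a b" "0 \<le> a" "0 \<le> b" "0 \<le> d"
  shows "blinfun_apply P (inf d (a + b)) = blinfun_apply P (inf d a) + blinfun_apply P (inf d b)"
proof (rule order.antisym)
  show "blinfun_apply P (inf d (a + b)) \<le> blinfun_apply P (inf d a) + blinfun_apply P (inf d b)"
    using P_mono[OF inf_add_le[of d a b]] assms by (simp add: blinfun.add_right)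
  have "inf d a + inf d b = sup (inf d a) (inf d b) + inf (inf d a) (inf d b)" by (rule add_eq_inf_sup)
  also have "\<dots> \<le> inf d (a + b) + inf a b"
    using assms by (intro add_mono le_supI le_infI)
      (auto intro: le_infI1 le_infI2 add_increasing add_increasing2)
  finally show "blinfun_apply P (inf d a) + blinfun_apply P (inf d b) \<le> blinfun_apply P (inf d (a + b))"
    using P_mono[of "inf d a + inf d b"] assms(1) by (fastforce simp: blinfun.add_right dj_def)
qed

lemma continuous_P [continuous_intros]: "continuous_on S f \<Longrightarrow> continuous_on S (\<lambda>x. blinfun_apply P (f x))"
  by (rule bounded_linear.continuous_on[OF blinfun.bounded_linear_right])

text \<open>Phrased by disjoint pairs, so that a nonzero positive element of \<open>X\<close> which
  is no atom can be split at once; that everything in \<open>I v\<close> is a multiple of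
  \<open>v\<close> is derived in \<open>below_atom\<close>.\<close>

definition atom :: "'a \<Rightarrow> bool" where
  "atom v \<longleftrightarrow> blinfun_apply P v = v \<and> 0 \<le> v \<and> v \<noteq> 0 \<and> (\<forall>a\<in>I v. \<forall>b\<in>I v. dj a b \<longrightarrow> a = 0 \<or> b = 0)"

text \<open>Let \<open>c\<close> be the largest scalar with \<open>c *\<^sub>R v \<le> b\<close>.
  For \<open>l > c\<close> the parts of \<open>b - l *\<^sub>R v\<close> are disjoint and, after
  rescaling, below \<open>v\<close>, so one of them vanishes. It is not the negative part, by the
  choice of \<open>c\<close>, so \<open>b \<le> l *\<^sub>R v\<close>; let \<open>l\<close> tend to
  \<open>c\<close>.\<close>

lemma below_atom:
  assumes v: "atom v" and b: "b \<in> I v"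
  obtains c where "0 \<le> c" "b = c *\<^sub>R v"
proof -
  have v0: "blinfun_apply P v = v" "0 \<le> v" "v \<noteq> 0"
    and v_dj: "\<And>a b. a \<in> I v \<Longrightarrow> b \<in> I v \<Longrightarrow> dj a b \<Longrightarrow> a = 0 \<or> b = 0"
    using v by (auto simp: atom_def)
  have b0: "blinfun_apply P b = b" "0 \<le> b" "b \<le> v" using b by (auto simp: I_def)
  define L where "L = {l. 0 \<le> l \<and> l *\<^sub>R v \<le> b}"
  have L0: "0 \<in> L" using b0 by (simp add: L_def)
  have L1: "l \<le> 1" if "l \<in> L" for l
  proof (rule ccontr)
    assume "\<not> l \<le> 1"
    have "l *\<^sub>R v \<le> v" using that b0 by (auto simp: L_def intro: order.trans)
    then have "(l - 1) *\<^sub>R v \<le> 0" by (simp add: scaleR_left_diff_distrib)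
    then have "inverse (l - 1) *\<^sub>R (l - 1) *\<^sub>R v \<le> inverse (l - 1) *\<^sub>R 0"
      using \<open>\<not> l \<le> 1\<close> by (intro scaleR_left_mono) auto
    then show False using \<open>\<not> l \<le> 1\<close> v0 by simp
  qed
  define c where "c = Sup L"
  have bdd: "bdd_above L" using L1 by (auto simp: bdd_above_def)
  have "closed ((\<lambda>l. l *\<^sub>R v) -` {x. x \<le> b})"
    by (intro closed_vimage closed_ge_lattice continuous_intros)
  then have "closed L" using closed_Int[of "{0..}" "(\<lambda>l. l *\<^sub>R v) -` {x. x \<le> b}"]
    by (simp add: L_def Int_def vimage_def)
  then have cL: "c \<in> L" using closed_contains_Sup[of L] L0 bdd by (auto simp: c_def)
  have above: "b \<le> l *\<^sub>R v" if l: "c < l" for l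
  proof -
    have l0: "0 < l" using l cL by (auto simp: L_def)
    let ?x = "b - l *\<^sub>R v"
    have x: "?x \<in> X" using b0 v0 by (simp add: blinfun.diff_right blinfun.scaleR_right)
    let ?p = "blinfun_apply P (pprt ?x)" and ?n = "blinfun_apply P (pprt (- ?x))"
    have "pprt ?x \<le> b" using b0 v0 l0 by (simp add: pprt_def diff_le_eq add_increasing2 scaleR_nonneg_nonneg)
    from P_mono[OF this] have p: "?p \<in> I v" using b0 by (auto simp: I_def idem P_nonneg)
    have "pprt (- ?x) \<le> l *\<^sub>R v" using b0 v0 l0 by (simp add: pprt_def scaleR_nonneg_nonneg)
    from P_mono[OF this] have "?n \<le> l *\<^sub>R v" by (simp add: blinfun.scaleR_right v0)
    then have "inverse l *\<^sub>R ?n \<le> inverse l *\<^sub>R l *\<^sub>R v" using l0 by (intro scaleR_left_mono) auto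
    then have n: "inverse l *\<^sub>R ?n \<in> I v"
      using l0 by (simp add: I_def idem P_nonneg blinfun.scaleR_right scaleR_nonneg_nonneg)
    have x_eq: "?x = ?p - ?n"
      using arg_cong[OF pprt_diff[of ?x], of "blinfun_apply P"] x by (simp add: blinfun.diff_right)
    have "dj (inverse l *\<^sub>R ?n) ?p"
      using dj_parts[OF x] l0 by (intro dj_scale) (auto simp: dj_commute P_nonneg)
    then consider "?n = 0" | "?p = 0" using v_dj[OF n p] l0 by auto
    then show ?thesis
    proof cases
      case 1
      have "0 \<le> ?p" by (simp add: P_nonneg)
      then have "0 \<le> ?x" using x_eq 1 by (metis diff_zero)
      then have "l \<in> L" using l0 by (simp add: L_def)
      then show ?thesis using l cSup_upper[OF _ bdd, of l] by (simp add: c_def)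
    next
      case 2
      have "- ?n \<le> 0" by (simp add: P_nonneg)
      then have "?x \<le> 0" using x_eq 2 by (metis diff_0)
      then show ?thesis by simp
    qed
  qed
  have "b \<le> c *\<^sub>R v"
  proof (rule tendsto_le_lattice[OF _ tendsto_const])
    show "(\<lambda>n. (c + 1 / real (Suc n)) *\<^sub>R v) \<longlonglongrightarrow> c *\<^sub>R v"
      using LIMSEQ_Suc[OF lim_1_over_n] by (intro tendsto_scaleR tendsto_const tendsto_add[of _ c _ _ 0, simplified])
    show "\<forall>\<^sub>F n in sequentially. b \<le> (c + 1 / real (Suc n)) *\<^sub>R v"
      by (intro always_eventually allI above) simp
  qed simp
  then have "b = c *\<^sub>R v" using cL by (intro order.antisym) (auto simp: L_def)
  then show ?thesis using that cL by (auto simp: L_def)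
qed

text \<open>On \<open>X\<close> the operator \<open>T t\<close> is bijective and reflects the order,
  so a disjoint pair below \<open>T t v\<close> comes from a disjoint pair below
  \<open>v\<close>.\<close>

lemma atom_T:
  assumes v: "atom v" and t: "0 < t" shows "atom (blinfun_apply (T t) v)"
proof -
  have v0: "blinfun_apply P v = v" "0 \<le> v" "v \<noteq> 0"
    and v_dj: "\<And>a b. a \<in> I v \<Longrightarrow> b \<in> I v \<Longrightarrow> dj a b \<Longrightarrow> a = 0 \<or> b = 0"
    using v by (auto simp: atom_def)
  have preimage: "\<exists>a'\<in>I v. blinfun_apply (T t) a' = a" if a: "a \<in> I (blinfun_apply (T t) v)" for a
  proof -
    obtain a' where a': "a' \<in> X" "blinfun_apply (T t) a' = a" using X_T_surj[of a t] a t by (auto simp: I_def)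
    moreover have "0 \<le> a'" using X_T_nonneg[OF a'(1) t] a a'(2) by (simp add: I_def)
    moreover have "a' \<le> v" using X_T_le[OF a'(1) _ t, of v] v0 a a'(2) by (simp add: I_def)
    ultimately show ?thesis by (auto simp: I_def)
  qed
  have "a = 0 \<or> b = 0"
    if ab: "a \<in> I (blinfun_apply (T t) v)" "b \<in> I (blinfun_apply (T t) v)" "dj a b" for a b
  proof -
    obtain a' b' where a': "a' \<in> I v" "blinfun_apply (T t) a' = a" and b': "b' \<in> I v" "blinfun_apply (T t) b' = b"
      using preimage ab by meson
    let ?g = "blinfun_apply P (inf a' b')"
    have nn: "0 \<le> a'" "0 \<le> b'" "blinfun_apply P a' = a'" "blinfun_apply P b' = b'" using a' b' by (auto simp: I_def)
    have g: "0 \<le> ?g" "?g \<le> a'" "?g \<le> b'"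
      using P_mono[of "inf a' b'" a'] P_mono[of "inf a' b'" b'] nn by (auto simp: P_nonneg)
    have "blinfun_apply (T t) ?g \<le> inf a b"
      using positive_op_mono[OF pos[OF t] g(2)] positive_op_mono[OF pos[OF t] g(3)] a' b' by simp
    from P_mono[OF this] have "blinfun_apply (T t) ?g \<le> 0"
      using ab(3) t by (simp add: P_T idem dj_def)
    moreover have "0 \<le> blinfun_apply (T t) ?g" using pos[OF t] g(1) by (simp add: positive_op_def)
    ultimately have "?g = 0" using X_T_inj[of ?g t] t by (simp add: idem)
    then have "a' = 0 \<or> b' = 0" using v_dj[OF a'(1) b'(1)] by (simp add: dj_def)
    then show ?thesis using a' b' by (auto simp: blinfun.zero_right)
  qed
  moreover have "0 \<le> blinfun_apply (T t) v" using pos[OF t] v0 by (simp add: positive_op_def)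
  moreover have "blinfun_apply (T t) v \<noteq> 0" using X_T_inj[of v t] v0 t by auto
  ultimately show ?thesis using v0 t by (auto simp: atom_def P_T)
qed

text \<open>The common part in \<open>X\<close> is nonzero and is a multiple of both atoms.\<close>

lemma atoms_proportional:
  assumes v: "atom v" and w: "atom w" and ndj: "\<not> dj v w"
  obtains c where "0 < c" "w = c *\<^sub>R v"
proof -
  let ?g = "blinfun_apply P (inf v w)"
  have v0: "blinfun_apply P v = v" "0 \<le> v" and w0: "blinfun_apply P w = w" "0 \<le> w" using v w by (auto simp: atom_def)
  have "?g \<in> I v" "?g \<in> I w"
    using P_mono[of "inf v w" v] P_mono[of "inf v w" w] v0 w0 by (auto simp: I_def idem P_nonneg)
  then obtain a b where ab: "0 \<le> a" "?g = a *\<^sub>R v" "0 \<le> b" "?g = b *\<^sub>R w"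
    using below_atom[OF v] below_atom[OF w] by metis
  have "?g \<noteq> 0" using ndj by (simp add: dj_def)
  then have "a \<noteq> 0" "b \<noteq> 0" using ab by auto
  then have pos: "0 < a" "0 < b" using ab by auto
  have "b *\<^sub>R w = a *\<^sub>R v" using ab by simp
  then have "inverse b *\<^sub>R b *\<^sub>R w = inverse b *\<^sub>R a *\<^sub>R v" by simp
  then have "w = (a / b) *\<^sub>R v" using pos by (simp add: field_simps)
  then show ?thesis using that[of "a / b"] pos by simp
qed

text \<open>Pigeonhole: \<open>N\<close> is the number of balls of radius \<open>d / 2\<close> in a
  cover, and \<open>N + 1\<close> points are placed. It depends only on \<open>A\<close> and
  \<open>d\<close>, which matters because \<open>atom_fixed\<close> chooses its time step after
  \<open>N\<close>.\<close>

lemma compact_no_separated: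
  fixes A :: "'a set"
  assumes "compact A"  "0 < d"
  shows "\<exists>N :: nat. \<forall>f. (\<forall>i\<le>N. f i \<in> A) \<longrightarrow> (\<exists>i j. i < j \<and> j \<le> N \<and> dist (f i) (f j) < d)"
proof -
  obtain k where k: "finite k" "A \<subseteq> (\<Union>c\<in>k. ball c (d / 2))"
    using assms(2) assms(1)[unfolded compact_eq_totally_bounded, THEN conjunct2, rule_format, of "d / 2"] by auto
  have "\<exists>i j. i < j \<and> j \<le> card k \<and> dist (f i) (f j) < d" if f: "\<And>i. i \<le> card k \<Longrightarrow> f i \<in> A" for f
  proof -
    have "\<exists>c. i \<le> card k \<longrightarrow> c \<in> k \<and> dist c (f i) < d / 2" for i
    proof (cases "i \<le> card k")
      case True
      then obtain c where "c \<in> k" "f i \<in> ball c (d / 2)" using f[of i] k(2) by blast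
      then show ?thesis by auto
    qed simp
    then obtain g where g: "\<And>i. i \<le> card k \<Longrightarrow> g i \<in> k \<and> dist (g i) (f i) < d / 2" by metis
    have "\<not> inj_on g {..card k}"
    proof
      assume "inj_on g {..card k}"
      then have "card {..card k} \<le> card k" using g k(1) by (intro card_inj_on_le[of g]) auto
      then show False by simp
    qed
    then obtain i j where ij: "i \<le> card k" "j \<le> card k" "i \<noteq> j" "g i = g j" by (auto simp: inj_on_def)
    have close: "dist (f i) (f j) < d"
      using dist_triangle3[of "f i" "f j" "g i"] g[OF ij(1)] g[OF ij(2)] ij(4) by simp
    consider "i < j" | "j < i" using ij(3) by linarith
    then show ?thesis
    proof cases
      case 1
      then show ?thesis using close ij(2) by blast
    next
      case 2
      then show ?thesis using close ij(1) by (metis dist_commute)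
    qed
  qed
  then show ?thesis by blast
qed

text \<open>Two disjoint elements of \<open>X\<close> are far apart in norm, so by compactness the orbit of an atom under
  \<open>T r\<close> returns to the same ray after at most \<open>N\<close> steps, with \<open>N\<close> independent of \<open>r\<close>; taking
  \<open>r = t / N!\<close> shows that \<open>T t\<close> fixes the atom.\<close>

lemma atom_fixed:
  assumes v: "atom v" "v \<le> y" and t: "0 < t"
  shows "blinfun_apply (T t) v = v"
proof -
  have v0: "blinfun_apply P v = v" "0 \<le> v" "v \<noteq> 0" using v by (auto simp: atom_def)
  have M: "0 < M"
  proof -
    have "norm v \<le> M * norm v" using norm_P[of v] v0 by simp
    then show ?thesis using v0 M_nonneg by (cases "M = 0") auto
  qed
  \<comment> \<open>One factor \<open>M\<close> is lost in the norm of \<open>P\<close> and one in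
    \<open>X_norm_T\<close>, which bounds orbit vectors from below.\<close>
  define d where "d = norm v / (M * M)"
  have d: "0 < d" using v0 M by (simp add: d_def)
  obtain N :: nat where N: "\<forall>f. (\<forall>i\<le>N. f i \<in> I y) \<longrightarrow> (\<exists>i j. i < j \<and> j \<le> N \<and> dist (f i) (f j) < d)"
    using compact_no_separated[OF I_compact[OF order.refl] d] ..
  define r where "r = t / fact N"
  have r: "0 < r" using t by (simp add: r_def)
  have orb: "atom (blinfun_apply (T u) v)" "blinfun_apply (T u) v \<in> I y" if "0 < u" for u
  proof -
    show "atom (blinfun_apply (T u) v)" by (rule atom_T[OF v(1) that])
    then show "blinfun_apply (T u) v \<in> I y"
      using positive_op_mono[OF pos[OF that] v(2)] by (simp add: I_def atom_def fix_y that)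
  qed
  have "\<exists>i j. i < j \<and> j \<le> N \<and>
      dist (blinfun_apply (T (real (Suc i) * r)) v) (blinfun_apply (T (real (Suc j) * r)) v) < d"
    using r by (intro N[rule_format] orb) (simp add: mult_pos_pos)
  then obtain i j where ij: "i < j" "j \<le> N"
    "dist (blinfun_apply (T (real (Suc i) * r)) v) (blinfun_apply (T (real (Suc j) * r)) v) < d" by blast
  let ?x = "blinfun_apply (T (real (Suc i) * r)) v" and ?z = "blinfun_apply (T (real (Suc j) * r)) v"
  have ir: "0 < real (Suc i) * r" and jr: "0 < real (Suc j) * r" using r by simp_all
  have "\<not> dj ?x ?z"
  proof
    assume "dj ?x ?z"
    then have "blinfun_apply P \<bar>?x - ?z\<bar> = ?x + ?z"
      using orb[OF ir] orb[OF jr] by (intro P_abs_diff_dj) (auto simp: atom_def)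
    moreover have "norm ?x \<le> norm (?x + ?z)"
      using orb[OF ir] orb[OF jr] by (intro norm_mono_pos) (auto simp: atom_def)
    ultimately have "norm ?x \<le> M * norm \<bar>?x - ?z\<bar>" using norm_P[of "\<bar>?x - ?z\<bar>"] by simp
    then have x: "norm ?x \<le> M * dist ?x ?z" by (simp only: norm_abs dist_norm)
    have "norm v \<le> M * norm ?x" using X_norm_T[OF _ ir] v0 by simp
    also have "\<dots> \<le> M * (M * dist ?x ?z)" using x M by (intro mult_left_mono) auto
    also have "\<dots> < M * (M * d)" using ij(3) M by (intro mult_strict_left_mono) auto
    also have "\<dots> = norm v" using M by (simp add: d_def)
    finally show False by simp
  qed
  then obtain c where c: "0 < c" "?z = c *\<^sub>R ?x" using atoms_proportional[OF orb(1)[OF ir] orb(1)[OF jr]] by blast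
  define k where "k = j - i"
  have k: "1 \<le> k" "k \<le> N" using ij by (auto simp: k_def)
  have kr: "0 < real k * r" using k r by simp
  have kv: "blinfun_apply (T (real k * r)) v = c *\<^sub>R v"
  proof -
    have "real (Suc j) * r = real (Suc i) * r + real k * r" using ij by (simp add: k_def of_nat_diff algebra_simps)
    then have "?z = blinfun_apply (T (real (Suc i) * r)) (blinfun_apply (T (real k * r)) v)"
      using semigroup[OF ir kr, of v] by simp
    then have "blinfun_apply (T (real (Suc i) * r)) (blinfun_apply (T (real k * r)) v - c *\<^sub>R v) = 0"
      using c by (simp add: blinfun.diff_right blinfun.scaleR_right)
    moreover have "blinfun_apply (T (real k * r)) v - c *\<^sub>R v \<in> X"
      using X_diff[OF X_T[OF _ kr] X_scale] v0(1) by blast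
    ultimately have "blinfun_apply (T (real k * r)) v - c *\<^sub>R v = 0" using X_T_inj[OF _ ir] by blast
    then show ?thesis by simp
  qed
  have pow: "blinfun_apply (T (real (Suc n) * (real k * r))) v = c ^ Suc n *\<^sub>R v" for n
  proof (induction n)
    case 0
    then show ?case by (simp add: kv)
  next
    case (Suc n)
    have nkr: "0 < real (Suc n) * (real k * r)" using kr by simp
    have "real (Suc (Suc n)) * (real k * r) = real k * r + real (Suc n) * (real k * r)" by (simp add: algebra_simps)
    then have "blinfun_apply (T (real (Suc (Suc n)) * (real k * r))) v =
        blinfun_apply (T (real k * r)) (c ^ Suc n *\<^sub>R v)"
      using semigroup[OF kr nkr, of v] Suc by simp
    then show ?case by (simp add: blinfun.scaleR_right kv)
  qed
  have nv: "0 < norm v" using v0 by simp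
  \<comment> \<open>All powers of \<open>c\<close> stay between two positive bounds, so
    \<open>c = 1\<close>.\<close>
  have upper: "c ^ Suc n \<le> M" and lower: "1 \<le> M * c ^ Suc n" for n
  proof -
    have u: "0 < real (Suc n) * (real k * r)" using kr by simp
    have "c ^ Suc n * norm v \<le> M * norm v" using norm_T[OF u, of v] c by (simp add: pow del: power_Suc of_nat_Suc)
    then show "c ^ Suc n \<le> M" using nv mult_le_cancel_right_pos by blast
    have "1 * norm v \<le> (M * c ^ Suc n) * norm v"
      using X_norm_T[OF _ u, of v] v0 c by (simp add: pow mult.assoc del: power_Suc of_nat_Suc)
    then show "1 \<le> M * c ^ Suc n" using nv mult_le_cancel_right_pos by blast
  qed
  have "\<not> 1 < c"
  proof
    assume "1 < c"
    then obtain n where n: "M < c ^ n" using real_arch_pow by blast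
    also have "\<dots> \<le> c ^ Suc n" using \<open>1 < c\<close> by (intro power_increasing) auto
    finally show False using upper[of n] by simp
  qed
  moreover have "\<not> c < 1"
  proof
    assume "c < 1"
    then obtain n where n: "c ^ n < 1 / M" using real_arch_pow_inv[of "1 / M" c] M by auto
    have "c ^ Suc n \<le> c ^ n" using \<open>c < 1\<close> c by (intro power_decreasing) auto
    then have "M * c ^ Suc n < M * (1 / M)" using n M by (intro mult_strict_left_mono) auto
    then show False using lower[of n] M by simp
  qed
  ultimately have "c = 1" by simp
  \<comment> \<open>The return time \<open>k * r\<close> depends on the atom, but \<open>k\<close>
    is at most \<open>N\<close>, so \<open>t = fact N * r\<close> is always a multiple of
    it.\<close>
  have "k dvd fact N" using k by (intro dvd_fact) auto
  then obtain q where q: "fact N = k * q" by blast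
  have "q \<noteq> 0" using q fact_nonzero[of N, where 'a=nat] by (metis mult_0_right)
  then obtain p where p: "q = Suc p" by (cases q) auto
  have fact_eq: "(fact N :: real) = real k * real (Suc p)"
    using q p by (metis of_nat_fact of_nat_mult)
  have "t = fact N * r" by (simp add: r_def)
  then have "t = real (Suc p) * (real k * r)" by (simp only: fact_eq mult_ac)
  then show ?thesis using pow[of p] \<open>c = 1\<close> by simp
qed

end

section \<open>Components and atoms, measured by a strictly positive functional\<close>

locale kernel_semigroup_limit = semigroup_limit_projection T M s y P m
  for T :: "real \<Rightarrow> 'a::banach_lattice \<Rightarrow>\<^sub>L 'a" and M s y P m +
  fixes \<psi> :: "'a \<Rightarrow>\<^sub>L real"
  assumes \<psi>: "positive_functional \<psi>"
    and strict: "0 \<le> x \<Longrightarrow> x \<le> y \<Longrightarrow> blinfun_apply \<psi> x = 0 \<Longrightarrow> blinfun_apply (T s) x = 0"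
begin

lemma \<psi>_nonneg: "x \<in> I v \<Longrightarrow> 0 \<le> blinfun_apply \<psi> x"
  using positive_functional_nonneg[OF \<psi>] by (simp add: I_def)

lemma \<psi>_strict: "x \<in> I y \<Longrightarrow> blinfun_apply \<psi> x \<le> 0 \<Longrightarrow> x = 0"
  using strict[of x] \<psi>_nonneg[of x y] X_T_inj[of x s] s by (auto simp: I_def)

lemma continuous_\<psi> [continuous_intros]: "continuous_on S f \<Longrightarrow> continuous_on S (\<lambda>x. blinfun_apply \<psi> (f x))"
  by (rule bounded_linear.continuous_on[OF blinfun.bounded_linear_right])

text \<open>No band projections are available in \<open>X\<close>. A component is obtained instead
  by maximising the total \<open>\<psi>\<close>-mass over the compact set of disjoint pairs above
  the given one: by strict positivity the maximal pair must exhaust \<open>v\<close>.\<close>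

lemma extend_disjoint_pair:
  assumes v: "v \<in> I y" and ab: "a0 \<in> I v" "b0 \<in> I v" "a0 \<noteq> 0" "b0 \<noteq> 0" "dj a0 b0"
  obtains a where "a \<in> I v" "dj a (v - a)" "a \<noteq> 0" "v - a \<noteq> 0"
proof -
  have v0: "blinfun_apply P v = v" "0 \<le> v" "v \<le> y" using v by (auto simp: I_def)
  define Z where "Z = (I v \<times> I v) \<inter> {z. a0 \<le> fst z} \<inter> {z. b0 \<le> snd z} \<inter> {z. blinfun_apply P (inf (fst z) (snd z)) = 0}"
  have cl: "closed {z :: 'a \<times> 'a. a0 \<le> fst z}" "closed {z :: 'a \<times> 'a. b0 \<le> snd z}"
    using closed_vimage[OF closed_le_lattice[of a0], of fst] closed_vimage[OF closed_le_lattice[of b0], of snd]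
    by (simp_all add: vimage_def continuous_on_fst continuous_on_snd continuous_on_id)
  have "closed {z. blinfun_apply P (inf (fst z) (snd z)) = 0}"
    by (intro closed_Collect_eq continuous_intros)
  then have "compact Z"
    unfolding Z_def using I_compact[OF v0(3)] cl
    by (intro compact_Int_closed compact_Times) auto
  moreover have "(a0, b0) \<in> Z" using ab by (simp add: Z_def dj_def)
  then have "Z \<noteq> {}" by blast
  moreover have "continuous_on Z (\<lambda>z. blinfun_apply \<psi> (fst z) + blinfun_apply \<psi> (snd z))"
    by (intro continuous_intros)
  ultimately obtain z where z: "z \<in> Z"
    "\<And>w. w \<in> Z \<Longrightarrow> blinfun_apply \<psi> (fst w) + blinfun_apply \<psi> (snd w) \<le> blinfun_apply \<psi> (fst z) + blinfun_apply \<psi> (snd z)"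
    using continuous_attains_sup[of Z] by blast
  obtain a b where z_ab: "z = (a, b)" by (cases z)
  have a: "a \<in> I v" "a0 \<le> a" and b: "b \<in> I v" "b0 \<le> b" and dj: "dj a b"
    using z(1) by (auto simp: Z_def z_ab dj_def)
  have a': "0 \<le> a" "blinfun_apply P a = a" and b': "0 \<le> b" "blinfun_apply P b = b" using a b by (auto simp: I_def)
  have max: "blinfun_apply \<psi> c + blinfun_apply \<psi> d \<le> blinfun_apply \<psi> a + blinfun_apply \<psi> b"
    if "c \<in> I v" "d \<in> I v" "a \<le> c" "b \<le> d" "dj c d" for c d
    using z(2)[of "(c, d)"] that a(2) b(2) by (auto simp: Z_def z_ab dj_def intro: order.trans)
  define w where "w = v - a - b"
  have w0: "0 \<le> w" using dj_sum_le[OF a(1) b(1) dj v0(1)] by (simp add: w_def le_diff_eq add.commute)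
  have wX: "blinfun_apply P w = w" using a' b' v0 by (simp add: w_def blinfun.diff_right)
  have "w \<le> v" using a' b' by (simp add: w_def diff_le_eq add_increasing2)
  then have wI: "w \<in> I y" using w0 wX v0 by (auto simp: I_def)
  \<comment> \<open>The common part of \<open>w\<close> and \<open>a\<close> could be added to
    \<open>a\<close>: it fits below \<open>v - b\<close> because it is below \<open>w\<close>, and
    it is disjoint from \<open>b\<close> because it is below \<open>a\<close>. Maximality leaves
    only 0.\<close>
  have dj_wa: "dj w a"
  proof -
    let ?g = "blinfun_apply P (inf w a)"
    have g: "?g \<in> I w" "?g \<le> a" using P_inf_I[OF wI a'(1)] P_mono[of "inf w a" a] a' by auto
    then have g0: "0 \<le> ?g" "?g \<le> w" by (auto simp: I_def)
    have "a + ?g \<le> v - b" using add_left_mono[OF g0(2), of a] by (simp add: w_def algebra_simps)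
    then have "a + ?g \<in> I v" using g g0 a' b' by (auto simp: I_def blinfun.add_right idem intro: order.trans[of _ "v - b"])
    moreover have "dj (a + ?g) b" using dj dj_mono[OF dj g0(1) g(2) b'(1) order.refl] a' b' g0 by (intro dj_add)
    ultimately have "blinfun_apply \<psi> ?g \<le> 0" using max[of "a + ?g" b] b(1) g0 by (simp add: blinfun.add_right)
    then have "?g = 0" using \<psi>_strict[OF I_trans[OF g(1) wI]] by blast
    then show ?thesis by (simp add: dj_def)
  qed
  have dj_wb: "dj w b"
  proof -
    let ?g = "blinfun_apply P (inf w b)"
    have g: "?g \<in> I w" "?g \<le> b" using P_inf_I[OF wI b'(1)] P_mono[of "inf w b" b] b' by auto
    then have g0: "0 \<le> ?g" "?g \<le> w" by (auto simp: I_def)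
    have "b + ?g \<le> v - a" using add_left_mono[OF g0(2), of b] by (simp add: w_def algebra_simps)
    then have "b + ?g \<in> I v" using g g0 a' b' by (auto simp: I_def blinfun.add_right idem intro: order.trans[of _ "v - a"])
    moreover have "dj (b + ?g) a"
      using dj dj_mono[OF dj a'(1) order.refl g0(1) g(2)] a' b' g0 by (intro dj_add) (simp_all add: dj_commute)
    ultimately have "blinfun_apply \<psi> ?g \<le> 0" using max[of a "b + ?g"] a(1) g0 by (simp add: blinfun.add_right dj_commute)
    then have "?g = 0" using \<psi>_strict[OF I_trans[OF g(1) wI]] by blast
    then show ?thesis by (simp add: dj_def)
  qed
  \<comment> \<open>Now that \<open>w\<close> is disjoint from \<open>b\<close>, the whole of
    \<open>w\<close> could be added to \<open>a\<close>.\<close>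
  have "a + w \<in> I v" using I_diff[OF b(1) v0(1)] by (simp add: w_def)
  moreover have "dj (a + w) b" using dj dj_wb a' b' w0 by (intro dj_add)
  ultimately have "blinfun_apply \<psi> w \<le> 0" using max[of "a + w" b] b(1) w0 by (simp add: blinfun.add_right)
  then have "w = 0" using \<psi>_strict[OF wI] by blast
  then have "v - a = b" by (simp add: w_def)
  moreover have "a \<noteq> 0" "b \<noteq> 0" using a b ab by (auto simp: I_def)
  ultimately show ?thesis using that[of a] a dj by simp
qed

text \<open>Maximise the smaller of the two masses over all components \<open>a\<close>. If it were
  below a quarter, the large part \<open>b\<close> could be split, and moving the lighter piece
  \<open>c\<close> to \<open>a\<close> would leave at least half of \<open>b\<close>, more than 3/8
  of the mass, on the other side: a better balance. Any constant up to 1/3 would do.\<close>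

lemma balanced_split:
  assumes v: "v \<in> I y" and no_atom: "\<And>w. w \<in> I v \<Longrightarrow> \<not> atom w"
  obtains a where "a \<in> I v" "dj a (v - a)"
    "blinfun_apply \<psi> v / 4 \<le> blinfun_apply \<psi> a" "blinfun_apply \<psi> v / 4 \<le> blinfun_apply \<psi> (v - a)"
proof -
  have v0: "blinfun_apply P v = v" "0 \<le> v" "v \<le> y" using v by (auto simp: I_def)
  define Z where "Z = I v \<inter> {a. blinfun_apply P (inf a (v - a)) = 0}"
  have Z_iff: "a \<in> Z \<longleftrightarrow> a \<in> I v \<and> dj a (v - a)" for a by (auto simp: Z_def dj_def)
  have "closed {a. blinfun_apply P (inf a (v - a)) = 0}" by (intro closed_Collect_eq continuous_intros)
  then have "compact Z" unfolding Z_def by (intro compact_Int_closed I_compact v0(3))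
  moreover have "0 \<in> Z" using v0 by (simp add: Z_iff I_def dj_zero blinfun.zero_right)
  then have "Z \<noteq> {}" by blast
  moreover have "continuous_on Z (\<lambda>a. min (blinfun_apply \<psi> a) (blinfun_apply \<psi> (v - a)))"
    by (intro continuous_intros)
  ultimately obtain a1 where a1: "a1 \<in> Z" "\<And>c. c \<in> Z \<Longrightarrow> min (blinfun_apply \<psi> c) (blinfun_apply \<psi> (v - c)) \<le> min (blinfun_apply \<psi> a1) (blinfun_apply \<psi> (v - a1))"
    using continuous_attains_sup[of Z] by blast
  have swap: "v - c \<in> Z" if "c \<in> Z" for c using that I_diff[of c v] v0 by (simp add: Z_iff dj_commute)
  obtain a where a: "a \<in> Z" "blinfun_apply \<psi> a \<le> blinfun_apply \<psi> (v - a)"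
    "\<And>c. c \<in> Z \<Longrightarrow> min (blinfun_apply \<psi> c) (blinfun_apply \<psi> (v - c)) \<le> blinfun_apply \<psi> a"
  proof (cases "blinfun_apply \<psi> a1 \<le> blinfun_apply \<psi> (v - a1)")
    case True
    then show ?thesis using that[of a1] a1 by simp
  next
    case False
    then show ?thesis using that[of "v - a1"] a1 swap[OF a1(1)] by (simp add: min.commute)
  qed
  have aI: "a \<in> I v" "dj a (v - a)" using a(1) by (auto simp: Z_iff)
  have "blinfun_apply \<psi> v / 4 \<le> blinfun_apply \<psi> a"
  proof (rule ccontr)
    assume small: "\<not> blinfun_apply \<psi> v / 4 \<le> blinfun_apply \<psi> a"
    define b where "b = v - a"
    have bI: "b \<in> I v" using I_diff[OF aI(1) v0(1)] by (simp add: b_def)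
    have a': "0 \<le> a" "blinfun_apply P a = a" and b': "0 \<le> b" "blinfun_apply P b = b" using aI bI by (auto simp: I_def)
    have \<psi>v: "blinfun_apply \<psi> v = blinfun_apply \<psi> a + blinfun_apply \<psi> b" by (simp add: b_def blinfun.diff_right)
    have "0 \<le> blinfun_apply \<psi> v" using \<psi>_nonneg[OF v] .
    then have "b \<noteq> 0" using small \<psi>v by (auto simp: blinfun.zero_right)
    then obtain a0 b0 where "a0 \<in> I b" "b0 \<in> I b" "a0 \<noteq> 0" "b0 \<noteq> 0" "dj a0 b0"
      using no_atom[OF bI] b' by (auto simp: atom_def)
    then obtain c1 where c1: "c1 \<in> I b" "dj c1 (b - c1)" "c1 \<noteq> 0" "b - c1 \<noteq> 0"
      using extend_disjoint_pair[OF I_trans[OF bI v]] by metis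
    obtain c where c: "c \<in> I b" "dj c (b - c)" "c \<noteq> 0" "blinfun_apply \<psi> c \<le> blinfun_apply \<psi> (b - c)"
    proof (cases "blinfun_apply \<psi> c1 \<le> blinfun_apply \<psi> (b - c1)")
      case True
      then show ?thesis using that[of c1] c1 by simp
    next
      case False
      then show ?thesis using that[of "b - c1"] c1 I_diff[OF c1(1) b'(2)] by (simp add: dj_commute)
    qed
    have c': "0 \<le> c" "c \<le> b" "blinfun_apply P c = c" using c(1) by (auto simp: I_def)
    have \<psi>c: "0 < blinfun_apply \<psi> c"
      using \<psi>_strict[of c] c(3) I_trans[OF c(1) I_trans[OF bI v]] by force
    have ac: "a + c \<in> Z"
    proof -
      have "a + c \<in> I v" using a' c' add_left_mono[OF c'(2), of a] by (simp add: I_def b_def blinfun.add_right)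
      moreover have "dj (a + c) (b - c)"
      proof (rule dj_add)
        show "dj a (b - c)" using dj_mono[OF aI(2) a'(1) order.refl, of "b - c"] c' by (simp add: b_def)
      qed (use c a' c' in auto)
      then have "dj (a + c) (v - (a + c))" by (simp add: b_def algebra_simps)
      ultimately show ?thesis by (simp add: Z_iff)
    qed
    have eq: "v - (a + c) = b - c" by (simp add: b_def)
    \<comment> \<open>The mass of \<open>a + c\<close> strictly exceeds that of \<open>a\<close>, so
      the minimum in the maximality statement must be attained by \<open>b - c\<close>.\<close>
    from a(3)[OF ac] have "blinfun_apply \<psi> (b - c) \<le> blinfun_apply \<psi> a"
      using \<psi>c unfolding eq by (auto simp: blinfun.add_right min_le_iff_disj)
    then show False using small c(4) \<psi>v \<psi>_nonneg[OF aI(1)] by (simp add: blinfun.diff_right)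
  qed
  then show ?thesis using that[of a] aI a(2) by simp
qed

text \<open>A Rademacher-type argument: without atoms below \<open>u\<close> there are infinitely many components of \<open>u\<close>
  at mutual distance bounded from below, against compactness.\<close>

lemma far_component:
  assumes u: "u \<in> I y" and no_atom: "\<And>w. w \<in> I u \<Longrightarrow> \<not> atom w"
    and F: "finite F" "\<And>d. d \<in> F \<Longrightarrow> d \<in> I u \<and> dj d (u - d)" and v: "v \<in> I u"
  shows "\<exists>c\<in>I v. dj c (v - c) \<and> blinfun_apply \<psi> v / 4 \<le> blinfun_apply \<psi> c \<and>
    blinfun_apply \<psi> v / 4 \<le> blinfun_apply \<psi> (v - c) \<and>
    (\<forall>d\<in>F. blinfun_apply \<psi> v / 4 \<le> blinfun_apply \<psi> (blinfun_apply P \<bar>c - blinfun_apply P (inf d v)\<bar>))"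
  using F v
proof (induction F arbitrary: v rule: finite_induct)
  case empty
  have "v \<in> I y" using I_trans[OF empty(2) u] .
  moreover have "\<not> atom w" if "w \<in> I v" for w using no_atom I_trans[OF that empty(2)] by blast
  ultimately obtain a where "a \<in> I v" "dj a (v - a)"
    "blinfun_apply \<psi> v / 4 \<le> blinfun_apply \<psi> a" "blinfun_apply \<psi> v / 4 \<le> blinfun_apply \<psi> (v - a)"
    by (rule balanced_split)
  then show ?case by blast
next
  case (insert d F)
  note v = insert.prems(2)
  have v0: "blinfun_apply P v = v" "0 \<le> v" "v \<le> u" using v by (auto simp: I_def)
  have d: "d \<in> I u" "dj d (u - d)" using insert.prems(1) by auto
  have d0: "0 \<le> d" "blinfun_apply P d = d" "d \<le> u" using d by (auto simp: I_def)
  \<comment> \<open>Cut \<open>v\<close> into its part inside \<open>d\<close> and its part outside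
    \<open>d\<close>, treat both by induction, and recombine. This is why \<open>v\<close> varies
    while \<open>u\<close> stays fixed.\<close>
  define v1 where "v1 = blinfun_apply P (inf v d)"
  define v2 where "v2 = v - v1"
  have v1: "v1 \<in> I v" "v1 \<in> I d" unfolding v1_def using P_inf_I[OF v d0(1)] P_inf_commute_I[OF d(1) v0(2)] by auto
  have v2: "v2 \<in> I v" unfolding v2_def by (rule I_diff[OF v1(1) v0(1)])
  have v1': "0 \<le> v1" "v1 \<le> v" "v1 \<le> d" "blinfun_apply P v1 = v1" and v2': "0 \<le> v2" "v2 \<le> v" "blinfun_apply P v2 = v2"
    using v1 v2 by (auto simp: I_def)
  have v_eq: "v = v1 + v2" by (simp add: v2_def)
  have "v2 \<le> u - d"
  proof -
    have "v2 = blinfun_apply P (pprt (v - d))" by (simp add: v2_def v1_def pprt_eq_sub_inf blinfun.diff_right v0)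
    also have "\<dots> \<le> blinfun_apply P (u - d)" using v0 d0 by (intro P_mono) (simp add: pprt_def diff_right_mono)
    also have "\<dots> = u - d" using d0 u by (simp add: blinfun.diff_right I_def)
    finally show ?thesis .
  qed
  then have dj_dv2: "dj d v2" using dj_mono[OF d(2) d0(1) order.refl v2'(1)] by blast
  then have dj12: "dj v1 v2" using dj_mono[of d v2 v1 v2] v1' v2' by simp
  have F: "\<And>d. d \<in> F \<Longrightarrow> d \<in> I u \<and> dj d (u - d)" using insert.prems(1) by auto
  obtain c1 where c1: "c1 \<in> I v1" "dj c1 (v1 - c1)" "blinfun_apply \<psi> v1 / 4 \<le> blinfun_apply \<psi> c1"
    "blinfun_apply \<psi> v1 / 4 \<le> blinfun_apply \<psi> (v1 - c1)"
    "\<And>d. d \<in> F \<Longrightarrow> blinfun_apply \<psi> v1 / 4 \<le> blinfun_apply \<psi> (blinfun_apply P \<bar>c1 - blinfun_apply P (inf d v1)\<bar>)"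
    using insert.IH[OF F I_trans[OF v1(1) v]] by blast
  obtain c2 where c2: "c2 \<in> I v2" "dj c2 (v2 - c2)" "blinfun_apply \<psi> v2 / 4 \<le> blinfun_apply \<psi> c2"
    "blinfun_apply \<psi> v2 / 4 \<le> blinfun_apply \<psi> (v2 - c2)"
    "\<And>d. d \<in> F \<Longrightarrow> blinfun_apply \<psi> v2 / 4 \<le> blinfun_apply \<psi> (blinfun_apply P \<bar>c2 - blinfun_apply P (inf d v2)\<bar>)"
    using insert.IH[OF F I_trans[OF v2 v]] by blast
  have c1': "0 \<le> c1" "c1 \<le> v1" "blinfun_apply P c1 = c1" and c2': "0 \<le> c2" "c2 \<le> v2" "blinfun_apply P c2 = c2"
    using c1(1) c2(1) by (auto simp: I_def)
  have \<psi>v: "blinfun_apply \<psi> v = blinfun_apply \<psi> v1 + blinfun_apply \<psi> v2" by (simp add: v_eq blinfun.add_right)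
  define c where "c = c1 + c2"
  have vc: "v - c = (v1 - c1) + (v2 - c2)" by (simp add: v_eq c_def)
  have cI: "c \<in> I v" using c1' c2' by (auto simp: I_def c_def v_eq blinfun.add_right intro: add_mono)
  have cross: "dj a b" if "0 \<le> a" "a \<le> v1" "0 \<le> b" "b \<le> v2" for a b using dj_mono[OF dj12] that by blast
  have dj_c: "dj c (v - c)"
  proof -
    have "dj (c1 + c2) (v1 - c1)"
      using c1(2) cross[of "v1 - c1" c2] c1' c2' by (intro dj_add) (auto simp: dj_commute)
    moreover have "dj (c1 + c2) (v2 - c2)"
      using c2(2) cross[of c1 "v2 - c2"] c1' c2' by (intro dj_add) auto
    ultimately have "dj c ((v1 - c1) + (v2 - c2))"
      using dj_add[of "v1 - c1" "c1 + c2" "v2 - c2"] c1' c2' by (simp add: dj_commute c_def)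
    then show ?thesis by (simp only: vc)
  qed
  have "blinfun_apply \<psi> v / 4 \<le> blinfun_apply \<psi> c"
    using c1(3) c2(3) \<psi>v by (simp add: c_def blinfun.add_right)
  moreover have "blinfun_apply \<psi> v / 4 \<le> blinfun_apply \<psi> (v - c)"
    using c1(4) c2(4) \<psi>v unfolding vc by (simp add: blinfun.add_right)
  \<comment> \<open>Inside \<open>d\<close> the difference to \<open>d\<close> is what
    \<open>c1\<close> omits, outside it is \<open>c2\<close>; these are disjoint, and each has at
    least a quarter of the mass of its piece.\<close>
  moreover have "blinfun_apply \<psi> v / 4 \<le> blinfun_apply \<psi> (blinfun_apply P \<bar>c - blinfun_apply P (inf d v)\<bar>)"
  proof -
    have "blinfun_apply P (inf d v) = v1" by (simp add: v1_def inf_commute)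
    then have "c - blinfun_apply P (inf d v) = c2 - (v1 - c1)" by (simp add: c_def)
    moreover have "blinfun_apply P \<bar>c2 - (v1 - c1)\<bar> = c2 + (v1 - c1)"
      using cross[of "v1 - c1" c2] c1' c2' v1' by (intro P_abs_diff_dj) (auto simp: dj_commute blinfun.diff_right)
    ultimately show ?thesis using c1(4) c2(3) \<psi>v by (simp add: blinfun.add_right)
  qed
  moreover have "blinfun_apply \<psi> v / 4 \<le> blinfun_apply \<psi> (blinfun_apply P \<bar>c - blinfun_apply P (inf d' v)\<bar>)"
    if d': "d' \<in> F" for d'
  proof -
    have d'0: "0 \<le> d'" "d' \<in> I u" using F[OF d'] by (auto simp: I_def)
    define x1 where "x1 = c1 - blinfun_apply P (inf d' v1)"
    define x2 where "x2 = c2 - blinfun_apply P (inf d' v2)"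
    have ax: "\<bar>p - q\<bar> \<le> w" if "0 \<le> p" "p \<le> w" "0 \<le> q" "q \<le> w" for p q w :: 'a
      using that diff_mono[of p w 0 q] diff_mono[of q w 0 p] by (intro abs_leI) auto
    have x: "\<bar>x1\<bar> \<le> v1" "\<bar>x2\<bar> \<le> v2"
      unfolding x1_def x2_def using c1' c2' P_inf_commute_I[OF v1(1) d'0(1)] P_inf_commute_I[OF v2 d'0(1)]
      by (auto intro!: ax simp: I_def)
    have "c - blinfun_apply P (inf d' v) = x1 + x2"
      using P_inf_add_dj[OF dj12 v1'(1) v2'(1) d'0(1)] by (simp add: x1_def x2_def c_def v_eq)
    \<comment> \<open>\<open>x1\<close> and \<open>x2\<close> live on the disjoint pieces
      \<open>v1\<close> and \<open>v2\<close>, so under \<open>P\<close> the correction term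
      disappears and the two distances add up.\<close>
    moreover have "\<bar>x1\<bar> + \<bar>x2\<bar> - 2 *\<^sub>R inf \<bar>x1\<bar> \<bar>x2\<bar> \<le> \<bar>x1 + x2\<bar>"
      using abs_triangle_ineq3[of x1 "- x2"] by (simp add: abs_diff_inf)
    then have "blinfun_apply P \<bar>x1\<bar> + blinfun_apply P \<bar>x2\<bar> \<le> blinfun_apply P \<bar>x1 + x2\<bar>"
      using P_mono[of "\<bar>x1\<bar> + \<bar>x2\<bar> - 2 *\<^sub>R inf \<bar>x1\<bar> \<bar>x2\<bar>" "\<bar>x1 + x2\<bar>"] cross[of "\<bar>x1\<bar>" "\<bar>x2\<bar>"] x
      by (simp add: blinfun.diff_right blinfun.add_right blinfun.scaleR_right dj_def)
    then have "blinfun_apply \<psi> (blinfun_apply P \<bar>x1\<bar> + blinfun_apply P \<bar>x2\<bar>) \<le> blinfun_apply \<psi> (blinfun_apply P \<bar>x1 + x2\<bar>)"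
      by (rule positive_functional_mono[OF \<psi>])
    moreover have "blinfun_apply \<psi> v1 / 4 \<le> blinfun_apply \<psi> (blinfun_apply P \<bar>x1\<bar>)"
      "blinfun_apply \<psi> v2 / 4 \<le> blinfun_apply \<psi> (blinfun_apply P \<bar>x2\<bar>)"
      using c1(5)[OF d'] c2(5)[OF d'] by (simp_all add: x1_def x2_def)
    ultimately show ?thesis using \<psi>v by (simp add: blinfun.add_right)
  qed
  ultimately show ?case using cI dj_c by blast
qed

lemma atom_exists:
  assumes u: "u \<in> I y" "u \<noteq> 0"
  shows "\<exists>v\<in>I u. atom v"
proof (rule ccontr)
  assume "\<not> ?thesis"
  then have no_atom: "\<And>w. w \<in> I u \<Longrightarrow> \<not> atom w" by blast
  have u0: "blinfun_apply P u = u" "0 \<le> u" "u \<le> y" using u by (auto simp: I_def)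
  \<comment> \<open>Converts separation in \<open>\<psi>\<close>-mass into separation in norm; the
    summands 1 keep \<open>C\<close> positive.\<close>
  define C where "C = (norm \<psi> + 1) * (M + 1)"
  have C: "0 < C" using M_nonneg by (simp add: C_def add_nonneg_pos)
  have \<psi>P: "blinfun_apply \<psi> (blinfun_apply P \<bar>x\<bar>) \<le> C * norm x" for x
  proof -
    have "blinfun_apply \<psi> (blinfun_apply P \<bar>x\<bar>) \<le> norm \<psi> * norm (blinfun_apply P \<bar>x\<bar>)"
      using norm_blinfun[of \<psi> "blinfun_apply P \<bar>x\<bar>"] by simp
    also have "\<dots> \<le> (norm \<psi> + 1) * ((M + 1) * norm x)"
    proof (rule mult_mono)
      have "norm (blinfun_apply P \<bar>x\<bar>) \<le> M * norm x"
        using norm_P[of "\<bar>x\<bar>"] by (simp only: norm_abs)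
      also have "\<dots> \<le> (M + 1) * norm x" by (intro mult_right_mono) auto
      finally show "norm (blinfun_apply P \<bar>x\<bar>) \<le> (M + 1) * norm x" .
    qed auto
    finally show ?thesis by (simp add: C_def mult.assoc)
  qed
  define d where "d = blinfun_apply \<psi> u / (4 * C)"
  have "0 < blinfun_apply \<psi> u" using \<psi>_strict[OF u(1)] u(2) by force
  then have d: "0 < d" using C by (simp add: d_def)
  define Z where "Z = {c \<in> I u. dj c (u - c)}"
  have step: "\<exists>c\<in>Z. \<forall>e\<in>F. d \<le> dist c e" if F: "finite F" "F \<subseteq> Z" for F
  proof -
    have "\<And>e. e \<in> F \<Longrightarrow> e \<in> I u \<and> dj e (u - e)" using F(2) by (auto simp: Z_def)
    moreover have "u \<in> I u" using u0 by (simp add: I_def)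
    ultimately obtain c where c: "c \<in> I u" "dj c (u - c)"
      "\<And>e. e \<in> F \<Longrightarrow> blinfun_apply \<psi> u / 4 \<le> blinfun_apply \<psi> (blinfun_apply P \<bar>c - blinfun_apply P (inf e u)\<bar>)"
      using far_component[OF u(1) no_atom F(1)] by blast
    have "d \<le> dist c e" if e: "e \<in> F" for e
    proof -
      have "e \<in> I u" using F(2) e by (auto simp: Z_def)
      then have "blinfun_apply P (inf e u) = e" by (simp add: I_def inf_absorb1)
      then have "blinfun_apply \<psi> u / 4 \<le> C * norm (c - e)" using c(3)[OF e] \<psi>P[of "c - e"] by simp
      then show ?thesis using C by (simp add: d_def dist_norm field_simps)
    qed
    then show ?thesis using c by (auto simp: Z_def)
  qed
  obtain N :: nat where N: "\<forall>f. (\<forall>i\<le>N. f i \<in> I u) \<longrightarrow> (\<exists>i j. i < j \<and> j \<le> N \<and> dist (f i) (f j) < d)"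
    using compact_no_separated[OF I_compact[OF u0(3)] d] ..
  have "\<exists>f :: nat \<Rightarrow> 'a. \<forall>n. f n \<in> Z \<and> (\<forall>i<n. d \<le> dist (f n) (f i))"
  proof (rule dependent_wellorder_choice)
    fix r :: 'a and f g :: "nat \<Rightarrow> 'a" and n :: nat
    assume "\<And>i. i < n \<Longrightarrow> f i = g i"
    then show "(r \<in> Z \<and> (\<forall>i<n. d \<le> dist r (f i))) = (r \<in> Z \<and> (\<forall>i<n. d \<le> dist r (g i)))" by simp
  next
    fix n :: nat and f :: "nat \<Rightarrow> 'a"
    assume "\<And>i. i < n \<Longrightarrow> f i \<in> Z \<and> (\<forall>j<i. d \<le> dist (f i) (f j))"
    then show "\<exists>r. r \<in> Z \<and> (\<forall>i<n. d \<le> dist r (f i))" using step[of "f ` {..<n}"] by fastforce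
  qed
  then obtain f :: "nat \<Rightarrow> 'a" where "\<forall>n. f n \<in> Z \<and> (\<forall>i<n. d \<le> dist (f n) (f i))" ..
  then have f: "f n \<in> Z" "i < n \<Longrightarrow> d \<le> dist (f n) (f i)" for n i by blast+
  then have "\<forall>i\<le>N. f i \<in> I u" by (simp add: Z_def)
  then obtain i j where "i < j" "dist (f i) (f j) < d" using N by blast
  then show False using f(2)[of i j] by (simp add: dist_commute)
qed

text \<open>If \<open>a\<close> is an atom below the positive part of \<open>T t x - x\<close>, then \<open>l a \<le> x\<close> implies
  \<open>(l + 1) a \<le> T t x\<close>, hence \<open>(l + 1) a \<le> x\<close> because \<open>T t\<close> fixes \<open>a\<close>; this contradicts
  the Archimedean property.\<close>

lemma T_le_on_X:
  assumes x: "x \<in> I y" and t: "0 < t"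
  shows "blinfun_apply (T t) x \<le> x"
proof -
  have x0: "blinfun_apply P x = x" "0 \<le> x" "x \<le> y" using x by (auto simp: I_def)
  let ?d = "blinfun_apply (T t) x - x"
  have dX: "?d \<in> X" using x0 t by (simp add: blinfun.diff_right P_T)
  let ?w = "blinfun_apply P (pprt ?d)" and ?w' = "blinfun_apply P (pprt (- ?d))"
  have Tx: "0 \<le> blinfun_apply (T t) x" "blinfun_apply (T t) x \<le> y"
    using pos[OF t] x0 positive_op_mono[OF pos[OF t] x0(3)] by (auto simp: positive_op_def fix_y t)
  have d_eq: "?d = ?w - ?w'"
    using arg_cong[OF pprt_diff[of ?d], of "blinfun_apply P"] dX by (simp add: blinfun.diff_right)
  have nn: "0 \<le> ?w" "0 \<le> ?w'" by (simp_all add: P_nonneg)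
  have "pprt ?d \<le> y" using Tx x0 y(1) by (simp add: pprt_def diff_le_eq add_increasing2)
  then have wI: "?w \<in> I y" using P_mono[of "pprt ?d" y] by (simp add: I_def idem P_y nn)
  have "?w = 0"
  proof (rule ccontr)
    assume "?w \<noteq> 0"
    then obtain a where a: "a \<in> I ?w" "atom a" using atom_exists[OF wI] by blast
    have a0: "blinfun_apply P a = a" "0 \<le> a" "a \<le> ?w" "a \<noteq> 0" using a by (auto simp: I_def atom_def)
    have "a \<le> y" using a0(3) wI by (auto simp: I_def)
    then have Ta: "blinfun_apply (T t) a = a" using atom_fixed[OF a(2) _ t] by blast
    have step: "(l + 1) *\<^sub>R a \<le> x" if l: "0 \<le> l" "l *\<^sub>R a \<le> x" for l
    proof -
      have "dj a ?w'" using dj_mono[OF dj_parts[OF dX] a0(2,3) nn(2) order.refl] .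
      then have dj: "dj ((l + 1) *\<^sub>R a) ?w'" using a0 nn l by (intro dj_scale) auto
      have "(l + 1) *\<^sub>R a \<le> x + ?w" using add_mono[OF l(2) a0(3)] by (simp add: scaleR_left_distrib)
      also have "\<dots> = blinfun_apply (T t) x + ?w'" using d_eq by (simp add: algebra_simps)
      finally have "(l + 1) *\<^sub>R a \<le> blinfun_apply (T t) x + ?w'" .
      \<comment> \<open>\<open>a\<close> is below the positive part \<open>?w\<close>, hence
        disjoint from the negative part \<open>?w'\<close>, which can therefore be dropped on the
        right.\<close>
      then have "(l + 1) *\<^sub>R a \<le> blinfun_apply (T t) x"
      proof (rule dj_le_add[OF dj])
        show "(l + 1) *\<^sub>R a \<in> X" using X_scale[of a] a0(1) by blast
        show "blinfun_apply (T t) x \<in> X" using X_T[of x t] x0(1) t by blast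
        show "0 \<le> (l + 1) *\<^sub>R a" using l a0 by (intro scaleR_nonneg_nonneg) auto
      qed (fact Tx(1) nn(2))+
      then show ?thesis
        using X_T_le[OF X_scale[of a "l + 1"] _ t, of x] a0(1) x0(1) by (simp add: blinfun.scaleR_right Ta)
    qed
    have "real n *\<^sub>R a \<le> x" for n
    proof (induction n)
      case 0
      then show ?case using x0 by simp
    next
      case (Suc n)
      then show ?case using step[of "real n"] by (simp add: add.commute)
    qed
    then have "a \<le> 0" by (rule archimedean_lattice)
    then show False using a0 by simp
  qed
  then have "?d = - ?w'" using d_eq by (metis diff_0)
  then have "?d \<le> 0" using nn(2) by (metis neg_le_0_iff_le)
  then show ?thesis by simp
qed

section \<open>From order intervals of \<open>X\<close> to convergence on the whole space\<close>

lemma T_fixes_X: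
  assumes x: "x \<in> I y" and t: "0 < t"
  shows "blinfun_apply (T t) x = x"
proof (rule order.antisym)
  show "blinfun_apply (T t) x \<le> x" by (rule T_le_on_X[OF x t])
  \<comment> \<open>The reverse inequality is the same estimate for the complement of
    \<open>x\<close> in the fixed vector \<open>y\<close>.\<close>
  have "blinfun_apply (T t) (y - x) \<le> y - x" by (intro T_le_on_X I_diff x P_y t)
  then show "x \<le> blinfun_apply (T t) x" by (simp add: blinfun.diff_right fix_y t)
qed

lemma P_range_fixed:
  assumes t: "0 < t" shows "blinfun_apply (T t) (blinfun_apply P x) = blinfun_apply P x"
proof -
  have interval: "blinfun_apply (T t) (blinfun_apply P x) = blinfun_apply P x" if x: "0 \<le> x" "x \<le> y" for x
    using that P_mono[of x y] by (intro T_fixes_X t) (simp add: I_def idem P_nonneg P_y)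
  have pos: "blinfun_apply (T t) (blinfun_apply P x) = blinfun_apply P x" if x: "0 \<le> x" "x \<le> c *\<^sub>R y" "0 \<le> c" for x c
  proof -
    have "x \<le> (c + 1) *\<^sub>R y" using x y(1) by (simp add: scaleR_left_distrib add_increasing2)
    then have "inverse (c + 1) *\<^sub>R x \<le> inverse (c + 1) *\<^sub>R (c + 1) *\<^sub>R y"
      using x by (intro scaleR_left_mono) auto
    then have "blinfun_apply (T t) (blinfun_apply P (inverse (c + 1) *\<^sub>R x)) = blinfun_apply P (inverse (c + 1) *\<^sub>R x)"
      using x by (intro interval) (auto intro: scaleR_nonneg_nonneg)
    then show ?thesis using x by (simp add: blinfun.scaleR_right)
  qed
  have "blinfun_apply (T t) (blinfun_apply P x) = blinfun_apply P x" if x: "x \<in> principal_ideal y" for x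
  proof -
    obtain c where c: "0 \<le> c" "\<bar>x\<bar> \<le> c *\<^sub>R y" using x by (auto simp: principal_ideal_def)
    have "pprt x \<le> \<bar>x\<bar>" "pprt (- x) \<le> \<bar>x\<bar>" by (simp_all add: abs_eq_pprt)
    then have "pprt x \<le> c *\<^sub>R y" "pprt (- x) \<le> c *\<^sub>R y" using c(2) order.trans by blast+
    then have "blinfun_apply (T t) (blinfun_apply P (pprt x - pprt (- x))) = blinfun_apply P (pprt x - pprt (- x))"
      using pos[of "pprt x" c] pos[of "pprt (- x)" c] c(1) by (simp add: blinfun.diff_right)
    then show ?thesis by (simp add: pprt_diff)
  qed
  moreover have "closed {x. blinfun_apply (T t) (blinfun_apply P x) = blinfun_apply P x}"
    by (intro closed_Collect_eq bounded_linear.continuous_on[OF blinfun.bounded_linear_right] continuous_intros)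
  ultimately have "closure (principal_ideal y) \<subseteq> {x. blinfun_apply (T t) (blinfun_apply P x) = blinfun_apply P x}"
    by (intro closure_minimal) auto
  then show ?thesis using y(2) by blast
qed

text \<open>As \<open>T\<close> fixes the range of \<open>P\<close>, the error at time
  \<open>t > m k\<close> is the image under \<open>T (t - m k)\<close> of the error at time
  \<open>m k\<close>, so it is at most \<open>M\<close> times as large. One good index
  \<open>k\<close> controls all later times.\<close>

lemma T_tendsto_P: "((\<lambda>t. blinfun_apply (T t) x) \<longlongrightarrow> blinfun_apply P x) at_top"
proof (rule tendstoI)
  fix e :: real assume e: "0 < e"
  then have "0 < e / (M + 1)" using M_nonneg by simp
  then obtain k where k: "dist (blinfun_apply (T (m k)) x) (blinfun_apply P x) < e / (M + 1)"
    using metric_LIMSEQ_D[OF P[of x]] by blast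
  have "dist (blinfun_apply (T t) x) (blinfun_apply P x) < e" if t: "m k < t" for t
  proof -
    have r: "0 < t - m k" using t by simp
    have "blinfun_apply (T t) x = blinfun_apply (T (t - m k)) (blinfun_apply (T (m k)) x)"
      using semigroup[OF r m_pos, of k x] by simp
    then have "dist (blinfun_apply (T t) x) (blinfun_apply P x) \<le> M * dist (blinfun_apply (T (m k)) x) (blinfun_apply P x)"
      using dist_T[OF r, of "blinfun_apply (T (m k)) x" "blinfun_apply P x"] by (simp add: P_range_fixed[OF r])
    also have "\<dots> \<le> (M + 1) * dist (blinfun_apply (T (m k)) x) (blinfun_apply P x)"
      by (intro mult_right_mono) auto
    also have "\<dots> < e" using k M_nonneg by (simp add: field_simps)
    finally show ?thesis .
  qed
  then show "\<forall>\<^sub>F t in at_top. dist (blinfun_apply (T t) x) (blinfun_apply P x) < e"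
    by (rule eventually_mono[OF eventually_gt_at_top[of "m k"]])
qed

end

theorem theorem4p1:
  fixes T :: "real \<Rightarrow> 'a::banach_lattice \<Rightarrow>\<^sub>L 'a"
  assumes "order_continuous_norm TYPE('a)"
    and "one_param_semigroup T"
    and "bounded_semigroup T"
    and "positive_semigroup T"
    and "\<exists>s>0. kernel_op (T s)"
    and "\<exists>y. quasi_interior_fixed_point T y"
  shows "strongly_convergent T"
proof -
  obtain s where ker: "0 < s" "kernel_op (T s)" using assms(5) by blast
  obtain y where fixed: "0 \<le> y" "closure (principal_ideal y) = UNIV" "\<And>t. 0 < t \<Longrightarrow> blinfun_apply (T t) y = y"
    using assms(6) by (auto simp: quasi_interior_fixed_point_def quasi_interior_def)
  obtain M where bdd: "\<And>t. 0 < t \<Longrightarrow> norm (T t) \<le> M"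
    using assms(3) by (auto simp: bounded_semigroup_def bdd_above_def)
  have positive: "positive_op (T t)" if "0 < t" for t using assms(4) that by (simp add: positive_semigroup_def)
  interpret compact_semigroup T M s y
  proof
    show "blinfun_apply (T (t + r)) x = blinfun_apply (T t) (blinfun_apply (T r) x)" if "0 < t" "0 < r" for t r x
      using assms(2) that by (simp add: one_param_semigroup_def)
    show "compact (closure (blinfun_apply (T s) ` {x. \<bar>x\<bar> \<le> y}))"
      by (rule kernel_op_compact[OF assms(1) positive[OF ker(1)] ker(2) fixed(1)])
  qed (fact bdd positive fixed ker(1))+
  obtain P :: "'a \<Rightarrow>\<^sub>L 'a" and m where proj: "\<forall>k. s < m k" "filterlim m at_top sequentially"
    "\<forall>x. (\<lambda>k. blinfun_apply (T (m k)) x) \<longlonglongrightarrow> blinfun_apply P x"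
    "\<forall>x. blinfun_apply P (blinfun_apply P x) = blinfun_apply P x"
    using limit_projection_exists by blast
  obtain \<psi> where functional: "positive_functional \<psi>"
    "\<And>x. 0 \<le> x \<Longrightarrow> x \<le> y \<Longrightarrow> blinfun_apply \<psi> x = 0 \<Longrightarrow> blinfun_apply (T s) x = 0"
    using kernel_op_strictly_positive[OF assms(1) positive[OF ker(1)] ker(2) fixed(1)] by blast
  interpret kernel_semigroup_limit T M s y P m \<psi>
  proof unfold_locales
    show "s < m k" for k by (rule spec[OF proj(1)])
    show "filterlim m at_top sequentially" by (rule proj(2))
    show "(\<lambda>k. blinfun_apply (T (m k)) x) \<longlonglongrightarrow> blinfun_apply P x" for x by (rule spec[OF proj(3)])
    show "blinfun_apply P (blinfun_apply P x) = blinfun_apply P x" for x by (rule spec[OF proj(4)])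
  qed (fact functional)+
  show ?thesis unfolding strongly_convergent_def using T_tendsto_P by blast
qed

end
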